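(* Let $H$ be a semisimple Hopf algebra over an algebraically closed field $k$ of characteristic $0$ and let $n\ge2$. Then the commutator subalgebra $H'$ of $H$ is the algebra generated by the left coideal $$H'_n=z_n\leftharpoonup H^*=\{z_n\leftharpoonup p\mid p\in H^*\},$$ where $z_n\in H$ is the element built from the idempotent integral of $H$ (defined in the context).
   Context: $H$ is finite dimensional with comultiplication $\Delta(h)=\sum h_1\otimes h_2$ (Sweedler notation), counit $\varepsilon$ and antipode $S$. A subspace $N\subseteq H$ is a left coideal if $\Delta(N)\subseteq H\otimes N$; a subalgebra $N$ is normal if $\sum h_1xS(h_2)\in N$ for all $h\in H$, $x\in N$; $N^+=N\cap\ker\varepsilon$. The commutator subalgebra $H'$ of $H$ is the normal left coideal subalgebra of $H$ for which $H/(HH'^+)$ is commutative and which is minimal with respect to this property; equivalently $H'=\{h\in H\mid \sigma\rightharpoonup h=h\ \text{for all }\sigma\in G(H^* )\}$, where $G(H^* )$ is the group of group-like elements of $H^*$ (algebra maps $H\to k$) and $\sigma\rightharpoonup h=\sum\langle\sigma,h_2\rangle h_1$. For $h\in H$, $p\in H^*$: $h\leftharpoonup p=\sum\langle p,h_1\rangle h_2$. $\Lambda$ denotes the idempotent integral of $H$: $h\Lambda=\varepsilon(h)\Lambda=\Lambda h$ for all $h\in H$, $\varepsilon(\Lambda)=1$. Let $\Lambda^1,\Lambda^2,\dots$ be copies of $\Lambda$ with $\Delta(\Lambda^i)=\sum\Lambda^i_1\otimes\Lambda^i_2$. For $n\ge1$, $$z_n=\sum\Lambda^1_1\Lambda^2_1\cdots\Lambda^n_1\,S(\Lambda^1_2)S(\Lambda^2_2)\cdots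 S(\Lambda^n_2).$$ *)

theory Defs
  imports Complex_Main "HOL-Computational_Algebra.Polynomial"
begin

text \<open>
  The libraries have no tensor product of abstract vector spaces. A list
  \<open>[(a\<^sub>1, b\<^sub>1), \<dots>, (a\<^sub>m, b\<^sub>m)]\<close> stands for the formal sum
  \<open>a\<^sub>1 \<otimes> b\<^sub>1 + \<dots> + a\<^sub>m \<otimes> b\<^sub>m\<close>, and two lists denote the same element of \<open>V \<otimes> V\<close> iff
  they are identified by \<open>tensor_eq\<close>. That is, \<open>V \<otimes> V\<close> is the free commutative monoid
  on \<open>V \<times> V\<close> modulo the bilinearity relations. The rule \<open>zero\<close> identifies the
  neutral element of that monoid with \<open>0 \<otimes> b\<close>; negatives are then \<open>(- a) \<otimes> b\<close>.
\<close>

inductive tensor_eq ::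
  "('k::field \<Rightarrow> 'v::ab_group_add \<Rightarrow> 'v) \<Rightarrow> ('v \<times> 'v) list \<Rightarrow> ('v \<times> 'v) list \<Rightarrow> bool"
  for scale where
  refl: "tensor_eq scale xs xs"
| sym: "tensor_eq scale xs ys \<Longrightarrow> tensor_eq scale ys xs"
| trans: "tensor_eq scale xs ys \<Longrightarrow> tensor_eq scale ys zs \<Longrightarrow> tensor_eq scale xs zs"
| append: "tensor_eq scale xs ys \<Longrightarrow> tensor_eq scale us vs \<Longrightarrow> tensor_eq scale (xs @ us) (ys @ vs)"
| comm: "tensor_eq scale (xs @ ys) (ys @ xs)"
| zero: "tensor_eq scale [(0, b)] []"
| add_left: "tensor_eq scale [(a + a', b)] [(a, b), (a', b)]"
| add_right: "tensor_eq scale [(a, b + b')] [(a, b), (a, b')]"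
| scale: "tensor_eq scale [(scale c a, b)] [(a, scale c b)]"

text \<open>The same for \<open>V \<otimes> V \<otimes> V\<close>.\<close>

inductive tensor3_eq ::
  "('k::field \<Rightarrow> 'v::ab_group_add \<Rightarrow> 'v) \<Rightarrow> ('v \<times> 'v \<times> 'v) list \<Rightarrow> ('v \<times> 'v \<times> 'v) list \<Rightarrow> bool"
  for scale where
  refl: "tensor3_eq scale xs xs"
| sym: "tensor3_eq scale xs ys \<Longrightarrow> tensor3_eq scale ys xs"
| trans: "tensor3_eq scale xs ys \<Longrightarrow> tensor3_eq scale ys zs \<Longrightarrow> tensor3_eq scale xs zs"
| append: "tensor3_eq scale xs ys \<Longrightarrow> tensor3_eq scale us vs \<Longrightarrow> tensor3_eq scale (xs @ us) (ys @ vs)"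
| comm: "tensor3_eq scale (xs @ ys) (ys @ xs)"
| zero: "tensor3_eq scale [(0, b, d)] []"
| add_1: "tensor3_eq scale [(a + a', b, d)] [(a, b, d), (a', b, d)]"
| add_2: "tensor3_eq scale [(a, b + b', d)] [(a, b, d), (a, b', d)]"
| add_3: "tensor3_eq scale [(a, b, d + d')] [(a, b, d), (a, b, d')]"
| scale_12: "tensor3_eq scale [(scale c a, b, d)] [(a, scale c b, d)]"
| scale_23: "tensor3_eq scale [(a, scale c b, d)] [(a, b, scale c d)]"

text \<open>
  The finite dimensional Hopf algebra \<open>H\<close> is the whole type \<open>'h\<close>, whose ring structure
  is given by the type class. \<open>comult h\<close> is some formal sum representing \<open>\<Delta>(h)\<close>, so
  the Sweedler expression \<open>\<Sum> f(h\<^sub>1, h\<^sub>2)\<close> is \<open>\<Sum>(a, b)\<leftarrow>comult h. f a b\<close>, and all axioms about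
  \<open>\<Delta>\<close> are stated modulo \<open>tensor_eq\<close>.
\<close>

locale hopf_algebra = vector_space scale
  for scale :: "'k::field \<Rightarrow> 'h::ring_1 \<Rightarrow> 'h" (infixr "*s" 75) +
  fixes comult :: "'h \<Rightarrow> ('h \<times> 'h) list"
    and counit :: "'h \<Rightarrow> 'k"
    and antipode :: "'h \<Rightarrow> 'h"
  assumes finite_dim: "\<exists>B. finite B \<and> span B = UNIV"
    and scale_mult_left: "(c *s x) * y = c *s (x * y)"
    and scale_mult_right: "x * (c *s y) = c *s (x * y)"
    and comult_add: "tensor_eq scale (comult (x + y)) (comult x @ comult y)"
    and comult_scale: "tensor_eq scale (comult (c *s x)) [(c *s a, b). (a, b) \<leftarrow> comult x]"
    and counit_linear: "Vector_Spaces.linear scale (*) counit"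
    and antipode_linear: "Vector_Spaces.linear scale scale antipode"
    and coassoc: "tensor3_eq scale
          [(a\<^sub>1, a\<^sub>2, b). (a, b) \<leftarrow> comult x, (a\<^sub>1, a\<^sub>2) \<leftarrow> comult a]
          [(a, b\<^sub>1, b\<^sub>2). (a, b) \<leftarrow> comult x, (b\<^sub>1, b\<^sub>2) \<leftarrow> comult b]"
    and counit_left: "(\<Sum>(a, b)\<leftarrow>comult x. counit a *s b) = x"
    and counit_right: "(\<Sum>(a, b)\<leftarrow>comult x. counit b *s a) = x"
    and comult_one: "tensor_eq scale (comult 1) [(1, 1)]"
    and comult_mult: "tensor_eq scale (comult (x * y))
          [(a * c, b * d). (a, b) \<leftarrow> comult x, (c, d) \<leftarrow> comult y]"
    and counit_one: "counit 1 = 1"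
    and counit_mult: "counit (x * y) = counit x * counit y"
    and antipode_left: "(\<Sum>(a, b)\<leftarrow>comult x. antipode a * b) = counit x *s 1"
    and antipode_right: "(\<Sum>(a, b)\<leftarrow>comult x. a * antipode b) = counit x *s 1"
begin

definition left_ideal :: "'h set \<Rightarrow> bool" where
  "left_ideal I \<longleftrightarrow> subspace I \<and> (\<forall>a. \<forall>x\<in>I. a * x \<in> I)"

text \<open>\<open>H\<close> is semisimple as a left module over itself.\<close>

definition semisimple :: bool where
  "semisimple \<longleftrightarrow>
    (\<forall>I. left_ideal I \<longrightarrow>
      (\<exists>J. left_ideal J \<and> I \<inter> J = {0} \<and> (\<forall>x. \<exists>a\<in>I. \<exists>b\<in>J. x = a + b)))"

definition dual :: "('h \<Rightarrow> 'k) set" where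
  "dual = {p. Vector_Spaces.linear scale (*) p}"

definition subalgebra :: "'h set \<Rightarrow> bool" where
  "subalgebra N \<longleftrightarrow> subspace N \<and> 1 \<in> N \<and> (\<forall>x\<in>N. \<forall>y\<in>N. x * y \<in> N)"

text \<open>\<open>\<Delta>(N) \<subseteq> H \<otimes> N\<close>, where \<open>H \<otimes> N\<close> is the span of the \<open>a \<otimes> b\<close> with \<open>b \<in> N\<close>.\<close>

definition left_coideal :: "'h set \<Rightarrow> bool" where
  "left_coideal N \<longleftrightarrow> subspace N \<and>
    (\<forall>x\<in>N. \<exists>ys. tensor_eq scale (comult x) ys \<and> snd ` set ys \<subseteq> N)"

definition normal :: "'h set \<Rightarrow> bool" where
  "normal N \<longleftrightarrow> (\<forall>h. \<forall>x\<in>N. (\<Sum>(a, b)\<leftarrow>comult h. a * x * antipode b) \<in> N)"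

definition augmentation :: "'h set \<Rightarrow> 'h set" where
  "augmentation N = N \<inter> {x. counit x = 0}"

definition quotient_ideal :: "'h set \<Rightarrow> 'h set" where
  "quotient_ideal N = span {h * x | h x. x \<in> augmentation N}"

text \<open>
  \<open>H / HN\<^sup>+\<close> is commutative iff all commutators lie in \<open>HN\<^sup>+\<close>, which is a two-sided ideal
  for a normal left coideal subalgebra \<open>N\<close>.
\<close>

definition commutative_quotient :: "'h set \<Rightarrow> bool" where
  "commutative_quotient N \<longleftrightarrow> (\<forall>a b. a * b - b * a \<in> quotient_ideal N)"

definition abelianizing :: "'h set \<Rightarrow> bool" where
  "abelianizing N \<longleftrightarrow>
    subalgebra N \<and> left_coideal N \<and> normal N \<and> commutative_quotient N"

definition is_commutator_subalgebra :: "'h set \<Rightarrow> bool" where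
  "is_commutator_subalgebra N \<longleftrightarrow>
    abelianizing N \<and> (\<forall>M. abelianizing M \<and> M \<subseteq> N \<longrightarrow> M = N)"

definition is_idempotent_integral :: "'h \<Rightarrow> bool" where
  "is_idempotent_integral L \<longleftrightarrow>
    (\<forall>h. h * L = counit h *s L \<and> L * h = counit h *s L) \<and> counit L = 1"

definition integral :: 'h where
  "integral = (THE L. is_idempotent_integral L)"

text \<open>
  \<open>\<Sum> \<Lambda>\<^sup>1\<^sub>1 \<cdots> \<Lambda>\<^sup>n\<^sub>1 \<otimes> S(\<Lambda>\<^sup>1\<^sub>2) \<cdots> S(\<Lambda>\<^sup>n\<^sub>2)\<close>, and multiplying the two factors gives \<open>z\<^sub>n\<close>.
\<close>

primrec z_tensor :: "nat \<Rightarrow> ('h \<times> 'h) list" where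
  "z_tensor 0 = [(1, 1)]"
| "z_tensor (Suc n) =
    [(u * a, v * antipode b). (u, v) \<leftarrow> z_tensor n, (a, b) \<leftarrow> comult integral]"

definition z_elem :: "nat \<Rightarrow> 'h" where
  "z_elem n = (\<Sum>(u, v)\<leftarrow>z_tensor n. u * v)"

definition right_hit :: "'h \<Rightarrow> ('h \<Rightarrow> 'k) \<Rightarrow> 'h" where
  "right_hit h p = (\<Sum>(a, b)\<leftarrow>comult h. p a *s b)"

definition z_coideal :: "nat \<Rightarrow> 'h set" where
  "z_coideal n = {right_hit (z_elem n) p | p. p \<in> dual}"

definition generated_algebra :: "'h set \<Rightarrow> 'h set" where
  "generated_algebra X = subalgebra hull X"

end

end

theory Submission
  imports Defs "HOL-Computational_Algebra.Fundamental_Theorem_Algebra" "HOL-Number_Theory.Totient"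
begin

text \<open>
  The first step is the theorem of Larson and Radford that the antipode \<open>S\<close> of \<open>H\<close> is an
  involution. The functional \<open>lam x = Tr(y \<mapsto> x S\<^sup>2(y))\<close> is a left integral of the dual, with
  value \<open>1\<close> at \<open>\<Lambda>\<close>, and so is \<open>mu x = Tr(y \<mapsto> S\<^sup>2(y) x)\<close> on the other side. Comparing the two
  shows that \<open>S\<^sup>4\<close> is conjugation by a group-like element, which has finite order. The regular
  trace \<open>tau\<close> is nondegenerate, and comparing \<open>tau\<close> with \<open>mu\<close> gives an invertible \<open>v\<close> such that
  \<open>S\<^sup>2(x) = v x v\<^sup>-\<^sup>1\<close>. On a block \<open>He\<close>, with \<open>e\<close> a primitive central idempotent, the trace of \<open>S\<^sup>2\<close>
  is \<open>tau(ev) tau(ev\<^sup>-\<^sup>1) / dim(He)\<close>. Its numerator is a sum of roots of unity times the conjugate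
  sum, so the trace becomes a nonnegative real number in the complex numbers. The block of \<open>\<Lambda>\<close>
  contributes \<open>1\<close>, hence \<open>Tr(S\<^sup>2) = lam 1\<close> is not zero (\<open>tr_S2_nonzero\<close>). Then the group-like
  element is \<open>1\<close> and \<open>S\<^sup>4 = id\<close>. Finally \<open>dim(H)\<close> divides the integer \<open>Tr(S\<^sup>2)\<close>, because \<open>Tr(S\<^sup>2)\<close>
  is also the trace of \<open>S\<^sup>2\<close> composed with \<open>h \<mapsto> \<Sum> tau(h\<^sub>1) h\<^sub>2\<close>, which is \<open>dim(H)\<close> times a
  projection. An operator of order two whose trace is a nonzero multiple of the dimension and
  which fixes \<open>1\<close> is the identity (\<open>antipode_involutive\<close>).

  Once \<open>S\<^sup>2 = id\<close>, the tensor \<open>\<Sum> \<Lambda>\<^sub>1 \<otimes> S(\<Lambda>\<^sub>2)\<close> is a symmetric Casimir element. This gives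
  \<open>z\<^bsub>n+2\<^esub> = z\<^sub>2 z\<^bsub>n\<^esub>\<close> and shows that \<open>z\<^bsub>n\<^esub>\<close> is central and acts on \<open>He\<close> as \<open>dim(He)\<^bsup>-\<lfloor>n/2\<rfloor>\<^esup>\<close>. Let \<open>A\<close> be the
  algebra generated by the left coideal of \<open>z\<^bsub>n\<^esub>\<close>. It is a normal left coideal subalgebra since
  \<open>z\<^bsub>n\<^esub>\<close> is central, and \<open>z\<^bsub>n\<^esub> - 1\<close> lies in \<open>A\<^sup>+\<close>. So for \<open>n \<ge> 2\<close> every block that survives in
  \<open>H / HA\<^sup>+\<close> has dimension \<open>1\<close>, and the quotient is commutative (\<open>abelianizing_generated\<close>).

  Conversely let \<open>M\<close> be any normal left coideal subalgebra with commutative quotient, and let \<open>f\<close>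
  be the central idempotent with \<open>HM\<^sup>+ = H(1 - f)\<close>. The form \<open>tau(xy)\<close> is nondegenerate on \<open>M\<close>
  (\<open>tau_nondegenerate_coideal\<close>), and therefore \<open>f\<close> lies in \<open>M\<close> (\<open>quotient_idempotent_mem\<close>). In the
  commutative algebra \<open>Hf\<close> the inner factors of \<open>\<Delta>(z\<^bsub>n\<^esub>)\<close> cancel, which means
  \<open>\<Delta>(z\<^bsub>n\<^esub>)(1 \<otimes> f) = z\<^bsub>n\<^esub> \<otimes> f\<close>. Such an element is recovered from \<open>f\<close> by the integral \<open>tau\<close>, so it
  lies in \<open>M\<close> (\<open>coinvariant_mem\<close>). Thus \<open>A\<close> is contained in every such \<open>M\<close>
  (\<open>generated_le_abelianizing\<close>), and it is the only minimal one.
\<close>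

context hopf_algebra
begin

section \<open>Sweedler sums\<close>

abbreviation S :: "'h \<Rightarrow> 'h" where "S \<equiv> antipode"

text \<open>
  A Sweedler sum depends only on the class of the list \<open>comult x\<close> when its summand is linear in
  each variable. The predicate \<open>lin\<close> is kept opaque, and closure rules for it are given to
  the simplifier, so that these side conditions are discharged automatically. The scalar
  multiplication of the target is a parameter since both \<open>H\<close> and the base field occur as targets.
\<close>

definition lin :: "('k \<Rightarrow> 'w::ab_group_add \<Rightarrow> 'w) \<Rightarrow> ('h \<Rightarrow> 'w) \<Rightarrow> bool" where
  "lin s f \<longleftrightarrow> Vector_Spaces.linear scale s f"

definition bil :: "('k \<Rightarrow> 'w::ab_group_add \<Rightarrow> 'w) \<Rightarrow> ('h \<Rightarrow> 'h \<Rightarrow> 'w) \<Rightarrow> bool" where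
  "bil s F \<longleftrightarrow> (\<forall>b. lin s (\<lambda>a. F a b)) \<and> (\<forall>a. lin s (\<lambda>b. F a b))"

definition tril :: "('k \<Rightarrow> 'w::ab_group_add \<Rightarrow> 'w) \<Rightarrow> ('h \<Rightarrow> 'h \<Rightarrow> 'h \<Rightarrow> 'w) \<Rightarrow> bool" where
  "tril s F \<longleftrightarrow> (\<forall>b c. lin s (\<lambda>a. F a b c)) \<and> (\<forall>a c. lin s (\<lambda>b. F a b c))
     \<and> (\<forall>a b. lin s (\<lambda>c. F a b c))"

definition sw :: "'h \<Rightarrow> ('h \<Rightarrow> 'h \<Rightarrow> 'w::ab_group_add) \<Rightarrow> 'w" where
  "sw x F = (\<Sum>(a, b)\<leftarrow>comult x. F a b)"

lemma vector_space_field [simp]: "vector_space ((*) :: 'k \<Rightarrow> 'k \<Rightarrow> 'k)"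
  by unfold_locales (simp_all add: algebra_simps)

lemma vector_space_scale [simp]: "vector_space scale" ..

lemma linI:
  assumes "vector_space s" "\<And>x y. f (x + y) = f x + f y" "\<And>c x. f (c *s x) = s c (f x)"
  shows "lin s f"
  unfolding lin_def Vector_Spaces.linear_iff using assms vector_space_axioms by auto

lemma lin_vector_space: "lin s f \<Longrightarrow> vector_space s"
  and lin_add: "lin s f \<Longrightarrow> f (x + y) = f x + f y"
  and lin_scale: "lin s f \<Longrightarrow> f (c *s x) = s c (f x)"
  unfolding lin_def Vector_Spaces.linear_iff by blast+

lemma lin_zero: "lin s f \<Longrightarrow> f 0 = 0"
  using lin_add[of s f 0 0] by simp

lemma lin_minus: "lin s f \<Longrightarrow> f (- x) = - f x"
  using lin_add[of s f "-x" x] lin_zero[of s f] by (simp add: eq_neg_iff_add_eq_0)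

lemma lin_diff: "lin s f \<Longrightarrow> f (x - y) = f x - f y"
  using lin_add[of s f x "-y"] lin_minus[of s f y] by simp

lemma lin_sum: "lin s f \<Longrightarrow> f (sum g A) = (\<Sum>i\<in>A. f (g i))"
  by (induction A rule: infinite_finite_induct) (auto simp: lin_zero lin_add)

lemma lin_sum_list: "lin s f \<Longrightarrow> f (sum_list (map g xs)) = (\<Sum>i\<leftarrow>xs. f (g i))"
  by (induction xs) (auto simp: lin_zero lin_add)

lemma lin_sw: "lin s f \<Longrightarrow> f (sw x F) = sw x (\<lambda>a b. f (F a b))"
  unfolding sw_def by (simp add: lin_sum_list split_def)

lemma lin_compose: "lin s f \<Longrightarrow> lin scale g \<Longrightarrow> lin s (\<lambda>x. f (g x))"
  by (rule linI) (auto dest: lin_vector_space simp: lin_add lin_scale)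

lemma lin_dual: "p \<in> dual \<longleftrightarrow> lin (*) p"
  by (simp add: dual_def lin_def)

lemma lin_ident [simp]: "lin scale (\<lambda>x. x)"
  by (rule linI) auto

lemma lin_mult_right [simp]: "lin scale f \<Longrightarrow> lin scale (\<lambda>x. f x * c)"
  by (rule linI) (auto simp: lin_add lin_scale scale_mult_left algebra_simps)

lemma lin_mult_left [simp]: "lin scale f \<Longrightarrow> lin scale (\<lambda>x. c * f x)"
  by (rule linI) (auto simp: lin_add lin_scale scale_mult_right algebra_simps)

lemma lin_scale_left [simp]: "lin (*) p \<Longrightarrow> lin scale (\<lambda>x. p x *s v)"
  by (rule linI) (auto simp: lin_add lin_scale scale_left_distrib)

lemma lin_scale_right [simp]: "lin scale f \<Longrightarrow> lin scale (\<lambda>x. c *s f x)"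
  by (rule linI) (auto simp: lin_add lin_scale scale_right_distrib mult.commute)

lemma lin_field_right [simp]: "lin (*) p \<Longrightarrow> lin (*) (\<lambda>x. p x * c)"
  by (rule linI) (auto simp: lin_add lin_scale algebra_simps)

lemma lin_field_left [simp]: "lin (*) p \<Longrightarrow> lin (*) (\<lambda>x. c * p x)"
  by (rule linI) (auto simp: lin_add lin_scale algebra_simps)

lemma lin_antipode: "lin scale S" and lin_counit: "lin (*) counit"
  using antipode_linear counit_linear by (auto simp: lin_def)

lemmas lin_antipode' [simp] = lin_compose[OF lin_antipode]
lemmas lin_counit' [simp] = lin_compose[OF lin_counit]

lemma lin_const_zero [simp]: "vector_space s \<Longrightarrow> lin s (\<lambda>x. 0)"
  by (rule linI) (auto simp: module.scale_zero_right module_iff_vector_space)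

lemma lin_plus [simp]: "lin s f \<Longrightarrow> lin s g \<Longrightarrow> lin s (\<lambda>x. f x + g x)"
  by (rule linI)
   (auto dest: lin_vector_space simp: lin_add lin_scale vector_space_def algebra_simps)

lemma lin_setsum [simp]:
  "vector_space s \<Longrightarrow> (\<And>i. i \<in> A \<Longrightarrow> lin s (\<lambda>x. F x i)) \<Longrightarrow> lin s (\<lambda>x. \<Sum>i\<in>A. F x i)"
  by (induction A rule: infinite_finite_induct) auto

lemma lin_sum_list_fun:
  "vector_space s \<Longrightarrow> (\<And>i. i \<in> set is \<Longrightarrow> lin s (\<lambda>x. F x i)) \<Longrightarrow> lin s (\<lambda>x. \<Sum>i\<leftarrow>is. F x i)"
  by (induction "is") auto

lemma lin_sw_fun [simp]:
  assumes "\<And>a b. lin s (\<lambda>x. F x a b)"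
  shows "lin s (\<lambda>x. sw c (F x))"
  unfolding sw_def
  using lin_sum_list_fun[of s "comult c" "\<lambda>x (a, b). F x a b"] assms lin_vector_space[OF assms]
  by (auto simp: split_def)

text \<open>
  Identities modulo \<open>tensor_eq\<close> enter the calculations through the bilinear maps that are applied
  to both sides.
\<close>

lemma tensor_eq_sum_list:
  assumes "tensor_eq scale xs ys" "bil s F"
  shows "(\<Sum>(a, b)\<leftarrow>xs. F a b) = (\<Sum>(a, b)\<leftarrow>ys. F a b)"
  using assms
proof (induction rule: tensor_eq.induct)
  case (zero b)
  then show ?case using lin_zero[of s "\<lambda>a. F a b"] by (simp add: bil_def)
next
  case (add_left a a' b)
  then show ?case using lin_add[of s "\<lambda>a. F a b"] by (simp add: bil_def)
next
  case (add_right a b b')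
  then show ?case using lin_add[of s "\<lambda>b. F a b"] by (simp add: bil_def)
next
  case (scale c a b)
  then show ?case
    using lin_scale[of s "\<lambda>b. F a b"] lin_scale[of s "\<lambda>a. F a b"] by (simp add: bil_def)
qed (auto simp: add.commute)

lemma tensor3_eq_sum_list:
  assumes "tensor3_eq scale xs ys" "tril s F"
  shows "(\<Sum>(a, b, c)\<leftarrow>xs. F a b c) = (\<Sum>(a, b, c)\<leftarrow>ys. F a b c)"
  using assms
proof (induction rule: tensor3_eq.induct)
  case (zero b d)
  then show ?case using lin_zero[of s "\<lambda>a. F a b d"] by (simp add: tril_def)
next
  case (add_1 a a' b d)
  then show ?case using lin_add[of s "\<lambda>a. F a b d"] by (simp add: tril_def)
next
  case (add_2 a b b' d)
  then show ?case using lin_add[of s "\<lambda>b. F a b d"] by (simp add: tril_def)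
next
  case (add_3 a b d d')
  then show ?case using lin_add[of s "\<lambda>d. F a b d"] by (simp add: tril_def)
next
  case (scale_12 c a b d)
  then show ?case
    using lin_scale[of s "\<lambda>b. F a b d"] lin_scale[of s "\<lambda>a. F a b d"] by (simp add: tril_def)
next
  case (scale_23 a c b d)
  then show ?case
    using lin_scale[of s "\<lambda>b. F a b d"] lin_scale[of s "\<lambda>d. F a b d"] by (simp add: tril_def)
qed (auto simp: add.commute)

lemma sw_cong: "(\<And>a b. F a b = G a b) \<Longrightarrow> sw x F = sw x G"
  by (simp add: sw_def)

lemma sw_add: "bil s F \<Longrightarrow> sw (x + y) F = sw x F + sw y F"
  unfolding sw_def using tensor_eq_sum_list[OF comult_add] by simp

lemma scale_sum_list:
  "vector_space s \<Longrightarrow> s c (\<Sum>i\<leftarrow>xs. g i) = (\<Sum>i\<leftarrow>xs. s c (g i))"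
  by (induction xs)
    (auto simp: module.scale_zero_right module.scale_right_distrib module_iff_vector_space)

lemma sw_scale: "bil s F \<Longrightarrow> sw (c *s x) F = s c (sw x F)"
proof -
  assume F: "bil s F"
  then have "vector_space s"
    using lin_vector_space by (auto simp: bil_def)
  have "sw (c *s x) F = (\<Sum>(a, b)\<leftarrow>comult x. F (c *s a) b)"
    unfolding sw_def tensor_eq_sum_list[OF comult_scale F]
    by (simp add: split_def o_def)
  also have "\<dots> = (\<Sum>(a, b)\<leftarrow>comult x. s c (F a b))"
    using F lin_scale[of s "\<lambda>a. F a _"] by (simp add: bil_def split_def)
  also have "\<dots> = s c (sw x F)"
    unfolding sw_def using \<open>vector_space s\<close>
    by (simp add: scale_sum_list split_def)
  finally show ?thesis .
qed

lemma lin_sw_arg: "bil s F \<Longrightarrow> lin s (\<lambda>x. sw x F)"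
  by (rule linI) (auto simp: sw_add sw_scale bil_def intro: lin_vector_space)

declare bil_def [simp] tril_def [simp]

lemma lin_sw_arg' [simp]: "lin scale g \<Longrightarrow> bil s F \<Longrightarrow> lin s (\<lambda>x. sw (g x) F)"
  using lin_compose[OF lin_sw_arg] by blast

lemma sum_list_concat: "sum_list (concat xs) = sum_list (map sum_list xs)"
  by (induction xs) auto

lemma sw_mult:
  "bil s F \<Longrightarrow> sw (x * y) F = sw x (\<lambda>a b. sw y (\<lambda>c d. F (a * c) (b * d)))"
  unfolding sw_def tensor_eq_sum_list[OF comult_mult]
  by (simp add: map_concat sum_list_concat split_def o_def)

lemma sw_one: "bil s F \<Longrightarrow> sw 1 F = F 1 1"
  unfolding sw_def tensor_eq_sum_list[OF comult_one] by simp

lemma sw_assoc: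
  assumes "tril s F"
  shows "sw x (\<lambda>a b. sw a (\<lambda>c d. F c d b)) = sw x (\<lambda>a b. sw b (\<lambda>c d. F a c d))"
  using tensor3_eq_sum_list[OF coassoc assms, of x] unfolding sw_def
  by (simp add: map_concat sum_list_concat split_def o_def)

lemma sw_counit_left: "lin s F \<Longrightarrow> sw x (\<lambda>a b. s (counit a) (F b)) = F x"
  and sw_counit_right: "lin s F \<Longrightarrow> sw x (\<lambda>a b. s (counit b) (F a)) = F x"
  using lin_sw[of s F x "\<lambda>a b. counit a *s b"] lin_sw[of s F x "\<lambda>a b. counit b *s a"]
    counit_left[of x] counit_right[of x]
  by (simp_all add: lin_scale sw_def split_def)

lemma sw_swap: "sw x (\<lambda>a b. sw y (\<lambda>c d. F a b c d)) = sw y (\<lambda>c d. sw x (\<lambda>a b. F a b c d))"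
proof -
  have "(\<Sum>i\<leftarrow>xs. \<Sum>j\<leftarrow>ys. G i j) = (\<Sum>j\<leftarrow>ys. \<Sum>i\<leftarrow>xs. G i j)"
    for xs ys :: "('h \<times> 'h) list" and G :: "'h \<times> 'h \<Rightarrow> 'h \<times> 'h \<Rightarrow> 'a"
    by (induction xs) (auto simp: sum_list_addf)
  then show ?thesis by (simp add: sw_def split_def)
qed

lemma sw_sum: "sw x (\<lambda>a b. \<Sum>i\<in>A. F i a b) = (\<Sum>i\<in>A. sw x (F i))"
  unfolding sw_def
  by (induction A rule: infinite_finite_induct) (auto simp: split_def sum_list_addf)

lemma sw_plus: "sw x (\<lambda>a b. F a b + G a b) = sw x F + sw x G"
  by (simp add: sw_def split_def sum_list_addf)

lemmas sw_mult_H = sw_mult[where s = scale]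
lemmas sw_one_H = sw_one[where s = scale]
lemmas sw_counit_left_H = sw_counit_left[where s = scale]
lemmas sw_counit_right_H = sw_counit_right[where s = scale]
  and sw_counit_right_K = sw_counit_right[where s = "(*)"]

lemma mult_sw: "u * sw x F = sw x (\<lambda>a b. u * F a b)" for u :: 'h
  using lin_sw[of scale "\<lambda>y. u * y"] by simp

lemma sw_times: "sw x F * u = sw x (\<lambda>a b. F a b * u)" for u :: 'h
  using lin_sw[of scale "\<lambda>y. y * u"] by simp

lemma scale_sw: "c *s sw x F = sw x (\<lambda>a b. c *s F a b)"
  using lin_sw[of scale "\<lambda>y. c *s y"] by simp

lemma sw_scale_vec: "sw x F *s v = sw x (\<lambda>a b. F a b *s v)" for F :: "'h \<Rightarrow> 'h \<Rightarrow> 'k"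
proof -
  have "sum_list (map g xs) *s v = (\<Sum>i\<leftarrow>xs. g i *s v)" for xs :: "('h \<times> 'h) list" and g
    by (induction xs) (auto simp: scale_left_distrib)
  then show ?thesis by (simp add: sw_def split_def)
qed

section \<open>Bases and traces\<close>

definition bas :: "'h set" where
  "bas = (SOME B. finite B \<and> independent B \<and> span B = UNIV)"

lemma bas: "finite bas" "independent bas" "span bas = UNIV"
proof -
  obtain B where B: "finite B" "span B = UNIV" using finite_dim by blast
  obtain C where "C \<subseteq> B" "independent C" "B \<subseteq> span C"
    using maximal_independent_subset[of B] by blast
  then have "finite C \<and> independent C \<and> span C = UNIV"
    using B by (metis finite_subset span_eq_iff subset_UNIV subspace_span span_minimal top.extremum_uniqueI)
  then show "finite bas" "independent bas" "span bas = UNIV"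
    unfolding bas_def by (metis (mono_tags, lifting) someI)+
qed

end

sublocale hopf_algebra \<subseteq> fd: finite_dimensional_vector_space scale bas
  by unfold_locales (use bas in auto)

context hopf_algebra
begin

definition coord :: "'h \<Rightarrow> 'h \<Rightarrow> 'k" where
  "coord b x = representation bas x b"

lemma lin_coord [simp]: "lin (*) (coord b)"
  unfolding coord_def lin_def using linear_representation[OF bas(2,3)] .

lemmas lin_coord' [simp] = lin_compose[OF lin_coord]

lemma coord_expand: "(\<Sum>b\<in>bas. coord b x *s b) = x"
  unfolding coord_def using bas by (intro sum_representation_eq) auto

lemma lin_expand: "lin s f \<Longrightarrow> f x = (\<Sum>b\<in>bas. s (coord b x) (f b))"
  using lin_sum[of s f "\<lambda>b. coord b x *s b" bas] by (simp add: coord_expand lin_scale)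

lemma eq_if_functionals_eq: "(\<And>p. lin (*) p \<Longrightarrow> p x = p y) \<Longrightarrow> x = y"
proof -
  assume "\<And>p. lin (*) p \<Longrightarrow> p x = p y"
  then have "coord b x = coord b y" for b by simp
  then have "(\<Sum>b\<in>bas. coord b x *s b) = (\<Sum>b\<in>bas. coord b y *s b)" by metis
  then show "x = y" unfolding coord_expand .
qed

definition tr :: "('h \<Rightarrow> 'h) \<Rightarrow> 'k" where
  "tr T = (\<Sum>b\<in>bas. coord b (T b))"

lemma lin_tr [simp]: "(\<And>y. lin scale (\<lambda>x. F x y)) \<Longrightarrow> lin (*) (\<lambda>x. tr (F x))"
  unfolding tr_def by simp

lemma tr_cong: "(\<And>x. U x = T x) \<Longrightarrow> tr U = tr T"
  by (simp add: tr_def)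

lemma tr_sum: "tr (\<lambda>x. \<Sum>i\<in>A. F i x) = (\<Sum>i\<in>A. tr (F i))"
  unfolding tr_def by (subst sum.swap) (simp add: lin_sum[OF lin_coord])

lemma tr_add: "tr (\<lambda>x. U x + T x) = tr U + tr T"
  unfolding tr_def by (simp add: lin_add[OF lin_coord] sum.distrib)

lemma tr_diff: "tr (\<lambda>x. U x - T x) = tr U - tr T"
  unfolding tr_def by (simp add: lin_diff[OF lin_coord] sum_subtractf)

lemma tr_scale: "tr (\<lambda>x. c *s T x) = c * tr T"
  unfolding tr_def by (simp add: lin_scale[OF lin_coord] sum_distrib_left)

lemma tr_sw: "tr (\<lambda>x. sw y (\<lambda>a b. F a b x)) = sw y (\<lambda>a b. tr (F a b))"
  unfolding tr_def by (simp add: sw_sum lin_sw[OF lin_coord])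

lemma tr_rank_one: "lin (*) p \<Longrightarrow> tr (\<lambda>x. p x *s c) = p c"
  unfolding tr_def using lin_expand[of "(*)" p c]
  by (simp add: lin_scale[OF lin_coord] mult.commute)

lemma tr_commute:
  assumes "lin scale U" "lin scale T"
  shows "tr (\<lambda>x. U (T x)) = tr (\<lambda>x. T (U x))"
proof -
  have "tr (\<lambda>x. U (T x)) = tr (\<lambda>x. \<Sum>b\<in>bas. coord b (T x) *s U b)"
    by (rule tr_cong) (rule lin_expand[OF assms(1)])
  also have "\<dots> = (\<Sum>b\<in>bas. coord b (T (U b)))"
    unfolding tr_sum using assms(2) by (simp add: tr_rank_one)
  finally show ?thesis by (simp add: tr_def)
qed

lemma subspace_image:
  assumes T: "lin scale T" and U: "subspace U"
  shows "subspace (T ` U)"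
proof (rule subspaceI)
  show "0 \<in> T ` U" using lin_zero[OF T] subspace_0[OF U] by (metis imageI)
next
  fix x y assume "x \<in> T ` U" "y \<in> T ` U"
  then show "x + y \<in> T ` U" using subspace_add[OF U] by (auto simp: lin_add[OF T, symmetric])
next
  fix c x assume "x \<in> T ` U"
  then show "c *s x \<in> T ` U" using subspace_scale[OF U] by (auto simp: lin_scale[OF T, symmetric])
qed

text \<open>
  In characteristic zero this identity turns statements about traces into statements about
  dimensions, which is how integrality and positivity enter.
\<close>

lemma tr_idempotent:
  assumes T: "lin scale T" "\<And>x. T (T x) = T x"
  shows "tr T = of_nat (dim (range T))"
proof -
  obtain C where C: "C \<subseteq> range T" "independent C" "range T \<subseteq> span C" "card C = dim (range T)"
    using basis_exists[of "range T"] by blast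
  have fin: "finite C" using C(2) fd.finiteI_independent by blast
  have sub: "subspace (range T)" by (rule subspace_image[OF T(1) subspace_UNIV])
  have span: "span C = range T" using C sub by (simp add: span_subspace)
  define p where "p c x = representation C (T x) c" for c x
  have p: "lin (*) (p c)" for c
    unfolding p_def using C(2) span T(1)
    by (intro linI) (auto simp: representation_add representation_scale lin_add lin_scale)
  have "T x = (\<Sum>c\<in>C. p c x *s c)" for x
    unfolding p_def by (rule sum_representation_eq[symmetric]) (use C(2) fin span in auto)
  then have "tr T = tr (\<lambda>x. \<Sum>c\<in>C. p c x *s c)"
    by (rule tr_cong)
  also have "\<dots> = (\<Sum>c\<in>C. p c c)"
    unfolding tr_sum by (simp add: tr_rank_one[OF p])
  also have "\<dots> = (\<Sum>c\<in>C. 1)"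
  proof (rule sum.cong)
    fix c assume "c \<in> C"
    then obtain x where "c = T x" using C(1) by blast
    then have "T c = c" using T(2)[of x] by simp
    then have "p c c = representation C c c" by (simp only: p_def)
    then show "p c c = 1" using representation_basis[OF C(2) \<open>c \<in> C\<close>] by simp
  qed simp
  finally show ?thesis using C(4) by simp
qed

section \<open>The antipode\<close>

lemma lin_bil_left: "bil s F \<Longrightarrow> lin scale g \<Longrightarrow> lin s (\<lambda>x. F (g x) b)"
  and lin_bil_right: "bil s F \<Longrightarrow> lin scale g \<Longrightarrow> lin s (\<lambda>x. F a (g x))"
  using lin_compose[of s "\<lambda>x. F x b" g] lin_compose[of s "\<lambda>x. F a x" g] by simp_all

lemma antipode_left_sw: "sw x (\<lambda>a b. S a * b) = counit x *s 1"
  and antipode_right_sw: "sw x (\<lambda>a b. a * S b) = counit x *s 1"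
  using antipode_left antipode_right by (simp_all add: sw_def)

lemma sw_antipode_left: "lin s F \<Longrightarrow> sw x (\<lambda>a b. F (S a * b)) = s (counit x) (F 1)"
  and sw_antipode_right: "lin s F \<Longrightarrow> sw x (\<lambda>a b. F (a * S b)) = s (counit x) (F 1)"
  using lin_sw[of s F x "\<lambda>a b. S a * b"] lin_sw[of s F x "\<lambda>a b. a * S b"]
  by (simp_all add: antipode_left_sw antipode_right_sw lin_scale)

text \<open>
  In an iterated coproduct \<open>a \<otimes> b \<otimes> c\<close> of \<open>x\<close>, an antipode next to a plain factor cancels. Here the
  coproduct is nested to the right, so the first two cases need coassociativity.
\<close>

lemma sw_cancel:
  assumes "bil s F"
  shows "sw x (\<lambda>a y. sw y (\<lambda>b c. F (S a * b) c)) = F 1 x"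
    and "sw x (\<lambda>a y. sw y (\<lambda>b c. F (a * S b) c)) = F 1 x"
    and "sw x (\<lambda>a y. sw y (\<lambda>b c. F a (S b * c))) = F x 1"
    and "sw x (\<lambda>a y. sw y (\<lambda>b c. F a (b * S c))) = F x 1"
proof -
  note [simp] = lin_bil_left[OF assms] lin_bil_right[OF assms]
  have l: "lin s (\<lambda>x. F x c)" "lin s (F a)" for a c using assms by simp_all
  show "sw x (\<lambda>a y. sw y (\<lambda>b c. F (S a * b) c)) = F 1 x"
    by (subst sw_assoc[where s=s and F="\<lambda>a b c. F (S a * b) c", symmetric])
      (simp_all add: sw_antipode_left[of s "\<lambda>x. F x _", OF l(1)] sw_counit_left l)
  show "sw x (\<lambda>a y. sw y (\<lambda>b c. F (a * S b) c)) = F 1 x"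
    by (subst sw_assoc[where s=s and F="\<lambda>a b c. F (a * S b) c", symmetric])
      (simp_all add: sw_antipode_right[of s "\<lambda>x. F x _", OF l(1)] sw_counit_left l)
  show "sw x (\<lambda>a y. sw y (\<lambda>b c. F a (S b * c))) = F x 1"
    by (simp add: sw_antipode_left[OF l(2)] sw_counit_right[where s=s and F="\<lambda>a. F a 1"] l)
  show "sw x (\<lambda>a y. sw y (\<lambda>b c. F a (b * S c))) = F x 1"
    by (simp add: sw_antipode_right[OF l(2)] sw_counit_right[where s=s and F="\<lambda>a. F a 1"] l)
qed

lemma antipode_one [simp]: "S 1 = 1"
  using antipode_left_sw[of 1] by (simp add: sw_one_H counit_one)

lemma counit_antipode [simp]: "counit (S x) = counit x"
proof -
  have "counit x = counit (sw x (\<lambda>a b. S a * b))"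
    by (simp add: antipode_left_sw lin_scale[OF lin_counit] counit_one)
  also have "\<dots> = sw x (\<lambda>a b. counit b * counit (S a))"
    by (simp add: lin_sw[OF lin_counit] counit_mult mult.commute)
  also have "\<dots> = counit (S x)"
    by (rule sw_counit_right_K) simp
  finally show ?thesis by simp
qed

text \<open>
  Both sides are convolution inverses of the multiplication map. Concretely, the sum
  \<open>\<Sum> S(x\<^sub>1 y\<^sub>1) x\<^sub>2 y\<^sub>2 S(y\<^sub>3) S(x\<^sub>3)\<close> is evaluated in two ways.
\<close>

lemma antipode_mult: "S (x * y) = S y * S x"
proof -
  \<comment> \<open>The arguments are \<open>x\<^sub>1, x\<^sub>2, x\<^sub>3, y\<^sub>1, y\<^sub>2, y\<^sub>3\<close>.\<close>
  define G where "G a b c d e f = S (a * d) * (b * e) * (S f * S c)" for a b c d e f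
  have "sw x (\<lambda>a x'. sw x' (\<lambda>b c. sw y (\<lambda>d y'. sw y' (\<lambda>e f. G a b c d e f)))) =
    sw x (\<lambda>a x'. sw x' (\<lambda>b c. S (a * y) * (b * S c)))"
    (is "?L = _")
  proof (intro sw_cong)
    fix a x' b c
    show "sw y (\<lambda>d y'. sw y' (\<lambda>e f. G a b c d e f)) = S (a * y) * (b * S c)"
      using sw_cancel(4)[of scale "\<lambda>d w. S (a * d) * (b * w * S c)" y]
      by (simp add: G_def mult.assoc)
  qed
  also have "\<dots> = S (x * y)"
    by (subst sw_cancel(4)[of scale "\<lambda>a w. S (a * y) * w"]) simp_all
  finally have 1: "?L = S (x * y)" .
  have "?L = sw x (\<lambda>x' c. sw x' (\<lambda>a b. sw y (\<lambda>d y'. sw y' (\<lambda>e f. G a b c d e f))))"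
    by (subst sw_assoc[where s=scale]) (simp_all add: G_def)
  also have "\<dots> = sw x (\<lambda>x' c. sw x' (\<lambda>a b. sw y (\<lambda>y' f. sw y' (\<lambda>d e. G a b c d e f))))"
    by (rule sw_cong, rule sw_cong, rule sw_assoc[where s=scale, symmetric]) (simp_all add: G_def)
  also have "\<dots> = sw x (\<lambda>x' c. sw y (\<lambda>y' f. sw x' (\<lambda>a b. sw y' (\<lambda>d e. G a b c d e f))))"
    by (rule sw_cong, rule sw_swap)
  also have "\<dots> = sw x (\<lambda>x' c. sw y (\<lambda>y' f. counit x' *s counit y' *s (S f * S c)))"
  proof (intro sw_cong)
    fix x' c y' f
    have "sw (x' * y') (\<lambda>a b. S a * b * (S f * S c))
      = counit x' *s counit y' *s (S f * S c)"
      by (simp add: sw_times[symmetric] antipode_left_sw counit_mult scale_mult_left)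
    then show "sw x' (\<lambda>a b. sw y' (\<lambda>d e. G a b c d e f)) = counit x' *s counit y' *s (S f * S c)"
      by (simp add: sw_mult_H G_def)
  qed
  also have "\<dots> = S y * S x"
    by (simp add: scale_sw[symmetric] scale_scale[symmetric] sw_counit_left_H sw_counit_right_H
        del: scale_scale)
  finally show ?thesis using 1 by simp
qed

text \<open>
  The same argument for \<open>\<Delta>\<close>: the expression \<open>\<Delta>(S x\<^sub>1) \<Delta>(x\<^sub>2) (S x\<^sub>4 \<otimes> S x\<^sub>3)\<close> is evaluated in two ways.
\<close>

lemma sw_antipode:
  assumes "bil s F"
  shows "sw (S x) F = sw x (\<lambda>a b. F (S b) (S a))"
proof -
  note [simp] = lin_bil_left[OF assms] lin_bil_right[OF assms]
  have vs: "vector_space s" using assms lin_vector_space[of s "\<lambda>a. F a undefined"] by simp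
  define G where "G p q b c d e = F (p * b * S e) (q * c * S d)" for p q b c d e
  have "sw x (\<lambda>a w. sw (S a) (\<lambda>p q. sw w (\<lambda>b w'. sw w' (\<lambda>c w''. sw w'' (\<lambda>d e. G p q b c d e)))))
    = sw x (\<lambda>a w. sw (S a) (\<lambda>p q. s (counit w) (F p q)))" (is "?L = _")
  proof (intro sw_cong)
    fix a w p q
    have "sw w (\<lambda>b w'. sw w' (\<lambda>c w''. sw w'' (\<lambda>d e. G p q b c d e)))
      = sw w (\<lambda>b w'. F (p * (b * S w')) q)"
    proof (intro sw_cong)
      fix b w'
      show "sw w' (\<lambda>c w''. sw w'' (\<lambda>d e. G p q b c d e)) = F (p * (b * S w')) q"
        using sw_cancel(2)[of s "\<lambda>u e. F (p * b * S e) (q * u)" w']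
        by (simp add: G_def mult.assoc)
    qed
    also have "\<dots> = s (counit w) (F p q)"
      by (subst sw_antipode_right[where s=s]) simp_all
    finally show "sw w (\<lambda>b w'. sw w' (\<lambda>c w''. sw w'' (\<lambda>d e. G p q b c d e))) = s (counit w) (F p q)" .
  qed
  also have "\<dots> = sw x (\<lambda>a w. s (counit w) (sw (S a) F))"
    using vs by (intro sw_cong) (simp add: sw_def scale_sum_list split_def)
  also have "\<dots> = sw (S x) F"
    using assms by (subst sw_counit_right[where s=s]) simp_all
  finally have 1: "?L = sw (S x) F" .
  have "?L = sw x (\<lambda>a w. sw (S a) (\<lambda>p q. sw w (\<lambda>w' w''. sw w' (\<lambda>b c. sw w'' (\<lambda>d e. G p q b c d e)))))"
    by (rule sw_cong, rule sw_cong, rule sw_assoc[where s=s, symmetric]) (simp_all add: G_def)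
  also have "\<dots> = sw x (\<lambda>a w. sw w (\<lambda>w' w''. sw (S a) (\<lambda>p q. sw w' (\<lambda>b c. sw w'' (\<lambda>d e. G p q b c d e)))))"
    by (rule sw_cong, rule sw_swap)
  also have "\<dots> = sw x (\<lambda>a w. sw w (\<lambda>w' w''. sw (S a * w') (\<lambda>u v. sw w'' (\<lambda>d e. F (u * S e) (v * S d)))))"
    by (rule sw_cong, rule sw_cong) (simp add: sw_mult[where s=s] G_def)
  also have "\<dots> = sw x (\<lambda>u w''. sw u (\<lambda>a w'. sw (S a * w') (\<lambda>u v. sw w'' (\<lambda>d e. F (u * S e) (v * S d)))))"
    by (subst sw_assoc[where s=s]) simp_all
  also have "\<dots> = sw x (\<lambda>u w''. s (counit u) (sw w'' (\<lambda>d e. F (S e) (S d))))"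
    by (rule sw_cong) (subst sw_antipode_left[where s=s], simp_all add: sw_one[where s=s])
  also have "\<dots> = sw x (\<lambda>d e. F (S e) (S d))"
    by (subst sw_counit_left[where s=s]) simp_all
  finally show ?thesis using 1 by simp
qed

abbreviation S2 :: "'h \<Rightarrow> 'h" where "S2 x \<equiv> S (S x)"

lemma sw_S2: "bil s F \<Longrightarrow> sw (S2 x) F = sw x (\<lambda>a b. F (S2 a) (S2 b))"
proof -
  assume F: "bil s F"
  note [simp] = lin_bil_left[OF F] lin_bil_right[OF F]
  show ?thesis using F by (simp add: sw_antipode[where s=s])
qed

lemma S2_mult: "S2 (x * y) = S2 x * S2 y"
  by (simp add: antipode_mult)

section \<open>Semisimplicity and the idempotent integral\<close>

text \<open>
  The unit is the component of \<open>1\<close> in \<open>I\<close>, with respect to a complementary left ideal.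
\<close>

lemma left_ideal_right_unit:
  assumes "semisimple" "left_ideal I"
  obtains u where "u \<in> I" "\<And>x. x \<in> I \<Longrightarrow> x * u = x"
proof -
  obtain J where J: "left_ideal J" "I \<inter> J = {0}" "\<forall>x. \<exists>a\<in>I. \<exists>b\<in>J. x = a + b"
    using assms(1)[unfolded semisimple_def, THEN spec, THEN mp, OF assms(2)] by (elim exE conjE)
  obtain u v where uv: "u \<in> I" "v \<in> J" "1 = u + v"
    using J(3)[THEN spec, of 1] by (elim bexE)
  have "x * u = x" if x: "x \<in> I" for x
  proof -
    have "x * v = x * (u + v) - x * u" by (simp add: distrib_left)
    then have "x * v = x - x * u" using uv(3) by simp
    moreover have "x - x * u \<in> I" using assms(2) x uv(1)
      unfolding left_ideal_def by (blast intro: subspace_diff)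
    moreover have "x * v \<in> J" using J(1) uv(2) unfolding left_ideal_def by blast
    ultimately have "x - x * u \<in> I \<inter> J" by (simp add: \<open>x * v = x - x * u\<close>)
    then show ?thesis using J(2) by simp
  qed
  then show ?thesis using uv(1) that by blast
qed

lemma idempotent_integral_unique:
  "is_idempotent_integral L \<Longrightarrow> is_idempotent_integral L' \<Longrightarrow> L = L'"
  unfolding is_idempotent_integral_def by (metis scale_one)

end

locale semisimple_hopf_algebra = hopf_algebra scale comult counit antipode
  for scale :: "'k::{alg_closed_field,field_char_0} \<Rightarrow> 'h::ring_1 \<Rightarrow> 'h" (infixr "*s" 75)
    and comult counit antipode +
  assumes semisimple: "semisimple"
begin

text \<open>
  The complement \<open>J\<close> of \<open>ker \<epsilon>\<close> contains a left integral \<open>L\<close> with \<open>\<epsilon>(L) = 1\<close>. It is also a right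
  integral, because \<open>L h - \<epsilon>(h) L\<close> is a left integral on which \<open>\<epsilon>\<close> vanishes. Such an element spans
  a left ideal of square zero, hence it is zero by semisimplicity.
\<close>

lemma is_idempotent_integral_integral: "is_idempotent_integral integral"
proof -
  define K where "K = {x. counit x = 0}"
  have "left_ideal K" unfolding left_ideal_def K_def subspace_def
    by (auto simp: lin_zero[OF lin_counit] lin_add[OF lin_counit] lin_scale[OF lin_counit] counit_mult)
  obtain J where J: "left_ideal J" "K \<inter> J = {0}" "\<forall>x. \<exists>a\<in>K. \<exists>b\<in>J. x = a + b"
    using semisimple[unfolded semisimple_def, THEN spec, THEN mp, OF \<open>left_ideal K\<close>] by (elim exE conjE)
  obtain a L where aL: "a \<in> K" "L \<in> J" "1 = a + L" using J(3)[THEN spec, of 1] by (elim bexE)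
  have L1: "counit L = 1"
    using aL lin_add[OF lin_counit, of a L] counit_one by (simp add: K_def)
  have left: "h * L = counit h *s L" for h
  proof -
    have "h * L - counit h *s L \<in> J" using J(1) aL(2)
      unfolding left_ideal_def by (blast intro: subspace_diff subspace_scale)
    moreover have "h * L - counit h *s L \<in> K"
      by (simp add: K_def lin_diff[OF lin_counit] lin_scale[OF lin_counit] counit_mult L1)
    ultimately have "h * L - counit h *s L \<in> K \<inter> J" by blast
    then show ?thesis using J(2) by simp
  qed
  have zero: "y = 0" if y: "\<And>h. h * y = counit h *s y" "counit y = 0" for y
  proof -
    have "left_ideal (span {y})"
      unfolding left_ideal_def
    proof (intro conjI subspace_span allI ballI)
      fix a x assume "x \<in> span {y}"
      then obtain c where "x = c *s y" by (auto simp: span_singleton)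
      then have "a * x = (c * counit a) *s y" using y(1) by (simp add: scale_mult_right)
      then show "a * x \<in> span {y}" by (simp add: span_scale span_base)
    qed
    then obtain u where u: "u \<in> span {y}" "\<And>x. x \<in> span {y} \<Longrightarrow> x * u = x"
      using left_ideal_right_unit[OF semisimple] by blast
    then obtain c where "u = c *s y" by (auto simp: span_singleton)
    then have "y = y * (c *s y)" using u(2)[of y] by (simp add: span_base)
    also have "\<dots> = 0" using y by (simp add: scale_mult_right)
    finally show ?thesis .
  qed
  have right: "L * h = counit h *s L" for h
  proof -
    have "L * h - counit h *s L = 0"
    proof (rule zero)
      show "x * (L * h - counit h *s L) = counit x *s (L * h - counit h *s L)" for x
        by (simp add: right_diff_distrib scale_mult_right left mult.assoc[symmetric] scale_mult_left
            scale_right_diff_distrib mult.commute)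
      show "counit (L * h - counit h *s L) = 0"
        by (simp add: lin_diff[OF lin_counit] lin_scale[OF lin_counit] counit_mult L1)
    qed
    then show ?thesis by simp
  qed
  have "is_idempotent_integral L"
    unfolding is_idempotent_integral_def using left right L1 by blast
  then show ?thesis unfolding integral_def
    using theI[of is_idempotent_integral L] idempotent_integral_unique[of _ L] by blast
qed

text \<open>
  This element is written \<open>\<Lambda>\<close> in the comments.
\<close>

abbreviation Lam :: 'h where "Lam \<equiv> integral"

lemma Lam_left: "h * Lam = counit h *s Lam" and Lam_right: "Lam * h = counit h *s Lam"
  and counit_Lam: "counit Lam = 1"
  using is_idempotent_integral_integral by (auto simp: is_idempotent_integral_def)

section \<open>Integrals of the dual as traces\<close>

text \<open>
  The invariance properties of \<open>\<Delta>(\<Lambda>)\<close> come from \<open>\<Delta>(h \<Lambda>) = \<epsilon>(h) \<Delta>(\<Lambda>) = \<Delta>(\<Lambda> h)\<close> by inserting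
  \<open>S(h\<^sub>1) h\<^sub>2\<close> or \<open>h\<^sub>1 S(h\<^sub>2)\<close>. They say that \<open>\<Sum> \<Lambda>\<^sub>1 \<otimes> S(\<Lambda>\<^sub>2)\<close> is a Casimir element, up to a twist
  by \<open>S\<^sup>2\<close> on one side.
\<close>

lemma Lam_casimir:
  assumes "bil s F"
  shows "sw Lam (\<lambda>a b. F a (h * b)) = sw Lam (\<lambda>a b. F (S h * a) b)"
    and "sw Lam (\<lambda>a b. F (a * h) b) = sw Lam (\<lambda>a b. F a (b * S h))"
    and "sw Lam (\<lambda>a b. F (h * a) (S b)) = sw Lam (\<lambda>a b. F a (S b * h))"
proof -
  note [simp] = lin_bil_left[OF assms] lin_bil_right[OF assms]
  have "sw Lam (\<lambda>a b. F a (h * b)) = sw h (\<lambda>c u. sw u (\<lambda>d e. sw Lam (\<lambda>a b. F (S c * d * a) (e * b))))"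
    by (subst sw_cancel(1)[where s=s and F="\<lambda>x c. sw Lam (\<lambda>a b. F (x * a) (c * b))"]) simp_all
  also have "\<dots> = sw h (\<lambda>c u. sw (u * Lam) (\<lambda>a b. F (S c * a) b))"
    by (simp add: sw_mult[where s=s] mult.assoc)
  also have "\<dots> = sw Lam (\<lambda>a b. F (S h * a) b)"
    by (simp add: Lam_left sw_scale[where s=s] sw_counit_right[where s=s])
  finally show "sw Lam (\<lambda>a b. F a (h * b)) = sw Lam (\<lambda>a b. F (S h * a) b)" .
  have "sw Lam (\<lambda>a b. F (a * h) b) = sw h (\<lambda>c u. sw u (\<lambda>d e. sw Lam (\<lambda>a b. F (a * c) (b * (d * S e)))))"
    by (subst sw_cancel(4)[where s=s and F="\<lambda>c x. sw Lam (\<lambda>a b. F (a * c) (b * x))"]) simp_all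
  also have "\<dots> = sw h (\<lambda>u e. sw u (\<lambda>c d. sw Lam (\<lambda>a b. F (a * c) (b * (d * S e)))))"
    by (rule sw_assoc[where s=s, symmetric]) simp
  also have "\<dots> = sw h (\<lambda>u e. sw (Lam * u) (\<lambda>a b. F a (b * S e)))"
    by (rule sw_cong, subst sw_swap) (simp add: sw_mult[where s=s] mult.assoc)
  also have "\<dots> = sw Lam (\<lambda>a b. F a (b * S h))"
    by (simp add: Lam_right sw_scale[where s=s] sw_counit_left[where s=s])
  finally show *: "sw Lam (\<lambda>a b. F (a * h) b) = sw Lam (\<lambda>a b. F a (b * S h))" .
  have "sw Lam (\<lambda>a b. F (h * a) (S b)) =
      sw h (\<lambda>c u. sw u (\<lambda>d e. sw Lam (\<lambda>a b. F (c * a) (S b * (S d * e)))))"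
    by (subst sw_cancel(3)[where s=s and F="\<lambda>c x. sw Lam (\<lambda>a b. F (c * a) (S b * x))"]) simp_all
  also have "\<dots> = sw h (\<lambda>u e. sw u (\<lambda>c d. sw Lam (\<lambda>a b. F (c * a) (S b * (S d * e)))))"
    by (rule sw_assoc[where s=s, symmetric]) simp
  also have "\<dots> = sw h (\<lambda>u e. sw (u * Lam) (\<lambda>a b. F a (S b * e)))"
    by (simp add: sw_mult[where s=s] mult.assoc antipode_mult)
  also have "\<dots> = sw Lam (\<lambda>a b. F a (S b * h))"
    by (simp add: Lam_left sw_scale[where s=s] sw_counit_left[where s=s])
  finally show "sw Lam (\<lambda>a b. F (h * a) (S b)) = sw Lam (\<lambda>a b. F a (S b * h))" .
qed

lemma Lam_casimir_S2:
  assumes "bil s F"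
  shows "sw Lam (\<lambda>a b. F (a * h) (S b)) = sw Lam (\<lambda>a b. F a (S2 h * S b))"
proof -
  note [simp] = lin_bil_left[OF assms] lin_bil_right[OF assms]
  show ?thesis
    using Lam_casimir(2)[of s "\<lambda>a b. F a (S b)" h] by (simp add: antipode_mult)
qed

text \<open>
  The second invariance property with \<open>h = \<Lambda>\<close>, followed by
  \<open>a \<otimes> b \<mapsto> S(a) b\<close>, gives \<open>S(\<Lambda>) \<Lambda> = S(\<Lambda>)\<close>, and the left side is \<open>\<Lambda>\<close>.
\<close>

lemma antipode_Lam: "S Lam = Lam"
proof -
  have "sw Lam (\<lambda>a b. S (a * Lam) * b) = sw Lam (\<lambda>a b. S a * (b * S Lam))"
    by (rule Lam_casimir(2)[where s=scale and F="\<lambda>a b. S a * b"]) simp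
  also have "\<dots> = S Lam"
    by (simp add: mult.assoc[symmetric] sw_times[symmetric] antipode_left_sw counit_Lam)
  finally have *: "sw Lam (\<lambda>a b. S (a * Lam) * b) = S Lam" .
  have "sw Lam (\<lambda>a b. S (a * Lam) * b) = S Lam * sw Lam (\<lambda>a b. counit a *s b)"
    by (simp add: Lam_left lin_scale[OF lin_antipode] scale_mult_left scale_mult_right mult_sw)
  also have "\<dots> = Lam"
    by (simp add: sw_counit_left_H[of "\<lambda>x. x"] Lam_left counit_Lam)
  finally show ?thesis using * by metis
qed

lemma sw_Lam_antipode: "bil s F \<Longrightarrow> sw Lam (\<lambda>a b. F (S b) (S a)) = sw Lam F"
  using sw_antipode[of s F Lam] by (simp only: antipode_Lam)

text \<open>
  These traces are the integrals of the dual Hopf algebra that take the value \<open>1\<close> at \<open>\<Lambda>\<close>. The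
  formula also makes their behaviour under \<open>xy \<mapsto> yx\<close> visible at once, by cyclicity of the trace.
\<close>

definition lam :: "'h \<Rightarrow> 'k" where "lam x = tr (\<lambda>y. x * S2 y)"

definition mu :: "'h \<Rightarrow> 'k" where "mu x = tr (\<lambda>y. S2 y * x)"

lemma lin_lam: "lin (*) lam" and lin_mu: "lin (*) mu"
proof -
  have "lin (*) (\<lambda>x. tr (\<lambda>y. x * S2 y))" "lin (*) (\<lambda>x. tr (\<lambda>y. S2 y * x))" by simp_all
  then show "lin (*) lam" "lin (*) mu" by (simp_all add: lam_def[abs_def] mu_def[abs_def])
qed

lemmas lin_mu' [simp] = lin_compose[OF lin_mu]

text \<open>
  After pairing with \<open>p\<close>, the left side is the trace of \<open>y \<mapsto> \<Sum> p(x\<^sub>1) x\<^sub>2 S\<^sup>2(y)\<close>. Since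
  \<open>S\<^sup>2(y\<^sub>2) S(y\<^sub>1)\<close> cancels, this operator equals \<open>BA\<close> where \<open>A\<close> maps \<open>y\<close> to \<open>\<Sum> S(y\<^sub>1) \<otimes> x S\<^sup>2(y\<^sub>2)\<close> and \<open>B\<close>
  applies \<open>\<Delta>\<close> to the second factor and \<open>p\<close> to the product of the other two. In the opposite order
  the factors \<open>w\<^sub>1 S(w\<^sub>2)\<close> cancel, and cyclicity of the trace gives the claim. The product inside \<open>p\<close>
  is split with the basis \<open>bas\<close>, which is the index \<open>c\<close> of \<open>A\<close> and \<open>B\<close>.
\<close>

lemma lam_left_integral: "sw x (\<lambda>a b. lam b *s a) = lam x *s 1"
proof (rule eq_if_functionals_eq)
  fix p :: "'h \<Rightarrow> 'k" assume p: "lin (*) p"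
  note [simp] = lin_compose[OF p]
  define A where "A c y = sw y (\<lambda>u v. p (c * S u) *s (x * S2 v))" for c y
  define B where "B c w = sw w (\<lambda>u v. coord c u *s v)" for c w
  have linA: "lin scale (A c)" for c unfolding A_def[abs_def] by simp
  have linB: "lin scale (B c)" for c unfolding B_def[abs_def] by simp
  have sumB: "(\<Sum>c\<in>bas. sw w (\<lambda>u v. coord c u *s G c v)) = sw w (\<lambda>u v. \<Sum>c\<in>bas. coord c u *s G c v)"
    for w G by (simp add: sw_sum)
  have BA: "(\<Sum>c\<in>bas. B c (A c y)) = sw x (\<lambda>a b. p a *s (b * S2 y))" for y
  proof -
    have "(\<Sum>c\<in>bas. B c (A c y)) = sw y (\<lambda>u v. sw (x * S2 v) (\<lambda>d e. (\<Sum>c\<in>bas. coord c d * p (c * S u)) *s e))"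
      by (simp add: A_def lin_sw[OF linB] lin_scale[OF linB] sw_sum[symmetric])
        (simp add: B_def scale_sw scale_sum_left sw_sum mult.commute)
    also have "\<dots> = sw y (\<lambda>u v. sw (x * S2 v) (\<lambda>d e. p (d * S u) *s e))"
      by (simp add: lin_expand[of "(*)" "\<lambda>d. p (d * S _)", symmetric])
    also have "\<dots> = sw y (\<lambda>u v. sw x (\<lambda>a b. sw v (\<lambda>e f. p (a * S (u * S e)) *s (b * S2 f))))"
      by (simp add: sw_mult[where s=scale] sw_S2[where s=scale] antipode_mult mult.assoc)
    also have "\<dots> = sw y (\<lambda>u v. sw v (\<lambda>e f. sw x (\<lambda>a b. p (a * S (u * S e)) *s (b * S2 f))))"
      by (rule sw_cong, rule sw_swap)
    also have "\<dots> = sw x (\<lambda>a b. p a *s (b * S2 y))"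
      by (subst sw_cancel(2)[where s=scale and F="\<lambda>z f. sw x (\<lambda>a b. p (a * S z) *s (b * S2 f))"]) simp_all
    finally show ?thesis .
  qed
  have AB: "(\<Sum>c\<in>bas. A c (B c w)) = p 1 *s (x * S2 w)" for w
  proof -
    have "(\<Sum>c\<in>bas. A c (B c w)) = sw w (\<lambda>d e. sw e (\<lambda>u v. (\<Sum>c\<in>bas. coord c d * p (c * S u)) *s (x * S2 v)))"
      by (simp add: B_def lin_sw[OF linA] lin_scale[OF linA] sw_sum[symmetric])
        (simp add: A_def scale_sw scale_sum_left sw_sum mult.commute)
    also have "\<dots> = sw w (\<lambda>d e. sw e (\<lambda>u v. p (d * S u) *s (x * S2 v)))"
      by (simp add: lin_expand[of "(*)" "\<lambda>d. p (d * S _)", symmetric])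
    also have "\<dots> = p 1 *s (x * S2 w)"
      by (rule sw_cancel(2)[where s=scale and F="\<lambda>z v. p z *s (x * S2 v)"]) (simp add: lin_compose[OF p])
    finally show ?thesis .
  qed
  have "p (sw x (\<lambda>a b. lam b *s a)) = tr (\<lambda>y. sw x (\<lambda>a b. p a *s (b * S2 y)))"
    by (simp add: lin_sw[OF p] lin_scale[OF p] tr_sw tr_scale lam_def mult.commute)
  also have "\<dots> = (\<Sum>c\<in>bas. tr (\<lambda>y. B c (A c y)))"
    by (simp add: BA[symmetric] tr_sum)
  also have "\<dots> = (\<Sum>c\<in>bas. tr (\<lambda>w. A c (B c w)))"
    by (rule sum.cong[OF HOL.refl], rule tr_commute[OF linB linA])
  also have "\<dots> = p (lam x *s 1)"
    by (simp add: tr_sum[symmetric] AB tr_scale lam_def lin_scale[OF p])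
  finally show "p (sw x (\<lambda>a b. lam b *s a)) = p (lam x *s 1)" .
qed

text \<open>
  This is the mirror image of the previous argument, for the opposite and coopposite structure.
\<close>

lemma mu_right_integral: "sw x (\<lambda>a b. mu a *s b) = mu x *s 1"
proof (rule eq_if_functionals_eq)
  fix p :: "'h \<Rightarrow> 'k" assume p: "lin (*) p"
  note [simp] = lin_compose[OF p]
  define A where "A c y = sw y (\<lambda>u v. p (S v * c) *s (S2 u * x))" for c y
  define B where "B c w = sw w (\<lambda>u v. coord c v *s u)" for c w
  have linA: "lin scale (A c)" for c unfolding A_def[abs_def] by simp
  have linB: "lin scale (B c)" for c unfolding B_def[abs_def] by simp
  have BA: "(\<Sum>c\<in>bas. B c (A c y)) = sw x (\<lambda>a b. p b *s (S2 y * a))" for y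
  proof -
    have "(\<Sum>c\<in>bas. B c (A c y)) = sw y (\<lambda>u v. sw (S2 u * x) (\<lambda>d e. (\<Sum>c\<in>bas. coord c e * p (S v * c)) *s d))"
      by (simp add: A_def lin_sw[OF linB] lin_scale[OF linB] sw_sum[symmetric])
        (simp add: B_def scale_sw scale_sum_left sw_sum mult.commute)
    also have "\<dots> = sw y (\<lambda>u v. sw (S2 u * x) (\<lambda>d e. p (S v * e) *s d))"
      by (simp add: lin_expand[of "(*)" "\<lambda>d. p (S _ * d)", symmetric])
    also have "\<dots> = sw y (\<lambda>u v. sw u (\<lambda>e f. sw x (\<lambda>a b. p (S (S f * v) * b) *s (S2 e * a))))"
      by (simp add: sw_mult[where s=scale] sw_S2[where s=scale] antipode_mult mult.assoc)
    also have "\<dots> = sw y (\<lambda>e w. sw w (\<lambda>f v. sw x (\<lambda>a b. p (S (S f * v) * b) *s (S2 e * a))))"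
      by (rule sw_assoc[where s=scale]) simp
    also have "\<dots> = sw x (\<lambda>a b. p b *s (S2 y * a))"
      by (subst sw_cancel(3)[where s=scale and F="\<lambda>e z. sw x (\<lambda>a b. p (S z * b) *s (S2 e * a))"]) simp_all
    finally show ?thesis .
  qed
  have AB: "(\<Sum>c\<in>bas. A c (B c w)) = p 1 *s (S2 w * x)" for w
  proof -
    have "(\<Sum>c\<in>bas. A c (B c w)) = sw w (\<lambda>d e. sw d (\<lambda>u v. (\<Sum>c\<in>bas. coord c e * p (S v * c)) *s (S2 u * x)))"
      by (simp add: B_def lin_sw[OF linA] lin_scale[OF linA] sw_sum[symmetric])
        (simp add: A_def scale_sw scale_sum_left sw_sum mult.commute)
    also have "\<dots> = sw w (\<lambda>d e. sw d (\<lambda>u v. p (S v * e) *s (S2 u * x)))"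
      by (simp add: lin_expand[of "(*)" "\<lambda>d. p (S _ * d)", symmetric])
    also have "\<dots> = sw w (\<lambda>u d. sw d (\<lambda>v e. p (S v * e) *s (S2 u * x)))"
      by (rule sw_assoc[where s=scale]) simp
    also have "\<dots> = p 1 *s (S2 w * x)"
      by (rule sw_cancel(3)[where s=scale and F="\<lambda>u z. p z *s (S2 u * x)"]) (simp add: lin_compose[OF p])
    finally show ?thesis .
  qed
  have "p (sw x (\<lambda>a b. mu a *s b)) = tr (\<lambda>y. sw x (\<lambda>a b. p b *s (S2 y * a)))"
    by (simp add: lin_sw[OF p] lin_scale[OF p] tr_sw tr_scale mu_def mult.commute)
  also have "\<dots> = (\<Sum>c\<in>bas. tr (\<lambda>y. B c (A c y)))"
    by (simp add: BA[symmetric] tr_sum)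
  also have "\<dots> = (\<Sum>c\<in>bas. tr (\<lambda>w. A c (B c w)))"
    by (rule sum.cong[OF HOL.refl], rule tr_commute[OF linB linA])
  also have "\<dots> = p (mu x *s 1)"
    by (simp add: tr_sum[symmetric] AB tr_scale mu_def lin_scale[OF p])
  finally show "p (sw x (\<lambda>a b. mu a *s b)) = p (mu x *s 1)" .
qed

lemma lam_Lam: "lam Lam = 1"
proof -
  have "lam Lam = tr (\<lambda>y. counit y *s Lam)" by (simp add: lam_def Lam_right)
  then show ?thesis by (simp add: tr_rank_one lin_counit counit_Lam)
qed

lemma mu_Lam: "mu Lam = 1"
proof -
  have "mu Lam = tr (\<lambda>y. counit y *s Lam)" by (simp add: mu_def Lam_left)
  then show ?thesis by (simp add: tr_rank_one lin_counit counit_Lam)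
qed

lemma lam_commute: "lam (x * y) = lam (y * S2 x)"
  using tr_commute[of "\<lambda>z. x * z" "\<lambda>z. y * S2 z"]
  by (simp add: lam_def S2_mult mult.assoc)

lemma mu_commute: "mu (x * y) = mu (S2 y * x)"
  using tr_commute[of "\<lambda>z. z * y" "\<lambda>z. S2 z * x"]
  by (simp add: mu_def S2_mult mult.assoc)

lemma mu_right_integral_sw: "lin s f \<Longrightarrow> sw x (\<lambda>a b. s (mu a) (f b)) = s (mu x) (f 1)"
  using lin_sw[of s f x "\<lambda>a b. mu a *s b"] by (simp add: mu_right_integral lin_scale)

lemma left_integral_shift:
  assumes "lin (*) r" and r: "\<And>x. sw x (\<lambda>a b. r b *s a) = r x *s 1"
  shows "sw y (\<lambda>a b. r (x * b) *s a) = sw x (\<lambda>a b. r (b * y) *s S a)"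
proof -
  note [simp] = lin_compose[OF assms(1)]
  have "sw y (\<lambda>a b. r (x * b) *s a) =
      sw x (\<lambda>e u. sw u (\<lambda>f g. sw y (\<lambda>c d. r (g * d) *s (S e * f * c))))"
    by (subst sw_cancel(1)[where s=scale and F="\<lambda>z g. sw y (\<lambda>c d. r (g * d) *s (z * c))"]) simp_all
  also have "\<dots> = sw x (\<lambda>e u. S e * sw (u * y) (\<lambda>p q. r q *s p))"
    by (simp add: mult_sw scale_mult_right sw_mult[where s=scale] mult.assoc)
  also have "\<dots> = sw x (\<lambda>a b. r (b * y) *s S a)"
    by (simp add: r scale_mult_right)
  finally show ?thesis .
qed

text \<open>
  Put \<open>y = \<Lambda>\<close> in \<open>left_integral_shift\<close> and apply \<open>mu\<close>, using \<open>\<Sum> mu(\<Lambda>\<^sub>1) \<Lambda>\<^sub>2 = 1\<close>.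
\<close>

lemma left_integral_unique:
  assumes "lin (*) r" "\<And>x. sw x (\<lambda>a b. r b *s a) = r x *s 1"
  shows "r x = r Lam * mu (S x)"
proof -
  have "sw Lam (\<lambda>a b. r (x * b) *s a) = sw x (\<lambda>a b. counit b *s (r Lam *s S a))"
    by (simp add: left_integral_shift[OF assms] Lam_left lin_scale[OF assms(1)])
  also have "\<dots> = r Lam *s S x"
    by (rule sw_counit_right_H) simp
  finally have "mu (sw Lam (\<lambda>a b. r (x * b) *s a)) = r Lam * mu (S x)"
    by (simp add: lin_scale[OF lin_mu])
  moreover have "mu (sw Lam (\<lambda>a b. r (x * b) *s a)) = sw Lam (\<lambda>a b. mu a * r (x * b))"
    by (simp add: lin_sw[OF lin_mu] lin_scale[OF lin_mu] mult.commute)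
  moreover have "\<dots> = r x"
    using mu_right_integral_sw[of "(*)" "\<lambda>b. r (x * b)" Lam]
    by (simp add: lin_compose[OF assms(1)] mu_Lam)
  ultimately show ?thesis by simp
qed

lemma lam_eq_mu_antipode: "lam x = mu (S x)"
  using left_integral_unique[OF lin_lam lam_left_integral] by (simp add: lam_Lam)

text \<open>
  So \<open>\<Lambda>\<^sub>1\<close> and \<open>mu(S(\<Lambda>\<^sub>2) \<cdot> _)\<close> are dual bases. This yields an explicit formula for traces, the
  representation of every functional by \<open>mu\<close>, and the bijectivity of the antipode.
\<close>

lemma dual_basis: "sw Lam (\<lambda>a b. mu (S b * x) *s a) = x"
proof -
  have "sw Lam (\<lambda>a b. mu (S b * x) *s a) = sw Lam (\<lambda>a b. mu (S b) *s (x * a))"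
    by (rule Lam_casimir(3)[where s=scale and F="\<lambda>a b. mu b *s a", symmetric]) (simp add: lin_mu)
  also have "\<dots> = x * sw Lam (\<lambda>a b. lam b *s a)"
    by (simp add: lam_eq_mu_antipode mult_sw scale_mult_right)
  also have "\<dots> = x" by (simp add: lam_left_integral lam_Lam)
  finally show ?thesis .
qed

lemma tr_formula:
  assumes "lin scale f"
  shows "tr f = sw Lam (\<lambda>a b. mu (S b * f a))"
proof -
  have "f x = sw Lam (\<lambda>a b. mu (S b * x) *s f a)" for x
    using lin_sw[OF assms, of Lam "\<lambda>a b. mu (S b * x) *s a"]
    by (simp add: dual_basis lin_scale[OF assms])
  then have "tr f = tr (\<lambda>x. sw Lam (\<lambda>a b. mu (S b * x) *s f a))" by (rule tr_cong)
  then show ?thesis by (simp add: tr_sw tr_rank_one)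
qed

lemma mu_represents:
  assumes "lin (*) p"
  shows "p x = mu (sw Lam (\<lambda>a b. p a *s S b) * x)"
proof -
  have "p x = p (sw Lam (\<lambda>a b. mu (S b * x) *s a))" by (simp only: dual_basis)
  then show ?thesis
    by (simp add: lin_sw[OF assms] lin_scale[OF assms] sw_times lin_sw[OF lin_mu]
       scale_mult_left lin_scale[OF lin_mu] mult.commute)
qed

lemma surj_antipode: "surj S"
proof (rule surjI)
  fix x
  have "x = sw Lam (\<lambda>a b. mu (S b * x) *s a)" by (simp only: dual_basis)
  also have "\<dots> = sw Lam (\<lambda>a b. mu (S2 a * x) *s S b)"
    by (rule sw_Lam_antipode[where s=scale and F="\<lambda>a b. mu (S b * x) *s a", symmetric]) simp
  also have "\<dots> = S (sw Lam (\<lambda>a b. mu (S2 a * x) *s b))"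
    by (simp add: lin_sw[OF lin_antipode] lin_scale[OF lin_antipode])
  finally show "S (sw Lam (\<lambda>a b. mu (S2 a * x) *s b)) = x" by simp
qed

lemma mu_nondegenerate_right: "(\<And>x. mu (x * w) = 0) \<Longrightarrow> w = 0"
  using dual_basis[of w] by (simp add: sw_def split_def)

lemma mu_nondegenerate_left: "(\<And>x. mu (w * x) = 0) \<Longrightarrow> w = 0"
proof (rule mu_nondegenerate_right)
  fix x assume w: "\<And>x. mu (w * x) = 0"
  obtain y where "x = S2 y" using surj_antipode by (metis surjD)
  then show "mu (x * w) = 0" using w[of y] mu_commute[of w y] by simp
qed

section \<open>The distinguished group-like element\<close>

text \<open>
  The distinguished group-like element (modular element) of \<open>H\<close>. It measures how far the left
  integral \<open>lam\<close> is from being a right integral.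
\<close>

definition modular :: 'h where "modular = sw Lam (\<lambda>a b. lam a *s b)"

lemma lam_eq_mu_modular: "lam x = mu (S modular * x)"
  using mu_represents[OF lin_lam, of x]
  by (simp add: modular_def lin_sw[OF lin_antipode] lin_scale[OF lin_antipode])

text \<open>
  As \<open>lam = mu(S(modular) \<cdot> _)\<close>, the value \<open>lam(xy)\<close> can be rewritten with \<open>lam_commute\<close> and then with
  \<open>mu_commute\<close>. This moves \<open>S\<^sup>4(x)\<close> to the front, and \<open>mu\<close> is nondegenerate.
\<close>

lemma S4_modular: "S2 (S2 x) * S modular = S modular * x"
proof -
  have "mu ((S modular * x - S2 (S2 x) * S modular) * y) = 0" for y
  proof -
    have "mu (S modular * x * y) = lam (x * y)" by (simp add: lam_eq_mu_modular mult.assoc)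
    also have "\<dots> = lam (y * S2 x)" by (rule lam_commute)
    also have "\<dots> = mu (S modular * y * S2 x)" by (simp add: lam_eq_mu_modular mult.assoc)
    also have "\<dots> = mu (S2 (S2 x) * S modular * y)" using mu_commute[of "S modular * y" "S2 x"] by (simp add: mult.assoc)
    finally show ?thesis by (simp add: left_diff_distrib lin_diff[OF lin_mu])
  qed
  from mu_nondegenerate_left[OF this] show ?thesis by simp
qed

text \<open>
  For every functional \<open>p\<close> the convolution product of \<open>lam\<close> with \<open>p\<close> is again a left integral, so it
  is a multiple of \<open>lam\<close>. The factor is found by evaluation at \<open>\<Lambda>\<close>.
\<close>

lemma lam_right: "sw x (\<lambda>a b. lam a *s b) = lam x *s modular"
proof (rule eq_if_functionals_eq)
  fix p :: "'h \<Rightarrow> 'k" assume p: "lin (*) p"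
  note [simp] = lin_compose[OF p] lin_lam
  define r where "r x = sw x (\<lambda>a b. lam a * p b)" for x
  have 1: "lin (*) r" unfolding r_def[abs_def] using p by simp
  have "sw x (\<lambda>a b. r b *s a) = r x *s 1" for x
  proof -
    have "sw x (\<lambda>a b. r b *s a) = sw x (\<lambda>a b. sw b (\<lambda>c d. (lam c * p d) *s a))"
      by (simp add: r_def sw_scale_vec)
    also have "\<dots> = sw x (\<lambda>u d. sw u (\<lambda>a c. (lam c * p d) *s a))"
      by (rule sw_assoc[where s=scale, symmetric]) (simp add: p)
    also have "\<dots> = sw x (\<lambda>u d. p d *s sw u (\<lambda>a c. lam c *s a))"
      by (simp add: scale_sw mult.commute)
    also have "\<dots> = r x *s 1"
      by (simp add: lam_left_integral r_def sw_scale_vec mult.commute)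
    finally show ?thesis .
  qed
  from left_integral_unique[OF 1 this, of x]
  have "r x = r Lam * lam x" by (simp add: lam_eq_mu_antipode)
  then show "p (sw x (\<lambda>a b. lam a *s b)) = p (lam x *s modular)"
    by (simp add: r_def modular_def lin_sw[OF p] lin_scale[OF p] mult.commute)
qed

lemma sw_modular:
  assumes "bil s F"
  shows "sw modular F = F modular modular"
proof -
  have lF: "lin s (\<lambda>x. sw x F)" using assms by (rule lin_sw_arg)
  have l1: "lin s (\<lambda>x. F x d)" "lin s (F c)" for c d using assms by simp_all
  have vs: "vector_space s" using lin_vector_space[OF lF] .
  note [simp] = lin_lam
  have ls: "lin s (\<lambda>a. s (lam a) w)" "lin s f \<Longrightarrow> lin s (\<lambda>x. s c (f x))" for w c f
    using vs by (auto intro!: linI simp: lin_add[OF lin_lam] lin_scale[OF lin_lam] lin_add lin_scale vector_space_def mult.commute)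
  have "sw modular F = sw Lam (\<lambda>a b. s (lam a) (sw b F))"
    by (simp add: modular_def lin_sw[OF lF] lin_scale[OF lF])
  also have "\<dots> = sw Lam (\<lambda>a b. sw b (\<lambda>c d. s (lam a) (F c d)))"
    by (simp add: sw_def scale_sum_list[OF vs] split_def)
  also have "\<dots> = sw Lam (\<lambda>u d. sw u (\<lambda>a c. s (lam a) (F c d)))"
    by (rule sw_assoc[where s=s, symmetric]) (simp add: ls l1)
  also have "\<dots> = sw Lam (\<lambda>u d. F (sw u (\<lambda>a c. lam a *s c)) d)"
    by (simp add: lin_sw[OF l1(1)] lin_scale[OF l1(1)])
  also have "\<dots> = F modular (sw Lam (\<lambda>u d. lam u *s d))"
    by (subst lin_sw[OF l1(2)], rule sw_cong) (simp only: lam_right lin_scale[OF l1(1)] lin_scale[OF l1(2)])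
  finally show ?thesis by (simp only: modular_def[symmetric])
qed

lemma counit_modular: "counit modular = 1"
proof -
  have "counit modular = sw Lam (\<lambda>a b. counit b * lam a)"
    by (simp add: modular_def lin_sw[OF lin_counit] lin_scale[OF lin_counit] mult.commute)
  also have "\<dots> = lam Lam" by (rule sw_counit_right_K) (rule lin_lam)
  finally show ?thesis by (simp add: lam_Lam)
qed

lemma antipode_modular: "S modular * modular = 1" "modular * S modular = 1"
  using antipode_left_sw[of modular] antipode_right_sw[of modular]
  by (simp_all add: sw_modular[where s=scale] counit_modular)

end

context hopf_algebra
begin

text \<open>
  The condition \<open>\<Delta>(x) = x \<otimes> x\<close> is tested on pairs of functionals.
\<close>

definition grouplike :: "'h \<Rightarrow> bool" where
  "grouplike x \<longleftrightarrow> counit x = 1 \<and>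
     (\<forall>p q. lin (*) p \<longrightarrow> lin (*) q \<longrightarrow> sw x (\<lambda>a b. p a * q b) = p x * q x)"

lemma grouplike_mult:
  assumes "grouplike x" "grouplike y"
  shows "grouplike (x * y)"
  unfolding grouplike_def
proof (intro conjI allI impI)
  show "counit (x * y) = 1" using assms by (simp add: grouplike_def counit_mult)
  fix p q :: "'h \<Rightarrow> 'k" assume pq: "lin (*) p" "lin (*) q"
  note [simp] = lin_compose[OF pq(1)] lin_compose[OF pq(2)] pq
  have "sw (x * y) (\<lambda>a b. p a * q b) = sw x (\<lambda>a b. sw y (\<lambda>c d. p (a * c) * q (b * d)))"
    by (simp add: sw_mult[where s="(*)"])
  also have "\<dots> = sw x (\<lambda>a b. p (a * y) * q (b * y))"
    by (intro sw_cong) (use assms(2) in \<open>simp add: grouplike_def\<close>)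
  also have "\<dots> = p (x * y) * q (x * y)"
    using assms(1)[unfolded grouplike_def, THEN conjunct2, rule_format, of "\<lambda>a. p (a * y)" "\<lambda>b. q (b * y)"]
    by simp
  finally show "sw (x * y) (\<lambda>a b. p a * q b) = p (x * y) * q (x * y)" .
qed

lemma grouplike_one: "grouplike 1"
  unfolding grouplike_def by (simp add: counit_one sw_one[where s="(*)"])

lemma grouplike_power: "grouplike x \<Longrightarrow> grouplike (x ^ n)"
  by (induction n) (auto simp: grouplike_one grouplike_mult)

text \<open>
  If \<open>h = \<Sum> c\<^sub>t t\<close> with independent \<open>t\<close>, then comparing \<open>h \<otimes> h\<close> with \<open>\<Sum> c\<^sub>t t \<otimes> t\<close> gives
  \<open>c\<^sub>t c\<^sub>u = 0\<close> for \<open>t \<noteq> u\<close> and \<open>c\<^sub>t\<^sup>2 = c\<^sub>t\<close>, while \<open>\<epsilon>\<close> gives \<open>\<Sum> c\<^sub>t = 1\<close>. Hence \<open>h\<close> is one of the \<open>t\<close>.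
\<close>

lemma grouplike_independent_finite:
  assumes "finite T" "T \<subseteq> {x. grouplike x}"
  shows "independent T"
  using assms
proof (induction T)
  case empty
  show ?case by (rule independent_empty)
next
  case (insert h T)
  then have ind: "independent T" and h: "grouplike h" and T: "\<And>t. t \<in> T \<Longrightarrow> grouplike t" by auto
  show ?case
  proof (rule independent_insertI[OF _ ind])
    show "h \<notin> span T"
    proof
      assume "h \<in> span T"
      then have exp: "h = (\<Sum>t\<in>T. representation T h t *s t)"
        by (intro sum_representation_eq[symmetric] ind insert(1)) auto
      define c where "c t = representation T h t" for t
      define p where "p t x = representation (extend_basis T) x t" for t x
      have p: "lin (*) (p t)" for t unfolding p_def lin_def
        by (rule linear_representation) (rule independent_extend_basis[OF ind], rule span_extend_basis[OF ind])
      have pt: "p t u = (if u = t then 1 else 0)" if "u \<in> T" for t u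
        unfolding p_def using that extend_basis_superset[OF ind]
        by (subst representation_basis[OF independent_extend_basis[OF ind]]) auto
      have exp': "f h = (\<Sum>t\<in>T. c t * f t)" if "lin (*) f" for f
        using lin_sum[OF that, of "\<lambda>t. c t *s t" T] exp by (simp add: c_def lin_scale[OF that])
      have ph: "p t h = c t" if "t \<in> T" for t
        using exp'[OF p, of t] that insert(1) by (simp add: pt sum.delta if_distrib cong: if_cong)
      have cc: "c t * c u = (if t = u then c t else 0)" if "t \<in> T" "u \<in> T" for t u
      proof -
        have "c t * c u = sw h (\<lambda>a b. p t a * p u b)"
          using h p that by (simp add: grouplike_def ph)
        also have "\<dots> = (\<Sum>v\<in>T. c v * sw v (\<lambda>a b. p t a * p u b))"
          by (rule exp') (simp add: p)
        also have "\<dots> = (\<Sum>v\<in>T. if v = t then (if t = u then c t else 0) else 0)"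
          using T p by (intro sum.cong) (auto simp: grouplike_def pt)
        finally show ?thesis using that insert(1) by simp
      qed
      have "(\<Sum>t\<in>T. c t) = 1"
        using exp'[OF lin_counit] h T by (simp add: grouplike_def)
      then obtain t where t: "t \<in> T" "c t \<noteq> 0" by (metis sum.neutral zero_neq_one)
      then have "c t = 1" using cc[of t t] by simp
      moreover have "c u = 0" if "u \<in> T" "u \<noteq> t" for u
        using cc[of t u] that t \<open>c t = 1\<close> by simp
      ultimately have "(\<Sum>u\<in>T. c u *s u) = (\<Sum>u\<in>T. if u = t then t else 0)"
        by (intro sum.cong) auto
      then have "h = t" using exp t insert(1) by (simp add: c_def)
      then show False using insert(2) t by simp
    qed
  qed
qed

text \<open>
  The powers of \<open>x\<close> are group-like, so infinitely many distinct ones would be independent.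
\<close>

lemma grouplike_finite_order:
  assumes "grouplike x" "y * x = 1"
  obtains N where "N > 0" "x ^ N = 1"
proof -
  have "\<not> inj (\<lambda>n::nat. x ^ n)"
  proof
    assume inj: "inj (\<lambda>n::nat. x ^ n)"
    define T where "T = (\<lambda>n. x ^ n) ` {..card bas}"
    have "independent T"
      unfolding T_def using assms by (intro grouplike_independent_finite) (auto intro: grouplike_power)
    then have "card T \<le> card bas"
      using fd.independent_card_le_dim[of T UNIV] fd.dim_UNIV by simp
    then show False unfolding T_def using inj by (simp add: card_image inj_on_subset)
  qed
  then obtain i j where ij: "i < j" "x ^ i = x ^ j" by (metis injI linorder_neqE_nat)
  have "y ^ i * x ^ i = 1"
    by (induction i) (use assms(2) in \<open>simp_all add: power_commutes mult.assoc\<close>,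
      metis mult.assoc mult.left_neutral power_commutes)
  then have "x ^ (j - i) = 1" using ij
    by (metis le_add_diff_inverse less_imp_le mult.assoc mult_1 power_add)
  then show ?thesis using that[of "j - i"] ij(1) by simp
qed

end

context semisimple_hopf_algebra
begin

lemma modular_finite_order: obtains N where "N > 0" "modular ^ N = 1"
  by (rule grouplike_finite_order[of modular "S modular"])
    (auto simp: grouplike_def counit_modular sw_modular[where s="(*)"] antipode_modular)

lemma S4_eq: "S2 (S2 x) = S modular * x * modular"
  by (metis S4_modular antipode_modular(1) mult.assoc mult.right_neutral)

end

context hopf_algebra
begin

section \<open>Polynomials in one element\<close>

definition eval_at :: "'k poly \<Rightarrow> 'h \<Rightarrow> 'h" where
  "eval_at p x = fold_coeffs (\<lambda>a r. a *s 1 + x * r) p 0"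

lemma eval_at_0 [simp]: "eval_at 0 x = 0"
  by (simp add: eval_at_def)

lemma eval_at_pCons [simp]: "eval_at (pCons a p) x = a *s 1 + x * eval_at p x"
  by (cases "a = 0 \<and> p = 0") (auto simp: eval_at_def)

lemma eval_at_add: "eval_at (p + q) x = eval_at p x + eval_at q x"
proof (induction p arbitrary: q)
  case (pCons a p)
  obtain b r where "q = pCons b r" by (rule pCons_cases)
  then show ?case
    by (simp add: pCons.IH scale_left_distrib distrib_left)
qed simp

lemma eval_at_smult: "eval_at (smult c p) x = c *s eval_at p x"
  by (induction p) (auto simp: scale_right_distrib scale_mult_right)

lemma eval_at_monom: "eval_at (monom 1 n) x = x ^ n"
  by (induction n) (auto simp: monom_0 monom_Suc)

lemma eval_at_linear_factor: "eval_at ([:- c, 1:] * p) x = x * eval_at p x - c *s eval_at p x"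
proof -
  have "[:- c, 1:] * p = smult (- c) p + pCons 0 p" by simp
  then show ?thesis by (simp only: eval_at_add eval_at_smult) simp
qed

lemma eval_at_commute: "x * eval_at p x = eval_at p x * x"
  by (induction p)
    (auto simp: distrib_left distrib_right scale_mult_left scale_mult_right mult.assoc[symmetric])

text \<open>
  Otherwise all powers of \<open>x\<close> would be independent, against the finite dimension.
\<close>

lemma annihilating_polynomial: obtains p where "p \<noteq> 0" "eval_at p x = 0"
proof (rule ccontr)
  assume "\<not> thesis"
  then have none: "p = 0" if "eval_at p x = 0" for p using that \<open>\<And>p. p \<noteq> 0 \<Longrightarrow> eval_at p x = 0 \<Longrightarrow> thesis\<close> by blast
  define X where "X m = (\<lambda>i. x ^ i) ` {..<m}" for m :: nat
  have sp: "\<exists>q. y = eval_at q x \<and> (\<forall>i\<ge>m. coeff q i = 0)" if "y \<in> span (X m)" for y m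
    using that
  proof (induction rule: span_induct_alt)
    case base
    show ?case by (rule exI[of _ 0]) simp
  next
    case (step c z y)
    then obtain i q where "z = x ^ i" "i < m" "y = eval_at q x" "\<forall>i\<ge>m. coeff q i = 0"
      by (auto simp: X_def)
    then show ?case
      by (intro exI[of _ "smult c (monom 1 i) + q"]) (auto simp: eval_at_add eval_at_smult eval_at_monom)
  qed
  have notin: "x ^ m \<notin> span (X m)" for m
  proof
    assume "x ^ m \<in> span (X m)"
    then obtain q where q: "x ^ m = eval_at q x" "\<forall>i\<ge>m. coeff q i = 0" using sp by blast
    have "eval_at (monom 1 m + smult (-1) q) x = 0"
      by (simp add: eval_at_add eval_at_smult[of "-1"] eval_at_monom q(1) del: smult_minus_left)
    then have "monom 1 m + smult (-1) q = 0" by (rule none)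
    then have "coeff (monom 1 m + smult (-1) q) m = 0" by simp
    then show False using q(2) by simp
  qed
  have "independent (X m) \<and> card (X m) = m" for m
  proof (induction m)
    case 0
    then show ?case by (simp add: X_def independent_empty)
  next
    case (Suc m)
    have "X (Suc m) = insert (x ^ m) (X m)" by (auto simp: X_def lessThan_Suc)
    moreover have "x ^ m \<notin> X m" using notin span_base by blast
    moreover have "finite (X m)" by (simp add: X_def)
    ultimately show ?case using Suc independent_insertI[OF notin] by simp
  qed
  then have "Suc (dim UNIV) \<le> dim UNIV"
    using fd.independent_card_le_dim[of "X (Suc (dim UNIV))" UNIV] by simp
  then show False by simp
qed

text \<open>
  If \<open>X\<^sup>k q\<close> with \<open>q(0) \<noteq> 0\<close> annihilates \<open>x\<close>, then \<open>x\<^sup>k\<close> is a multiple of \<open>x\<^bsup>k+1\<^esup>\<close>. The element \<open>x r\<close> is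
  a polynomial in \<open>x\<close> without constant term. Its powers become idempotent, and this
  idempotent is zero only if \<open>x\<close> is nilpotent.
\<close>

lemma fitting: obtains k r where "x ^ k = x ^ k * (x * r)" "x * r = r * x"
    "\<And>N. \<lbrakk>subspace N; \<And>i. x ^ Suc i \<in> N\<rbrakk> \<Longrightarrow> x * r \<in> N"
proof -
  have main: "\<exists>k s. x ^ k = x ^ Suc k * eval_at s x" if "p \<noteq> 0" "x ^ j * eval_at p x = 0" for p j
    using that
  proof (induction p arbitrary: j)
    case (pCons a p)
    show ?case
    proof (cases "a = 0")
      case True
      then have "x ^ Suc j * eval_at p x = 0" "p \<noteq> 0"
        using pCons.prems by (simp_all add: power_Suc2 mult.assoc del: power_Suc)
      then show ?thesis using pCons.IH by blast
    next
      case False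
      have "a *s x ^ j = - (x ^ j * (x * eval_at p x))"
        using pCons.prems by (simp add: distrib_left scale_mult_right eq_neg_iff_add_eq_0)
      then have "inverse a *s a *s x ^ j = inverse a *s (- (x ^ j * (x * eval_at p x)))" by simp
      then have "x ^ j = x ^ Suc j * eval_at (smult (- inverse a) p) x"
        using False
        by (simp add: eval_at_smult scale_mult_right power_commutes mult.assoc[symmetric] del: smult_minus_left)
      then show ?thesis by blast
    qed
  qed simp
  obtain p where p: "p \<noteq> 0" "eval_at p x = 0" by (rule annihilating_polynomial)
  then obtain k s where ks: "x ^ k = x ^ Suc k * eval_at s x" using main[of p 0] by auto
  have "x * eval_at s x \<in> N" if "subspace N" "\<And>i. x ^ Suc i \<in> N" for N
  proof -
    have "x ^ Suc i * eval_at s x \<in> N" for i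
    proof (induction s arbitrary: i)
      case 0
      show ?case using that by (simp add: subspace_0)
    next
      case (pCons a s)
      have "x ^ Suc i * eval_at (pCons a s) x = a *s x ^ Suc i + x ^ Suc (Suc i) * eval_at s x"
        by (simp only: eval_at_pCons distrib_left scale_mult_right mult_1_right power_Suc2[of x "Suc i"] mult.assoc)
      then show ?case using that pCons.IH[of "Suc i"] by (metis subspace_add subspace_scale)
    qed
    from this[of 0] show ?thesis by simp
  qed
  moreover have "x ^ k = x ^ k * (x * eval_at s x)" using ks by (simp only: power_Suc2 mult.assoc)
  ultimately show ?thesis using eval_at_commute[of x s] that by blast
qed

section \<open>The regular trace\<close>

definition tau :: "'h \<Rightarrow> 'k" where "tau x = tr (\<lambda>y. x * y)"

lemma lin_tau: "lin (*) tau"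
proof -
  have "lin (*) (\<lambda>x. tr (\<lambda>y. x * y))" by simp
  then show ?thesis by (simp add: tau_def[abs_def])
qed

lemmas lin_tau' [simp] = lin_compose[OF lin_tau]

lemma tau_commute: "tau (x * y) = tau (y * x)"
  using tr_commute[of "\<lambda>z. x * z" "\<lambda>z. y * z"] by (simp add: tau_def mult.assoc)

definition rank :: "'h \<Rightarrow> nat" where "rank u = dim (range (\<lambda>y. u * y))"

lemma tau_idempotent: "u * u = u \<Longrightarrow> tau u = of_nat (rank u)"
  unfolding tau_def rank_def by (rule tr_idempotent) (simp_all add: mult.assoc[symmetric])

lemma rank_eq_0: "rank u = 0 \<longleftrightarrow> u = 0"
proof
  assume "rank u = 0"
  then have "range (\<lambda>y. u * y) \<subseteq> {0}" unfolding rank_def using fd.dim_eq_0 by simp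
  then have "u * 1 = 0" by blast
  then show "u = 0" by simp
qed (simp add: rank_def)

end

text \<open>
  Split a linear factor off a polynomial that annihilates \<open>w\<close>. Either the cofactor still
  annihilates \<open>w\<close>, or it maps \<open>w\<close> to an eigenvector.
\<close>

lemma (in hopf_algebra) eigenvector:
  assumes "w \<noteq> 0" and alg: "\<And>p :: 'k poly. degree p > 0 \<Longrightarrow> \<exists>x. poly p x = 0"
  obtains c r where "r * w \<noteq> 0" "z * (r * w) = c *s (r * w)"
proof -
  have "\<exists>c r. r * w \<noteq> 0 \<and> z * (r * w) = c *s (r * w)" if "p \<noteq> 0" "eval_at p z * w = 0" for p
    using that
  proof (induction "degree p" arbitrary: p rule: less_induct)
    case less
    have "degree p \<noteq> 0"
    proof
      assume "degree p = 0"
      then obtain a where "p = [:a:]" by (rule degree_eq_zeroE)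
      then show False using less.prems assms(1) by (simp add: scale_mult_left)
    qed
    then obtain c where "poly p c = 0" using alg by blast
    then obtain q where q: "p = [:- c, 1:] * q" by (auto simp: poly_eq_0_iff_dvd elim: dvdE)
    then have "q \<noteq> 0" using less.prems by auto
    then have "degree p = degree [:- c, 1:] + degree q"
      unfolding q by (intro degree_mult_eq) auto
    then have deg: "degree q < degree p" by simp
    show ?case
    proof (cases "eval_at q z * w = 0")
      case True
      then show ?thesis using less.hyps[OF deg \<open>q \<noteq> 0\<close>] by blast
    next
      case False
      have "z * (eval_at q z * w) = c *s (eval_at q z * w)"
        using less.prems(2) unfolding q eval_at_linear_factor
        by (simp add: left_diff_distrib scale_mult_left mult.assoc)
      then show ?thesis using False by blast
    qed
  qed
  moreover obtain p where "p \<noteq> 0" "eval_at p z = 0" by (rule annihilating_polynomial)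
  ultimately show ?thesis using that by (metis mult_zero_left)
qed

context semisimple_hopf_algebra
begin

lemma tau_idempotent_eq_0: "u * u = u \<Longrightarrow> tau u = 0 \<Longrightarrow> u = 0"
  using tau_idempotent[of u] rank_eq_0[of u] by simp

text \<open>
  The radical of the form is an ideal, so it has a right unit \<open>u\<close>, which is idempotent. The trace
  of \<open>u\<close> is the dimension of \<open>uH\<close> and it vanishes, hence \<open>u = 0\<close> in characteristic zero.
\<close>

lemma tau_nondegenerate: "(\<And>y. tau (x * y) = 0) \<Longrightarrow> x = 0"
proof -
  assume x: "\<And>y. tau (x * y) = 0"
  define I where "I = {x. \<forall>y. tau (x * y) = 0}"
  have "left_ideal I"
    unfolding left_ideal_def
  proof (intro conjI ballI allI subspaceI)
    fix a x assume "x \<in> I"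
    then show "a * x \<in> I" unfolding I_def using tau_commute[of a] by (auto simp: mult.assoc)
  qed (auto simp: I_def lin_zero[OF lin_tau] lin_add[OF lin_tau] lin_scale[OF lin_tau] distrib_right scale_mult_left)
  then obtain u where u: "u \<in> I" "\<And>x. x \<in> I \<Longrightarrow> x * u = x"
    using left_ideal_right_unit[OF semisimple] by blast
  have "tau (u * 1) = 0" using u(1) unfolding I_def by blast
  then have "u = 0" using tau_idempotent_eq_0 u by simp
  moreover have "x * u = x" using x u(2) unfolding I_def by simp
  ultimately show "x = 0" by simp
qed

text \<open>
  Represent \<open>tau\<close> as \<open>mu(v \<cdot> _)\<close>. Since \<open>tau\<close> is symmetric and \<open>mu\<close> is symmetric up to \<open>S\<^sup>2\<close>, it
  follows that \<open>v x = S\<^sup>2(x) v\<close>. Nondegeneracy of \<open>tau\<close> makes \<open>v\<close> invertible.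
\<close>

lemma S2_inner: "\<exists>v w. v * w = 1 \<and> w * v = 1 \<and> (\<forall>x. S2 x = v * x * w) \<and> (\<forall>x. mu x = tau (w * x))"
proof -
  define v where "v = sw Lam (\<lambda>a b. tau a *s S b)"
  have tau: "tau x = mu (v * x)" for x
    unfolding v_def by (rule mu_represents[OF lin_tau])
  have vx: "v * x = S2 x * v" for x
  proof -
    have "mu ((v * x - S2 x * v) * y) = 0" for y
    proof -
      have "mu (v * x * y) = tau (x * y)" by (simp add: tau mult.assoc)
      also have "\<dots> = tau (y * x)" by (rule tau_commute)
      also have "\<dots> = mu (S2 x * v * y)" using mu_commute[of "v * y" x] by (simp add: tau mult.assoc)
      finally show ?thesis by (simp add: left_diff_distrib lin_diff[OF lin_mu])
    qed
    from mu_nondegenerate_left[OF this] show ?thesis by simp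
  qed
  have inj: "inj (\<lambda>x. v * x)"
  proof (rule injI)
    fix x y assume "v * x = v * y"
    then have "v * (x - y) = 0" by (simp add: right_diff_distrib)
    then have "tau ((x - y) * z) = 0" for z
      by (simp add: tau mult.assoc[symmetric] lin_zero[OF lin_mu])
    then have "x - y = 0" by (rule tau_nondegenerate)
    then show "x = y" by simp
  qed
  moreover have "Vector_Spaces.linear scale scale (\<lambda>x. v * x)"
    using lin_mult_left[OF lin_ident] by (simp add: lin_def)
  ultimately have "surj (\<lambda>x. v * x)" using fd.linear_inj_imp_surj by blast
  then obtain w where w: "v * w = 1" by (metis surjD)
  have "v * (w * v) = v * 1" using w by (simp add: mult.assoc[symmetric])
  then have w': "w * v = 1" using inj by (simp add: inj_def)
  have "S2 x = v * x * w" for x by (metis vx mult.assoc w mult.right_neutral)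
  moreover have "mu x = tau (w * x)" for x by (simp add: tau mult.assoc[symmetric] w)
  ultimately show ?thesis using w w' by blast
qed

section \<open>Central idempotents\<close>

text \<open>
  For a group algebra this is the average of the conjugates of \<open>x\<close>.
\<close>

definition casimir :: "'h \<Rightarrow> 'h" where "casimir x = sw Lam (\<lambda>a b. a * x * S b)"

lemma lin_casimir: "lin scale casimir"
  unfolding casimir_def[abs_def] by simp

lemma casimir_central: "h * casimir x = casimir x * h"
  using Lam_casimir(3)[of scale "\<lambda>a b. a * x * b" h]
  by (simp add: casimir_def mult_sw sw_times mult.assoc)

lemma casimir_one: "casimir 1 = 1"
  by (simp add: casimir_def antipode_right_sw counit_Lam)

definition central_idempotent :: "'h \<Rightarrow> bool" where "central_idempotent e \<longleftrightarrow> e * e = e \<and> (\<forall>x. e * x = x * e)"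

text \<open>
  If \<open>u\<close> is a right unit of the ideal, averaging \<open>1 - u\<close> with the Casimir element makes it
  central without changing it modulo the ideal.
\<close>

lemma ideal_central_idempotent:
  assumes "left_ideal I" "\<And>x a. x \<in> I \<Longrightarrow> x * a \<in> I"
  obtains f where "central_idempotent f" "\<And>x. x \<in> I \<Longrightarrow> x * f = 0" "1 - f \<in> I"
proof -
  obtain u where u: "u \<in> I" "\<And>x. x \<in> I \<Longrightarrow> x * u = x"
    using left_ideal_right_unit[OF semisimple assms(1)] by blast
  define f where "f = casimir (1 - u)"
  have central: "\<And>x. f * x = x * f" unfolding f_def by (rule casimir_central[symmetric])
  have sub: "subspace I" and left: "\<And>a x. x \<in> I \<Longrightarrow> a * x \<in> I"
    using assms(1) by (auto simp: left_ideal_def)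
  have If: "x * f = 0" if x: "x \<in> I" for x
  proof -
    have "x * a * (1 - u) = 0" for a
      using u(2)[OF assms(2)[OF x, of a]] by (simp add: right_diff_distrib)
    then show ?thesis by (simp add: f_def casimir_def mult_sw mult.assoc[symmetric]) (simp add: sw_def split_def)
  qed
  have "sw Lam (\<lambda>a b. a * u * S b) \<in> I"
  proof -
    have "a * u * S b \<in> I" for a b using u(1) assms(2) left by blast
    then have "(\<Sum>(a, b)\<leftarrow>xs. a * u * S b) \<in> I" for xs
      by (induction xs) (auto intro: subspace_0[OF sub] subspace_add[OF sub])
    then show ?thesis by (simp add: sw_def)
  qed
  moreover have "1 - f = casimir u"
    by (simp add: f_def lin_diff[OF lin_casimir] casimir_one)
  ultimately have 1: "1 - f \<in> I" by (simp add: casimir_def)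
  have "f * f = f" using If[OF 1] by (simp add: left_diff_distrib)
  then have "central_idempotent f" unfolding central_idempotent_def using central by blast
  then show ?thesis using If 1 by (rule that)
qed

definition primitive :: "'h \<Rightarrow> bool" where
  "primitive e \<longleftrightarrow> central_idempotent e \<and> e \<noteq> 0 \<and> (\<forall>e'. central_idempotent e' \<longrightarrow> e' * e = e' \<longrightarrow> e' = 0 \<or> e' = e)"

text \<open>
  Choose an eigenvalue \<open>c\<close> of \<open>z\<close> on \<open>He\<close>. The element \<open>y = z - c e\<close> is central and not invertible on
  \<open>He\<close>, so the ideal \<open>Hy\<close> is generated by a central idempotent below \<open>e\<close> that is different from \<open>e\<close>.
  By primitivity it is zero.
\<close>

lemma primitive_center:
  assumes e: "primitive e" and z: "\<And>x. z * x = x * z" "z * e = z"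
  obtains c where "z = c *s e"
proof -
  have ee: "e * e = e" "\<And>x. e * x = x * e" "e \<noteq> 0" using e unfolding primitive_def central_idempotent_def by blast+
  obtain c r where r: "r * e \<noteq> 0" "z * (r * e) = c *s (r * e)"
    using eigenvector[OF ee(3), of z] alg_closed_imp_poly_has_root by blast
  define y where "y = z - c *s e"
  have yc: "y * x = x * y" for x
    by (simp add: y_def left_diff_distrib right_diff_distrib z ee scale_mult_left scale_mult_right)
  have ye: "y * e = y" by (simp add: y_def left_diff_distrib z(2) ee(1) scale_mult_left)
  have yr: "y * (r * e) = 0"
  proof -
    have "e * (r * e) = r * e" by (simp add: ee(2)[of "r * e"] mult.assoc ee(1))
    then show ?thesis by (simp add: y_def left_diff_distrib r scale_mult_left)
  qed
  define I where "I = range (\<lambda>h. h * y)"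
  have "left_ideal I"
    unfolding left_ideal_def I_def
  proof (intro conjI subspaceI allI ballI)
    show "0 \<in> range (\<lambda>h. h * y)" by (rule range_eqI[of _ _ 0]) simp
  next
    fix a b assume "a \<in> range (\<lambda>h. h * y)" "b \<in> range (\<lambda>h. h * y)"
    then show "a + b \<in> range (\<lambda>h. h * y)" by (auto simp: distrib_right[symmetric])
  next
    fix k a assume "a \<in> range (\<lambda>h. h * y)"
    then show "k *s a \<in> range (\<lambda>h. h * y)" by (auto simp: scale_mult_left[symmetric])
  next
    fix b a assume "a \<in> range (\<lambda>h. h * y)"
    then show "b * a \<in> range (\<lambda>h. h * y)" by (auto simp: mult.assoc[symmetric])
  qed
  moreover have "x * a \<in> I" if xI: "x \<in> I" for x a
  proof -
    obtain h where "x = h * y" using xI by (auto simp: I_def)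
    then have "x * a = h * a * y" using yc[of a] by (simp add: mult.assoc)
    then show ?thesis by (auto simp: I_def)
  qed
  ultimately obtain f where f: "central_idempotent f" "\<And>x. x \<in> I \<Longrightarrow> x * f = 0" "1 - f \<in> I"
    using ideal_central_idempotent by blast
  obtain h where h: "1 - f = h * y" using f(3) by (auto simp: I_def)
  have fc: "\<And>x. f * x = x * f" and ff: "f * f = f" using f(1) unfolding central_idempotent_def by blast+
  have fy: "y * f = 0" using f(2)[of y] unfolding I_def by (metis mult_1 rangeI)
  have "central_idempotent (1 - f)"
    unfolding central_idempotent_def by (simp add: left_diff_distrib right_diff_distrib ff) (metis fc)
  moreover have "(1 - f) * e = 1 - f" by (simp add: h mult.assoc ye)
  moreover have "1 - f \<noteq> e"
  proof
    assume "1 - f = e"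
    then have "e = h * y" using h by simp
    then have "e * (r * e) = h * (y * (r * e))" by (metis mult.assoc)
    then have "e * (r * e) = 0" by (simp only: yr mult_zero_right)
    then have "r * e = 0" by (simp add: ee(2)[of "r * e"] mult.assoc ee(1))
    then show False using r(1) by simp
  qed
  ultimately have "1 - f = 0" using e unfolding primitive_def by blast
  then have "y = 0" using fy by simp
  then show ?thesis using that[of c] by (simp add: y_def)
qed

text \<open>
  Induction on the dimension of \<open>He\<close> replaces the decomposition of \<open>1\<close> into primitive idempotents.
\<close>

lemma central_idempotent_induct [consumes 1, case_names zero primitive add]:
  assumes "central_idempotent e" "P 0" "\<And>e. primitive e \<Longrightarrow> P e"
    "\<And>e f. central_idempotent e \<Longrightarrow> central_idempotent f \<Longrightarrow> e * f = 0 \<Longrightarrow> P e \<Longrightarrow> P f \<Longrightarrow> P (e + f)"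
  shows "P e"
  using assms(1)
proof (induction "rank e" arbitrary: e rule: less_induct)
  case less
  show ?case
  proof (cases "e = 0 \<or> primitive e")
    case False
    then obtain e' where e': "central_idempotent e'" "e' * e = e'" "e' \<noteq> 0" "e' \<noteq> e"
      using less.prems unfolding primitive_def by blast
    define f where "f = e - e'"
    have ee': "e * e' = e'" using e'(1,2) unfolding central_idempotent_def by metis
    have sq: "e * e = e" "e' * e' = e'" using less.prems e'(1) unfolding central_idempotent_def by blast+
    have ff: "f * f = f" "e' * f = 0"
      by (simp_all add: f_def left_diff_distrib right_diff_distrib sq ee' e'(2))
    moreover have "f * x = x * f" for x
      using less.prems e'(1) unfolding f_def central_idempotent_def left_diff_distrib right_diff_distrib by metis
    ultimately have f: "central_idempotent f" "e' * f = 0" unfolding central_idempotent_def by blast+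
    have "of_nat (rank e) = (of_nat (rank e' + rank f) :: 'k)"
      using tau_idempotent[OF sq(1)] tau_idempotent[OF sq(2)] tau_idempotent[OF ff(1)]
        lin_diff[OF lin_tau, of e e'] unfolding f_def of_nat_add by (metis add.commute diff_add_cancel)
    then have "rank e = rank e' + rank f" by (simp only: of_nat_eq_iff)
    moreover have "rank e' \<noteq> 0" "rank f \<noteq> 0" using e'(3,4) by (simp_all add: rank_eq_0 f_def)
    ultimately have "P e'" "P f" using less.hyps e'(1) f(1) by simp_all
    then have "P (e' + f)" using assms(4) e'(1) f by blast
    then show ?thesis by (simp add: f_def)
  qed (use assms in auto)
qed

text \<open>
  For a matrix block this is \<open>Tr(y \<mapsto> a y b) = tr(a) tr(b)\<close>, written with regular traces. The
  element \<open>K\<close> below is the Casimir average of \<open>a\<close> with respect to \<open>tau\<close>. It is central, so it acts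
  on the block as a scalar, and this scalar is read off from the case \<open>b = 1\<close>.
\<close>

lemma tr_primitive:
  assumes e: "primitive e"
  shows "tr (\<lambda>y. e * (a * y * b)) * tau e = tau (e * a) * tau (e * b)"
proof -
  obtain v w where vw: "v * w = 1" "w * v = 1" "\<And>x. S2 x = v * x * w" "\<And>x. mu x = tau (w * x)"
    using S2_inner by blast
  have ee: "e * e = e" "\<And>x. e * x = x * e" using e unfolding primitive_def central_idempotent_def by blast+
  define K where "K = sw Lam (\<lambda>p q. w * S q * (e * a) * p)"
  have "K * h = h * K" for h
  proof -
    have "K * h = sw Lam (\<lambda>p q. w * S q * (e * a) * (p * h))"
      by (simp add: K_def sw_times mult.assoc)
    also have "\<dots> = sw Lam (\<lambda>p q. w * (S2 h * S q) * (e * a) * p)"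
      by (rule Lam_casimir_S2[where s=scale and F="\<lambda>p q. w * q * (e * a) * p"]) simp
    also have "\<dots> = h * K"
      by (simp add: K_def mult_sw vw(3) mult.assoc[symmetric] vw(2))
    finally show ?thesis .
  qed
  moreover have "K * e = K"
  proof -
    have "K * e = sw Lam (\<lambda>p q. w * S q * (e * a) * (p * e))"
      by (simp add: K_def sw_times mult.assoc)
    also have "\<dots> = K" unfolding K_def
    proof (rule sw_cong)
      fix p q
      have "e * a * (p * e) = e * a * p"
        by (metis ee mult.assoc)
      then show "w * S q * (e * a) * (p * e) = w * S q * (e * a) * p"
        by (metis mult.assoc)
    qed
    finally show ?thesis .
  qed
  ultimately obtain c where c: "K = c *s e" using primitive_center[OF e, of K] by metis
  have tr: "tr (\<lambda>y. e * (a * y * b)) = c * tau (e * b)" for b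
  proof -
    have "tr (\<lambda>y. e * (a * y * b)) = sw Lam (\<lambda>p q. tau (w * S q * (e * a) * p * b))"
      by (subst tr_formula) (simp_all add: vw(4) mult.assoc)
    also have "\<dots> = tau (K * b)" by (simp add: K_def sw_times lin_sw[OF lin_tau])
    finally show ?thesis by (simp add: c scale_mult_left lin_scale[OF lin_tau])
  qed
  have "tau (e * a) = c * tau e"
    using tr[of 1] by (simp add: tau_def mult.assoc[symmetric])
  then show ?thesis by (simp add: tr)
qed

end

section \<open>Roots of unity in characteristic zero\<close>

lemma card_roots_of_unity_alg_closed:
  fixes m :: nat
  assumes "m > 0"
  shows "card {x :: 'k::{alg_closed_field,field_char_0}. x ^ m = 1} = m"
proof -
  define p :: "'k poly" where "p = monom 1 m + (- 1)"
  have deg: "degree p = m"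
    unfolding p_def using assms by (subst degree_add_eq_left) (auto simp: degree_monom_eq)
  have p0: "p \<noteq> 0" using deg assms by auto
  have root: "poly p x = 0 \<longleftrightarrow> x ^ m = 1" for x by (simp add: p_def poly_monom)
  have "rsquarefree p"
    unfolding rsquarefree_roots
  proof (intro allI notI)
    fix a assume "poly p a = 0 \<and> poly (pderiv p) a = 0"
    then have "a ^ m = 1" "of_nat m * a ^ (m - 1) = 0"
      by (auto simp: root p_def pderiv_diff pderiv_monom poly_monom)
    moreover from \<open>a ^ m = 1\<close> assms have "a \<noteq> 0" by (metis power_0_left zero_neq_one less_irrefl)
    ultimately show False using assms by simp
  qed
  then have order: "order x p = 1" if "x ^ m = 1" for x
    using rsquarefree_root_order p0 root that by blast
  obtain A where A: "size A = degree p" "p = smult (lead_coeff p) (\<Prod>x\<in>#A. [:-x, 1:])"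
    using alg_closed_imp_factorization[OF p0] by blast
  have "(\<Prod>x\<in>#B. [:-x, 1:]) \<noteq> 0 \<and> proots (\<Prod>x\<in>#B. [:-x, 1:]) = B" for B :: "'k multiset"
  proof (induction B)
    case (add x B)
    define P :: "'k poly" where "P = (\<Prod>x\<in>#B. [:-x, 1:])"
    have P: "P \<noteq> 0" "proots P = B" using add.IH unfolding P_def by blast+
    have eq: "(\<Prod>x\<in>#add_mset x B. [:-x, 1:]) = [:-x, 1:] * P"
      by (simp only: image_mset_add_mset prod_mset.add_mset P_def)
    have ne: "[:-x, 1:] * P \<noteq> 0" using P(1) by (intro no_zero_divisors) auto
    have "proots ([:-x, 1:] * P) = proots [:-x, 1:] + proots P"
      by (rule proots_mult) (use P(1) in simp_all)
    then have "proots ([:-x, 1:] * P) = add_mset x B"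
      unfolding P(2) proots_linear_factor by simp
    with ne show ?case unfolding eq by blast
  qed simp
  then have "proots p = A"
    using p0 A(2) by (metis leading_coeff_0_iff proots_smult)
  then have "size (proots p) = m" using A deg by simp
  moreover have "size (proots p) = (\<Sum>x\<in>{x :: 'k. x ^ m = 1}. 1)"
    unfolding size_multiset_overloaded_eq by (rule sum.cong) (use p0 order in \<open>auto simp: root\<close>)
  ultimately show ?thesis by simp
qed

text \<open>
  Sorting the \<open>M\<close>-th roots of unity by their exact order gives the recursion that determines the
  totient function.
\<close>

lemma exact_order_count:
  fixes M :: nat
  assumes "M > 0"
  shows "card {x :: 'k::{alg_closed_field,field_char_0}. x ^ M = 1 \<and> (\<forall>k. 0 < k \<longrightarrow> k < M \<longrightarrow> x ^ k \<noteq> 1)}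
    = totient M"
  using assms
proof (induction M rule: less_induct)
  case (less M)
  define Od where "Od d = {x :: 'k. x ^ d = 1 \<and> (\<forall>k. 0 < k \<longrightarrow> k < d \<longrightarrow> x ^ k \<noteq> 1)}" for d
  have fin: "finite {x :: 'k. x ^ m = 1}" if "m > 0" for m
    using card_roots_of_unity_alg_closed[OF that, where 'k='k] that card.infinite by fastforce
  have union: "{x. x ^ M = 1} = (\<Union>d\<in>{d. d dvd M}. Od d)"
  proof (intro equalityI subsetI)
    fix x :: 'k assume x: "x \<in> {x. x ^ M = 1}"
    define d where "d = (LEAST d. 0 < d \<and> x ^ d = 1)"
    have d: "0 < d \<and> x ^ d = 1" unfolding d_def
      by (rule LeastI[of "\<lambda>d. 0 < d \<and> x ^ d = 1" M]) (use x less.prems in simp)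
    have least: "x ^ k \<noteq> 1" if "0 < k" "k < d" for k
      using not_less_Least[of k "\<lambda>d. 0 < d \<and> x ^ d = 1"] that unfolding d_def by blast
    have "x ^ (M mod d) = 1"
    proof -
      have "x ^ M = (x ^ d) ^ (M div d) * x ^ (M mod d)"
        by (metis mult_div_mod_eq power_add power_mult)
      then show ?thesis using x d by simp
    qed
    then have "M mod d = 0" using least[of "M mod d"] d by (metis mod_less_divisor neq0_conv)
    then have "d dvd M" by (rule dvd_eq_mod_eq_0[THEN iffD2])
    then show "x \<in> (\<Union>d\<in>{d. d dvd M}. Od d)" using d least unfolding Od_def by (auto simp: dvd_eq_mod_eq_0)
  next
    fix x :: 'k assume "x \<in> (\<Union>d\<in>{d. d dvd M}. Od d)"
    then show "x \<in> {x. x ^ M = 1}" by (auto simp: Od_def power_mult elim!: dvdE)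
  qed
  have finO: "finite (Od d)" if "d dvd M" for d
    using fin[of d] that less.prems unfolding Od_def by (auto intro: finite_subset[rotated] dvd_pos_nat)
  have disj: "Od d \<inter> Od e = {}" if "d dvd M" "e dvd M" "d \<noteq> e" for d e
  proof -
    have "d > 0" "e > 0" using that less.prems by (auto intro: dvd_pos_nat)
    then show ?thesis using that(3) unfolding Od_def by (auto simp: neq_iff)
  qed
  have "M = (\<Sum>d | d dvd M. card (Od d))"
    using card_UN_disjoint[of "{d. d dvd M}" Od] finO disj less.prems union
      card_roots_of_unity_alg_closed[OF less.prems, where 'k='k] by (auto simp: finite_divisors_nat)
  also have "\<dots> = card (Od M) + (\<Sum>d\<in>{d. d dvd M} - {M}. card (Od d))"
    using less.prems by (intro sum.remove) (auto simp: finite_divisors_nat)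
  also have "(\<Sum>d\<in>{d. d dvd M} - {M}. card (Od d)) = (\<Sum>d\<in>{d. d dvd M} - {M}. totient d)"
  proof (intro sum.cong)
    fix d assume "d \<in> {d. d dvd M} - {M}"
    then have "d < M" "d > 0" using less.prems by (auto dest: dvd_imp_le intro: dvd_pos_nat)
    then show "card (Od d) = totient d" using less.IH[of d] unfolding Od_def by simp
  qed simp
  finally have "M = card (Od M) + (\<Sum>d\<in>{d. d dvd M} - {M}. totient d)" .
  moreover have "M = totient M + (\<Sum>d\<in>{d. d dvd M} - {M}. totient d)"
    using sum.remove[of "{d. d dvd M}" M totient] less.prems
    by (simp add: finite_divisors_nat totient_divisor_sum)
  ultimately show ?case unfolding Od_def by linarith
qed

lemma primitive_root_of_unity:
  assumes "M > 0"
  obtains z :: "'k::{alg_closed_field,field_char_0}" where "z ^ M = 1" "\<And>k. 0 < k \<Longrightarrow> k < M \<Longrightarrow> z ^ k \<noteq> 1"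
proof -
  have "card {x :: 'k. x ^ M = 1 \<and> (\<forall>k. 0 < k \<longrightarrow> k < M \<longrightarrow> x ^ k \<noteq> 1)} > 0"
    using assms by (subst exact_order_count) auto
  then have "{x :: 'k. x ^ M = 1 \<and> (\<forall>k. 0 < k \<longrightarrow> k < M \<longrightarrow> x ^ k \<noteq> 1)} \<noteq> {}"
    by (metis card.empty less_irrefl)
  then show ?thesis using that by blast
qed

text \<open>
  The codomain is an arbitrary field of characteristic zero, since the same polynomial is
  evaluated in the base field of \<open>H\<close> and in the complex numbers.
\<close>

definition qev :: "rat poly \<Rightarrow> 'a::field_char_0 \<Rightarrow> 'a" where
  "qev p x = fold_coeffs (\<lambda>a r. of_rat a + x * r) p 0"

lemma qev_0 [simp]: "qev 0 x = 0"
  by (simp add: qev_def)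

lemma qev_pCons [simp]: "qev (pCons a p) x = of_rat a + x * qev p x"
  by (cases "a = 0 \<and> p = 0") (auto simp: qev_def)

lemma qev_add [simp]: "qev (p + q) x = qev p x + qev q x"
proof (induction p arbitrary: q)
  case (pCons a p)
  obtain b r where "q = pCons b r" by (rule pCons_cases)
  then show ?case by (simp add: pCons.IH of_rat_add algebra_simps)
qed simp

lemma qev_smult [simp]: "qev (smult c p) x = of_rat c * qev p x"
  by (induction p) (auto simp: of_rat_mult algebra_simps)

lemma qev_mult [simp]: "qev (p * q) x = qev p x * qev q x"
  by (induction p) (auto simp: algebra_simps)

lemma qev_monom [simp]: "qev (monom c n) x = of_rat c * x ^ n"
  by (induction n) (auto simp: monom_0 monom_Suc algebra_simps)

lemma qev_sum: "qev (\<Sum>i\<in>A. f i) x = (\<Sum>i\<in>A. qev (f i) x)"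
  by (induction A rule: infinite_finite_induct) auto

lemma qev_complex_root:
  assumes "degree p > 0"
  shows "\<exists>w :: complex. qev p w = 0"
proof -
  have eq: "qev p w = poly (map_poly of_rat p) w" for w :: complex
    by (induction p) (auto simp: map_poly_pCons)
  have "degree (map_poly of_rat p :: complex poly) = degree p" by (rule degree_map_poly) auto
  then show ?thesis using alg_closed_imp_poly_has_root[of "map_poly of_rat p :: complex poly"] assms
    by (simp add: eq)
qed

text \<open>
  Take for \<open>w\<close> a complex root of the minimal polynomial of \<open>z\<close> over the rational numbers. So
  \<open>P(z) \<mapsto> P(w)\<close> is a well defined ring map from \<open>Q[z]\<close> to the complex numbers.
\<close>

lemma embed_root_of_unity:
  fixes z :: "'k::field_char_0"
  assumes "M > 0" "z ^ M = 1"
  obtains w :: complex where "w ^ M = 1" "\<And>P. qev P z = 0 \<Longrightarrow> qev P w = 0"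
proof -
  define Q where "Q = (\<lambda>p :: rat poly. p \<noteq> 0 \<and> qev p z = 0)"
  define p0 :: "rat poly" where "p0 = monom 1 M + smult (-1) 1"
  have p00: "qev p0 x = x ^ M - 1" for x :: "'b::field_char_0"
    using qev_monom[of 1 0 x] by (simp add: p0_def monom_0 one_pCons)
  have "p0 \<noteq> 0"
  proof
    assume "p0 = 0"
    then have "coeff p0 M = 0" by simp
    then show False using assms(1) by (cases M) (simp_all add: p0_def)
  qed
  then have "Q p0" using assms p00[of z] by (simp add: Q_def)
  define m where "m = arg_min degree Q"
  have m: "Q m" "\<And>q. Q q \<Longrightarrow> degree m \<le> degree q"
    unfolding m_def using arg_min_nat_lemma[of Q p0 degree] \<open>Q p0\<close> by auto
  have "degree m > 0"
  proof (rule ccontr)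
    assume "\<not> degree m > 0"
    then obtain a where "m = [:a:]" by (auto elim: degree_eq_zeroE)
    then show False using m(1) by (simp add: Q_def)
  qed
  then obtain w :: complex where w: "qev m w = 0" using qev_complex_root by blast
  have all: "qev P w = 0" if P: "qev P z = 0" for P
  proof -
    have "P = m * (P div m) + P mod m" by simp
    then have split: "qev P x = qev m x * qev (P div m) x + qev (P mod m) x" for x :: "'b::field_char_0"
      by (metis qev_add qev_mult)
    then have "qev (P mod m) z = 0" using P m(1) split[of z] by (simp add: Q_def)
    then have "P mod m = 0"
      using m(2)[of "P mod m"] degree_mod_less'[of m P] m(1) \<open>degree m > 0\<close>
      by (auto simp: Q_def not_less[symmetric]) 
    then show ?thesis using split[of w] w by simp
  qed
  have "w ^ M = 1" using all[of p0] assms p00[of z] p00[of w] by simp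
  then show ?thesis using that all by blast
qed

lemma sum_powers_root_of_unity:
  fixes x :: "'a::field"
  assumes "x ^ M = 1" "x \<noteq> 1"
  shows "(\<Sum>i<M. x ^ i) = 0"
proof -
  have "(1 - x) * (\<Sum>i<M. x ^ i) = 1 - x ^ M" by (simp add: one_diff_power_eq)
  then show ?thesis using assms by simp
qed

context semisimple_hopf_algebra
begin

section \<open>The trace of the squared antipode is not zero\<close>

lemma S2_power_finite_order: obtains N where "N > 0" "\<And>x. ((\<lambda>x. S2 x) ^^ (2 * N)) x = x"
proof -
  obtain N where N: "N > 0" "modular ^ N = 1" by (rule modular_finite_order)
  have it: "((\<lambda>x. S2 x) ^^ (2 * j)) x = S modular ^ j * x * modular ^ j" for j x
    by (induction j) (auto simp: S4_eq mult.assoc power_commutes)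
  have "S modular ^ N * modular ^ N = 1" by (rule left_right_inverse_power[OF antipode_modular(1)])
  then have "S modular ^ N = 1" using N(2) by simp
  then show ?thesis using that[OF N(1)] it[of N] N(2) by simp
qed

text \<open>
  The elements \<open>t k\<close> are the powers of an element whose \<open>M\<close>-th power is the unit \<open>t 0\<close>. They are combinations of its spectral idempotents \<open>p i\<close>, whose traces are the dimensions \<open>m i\<close>.
\<close>

lemma fourier_idempotents:
  fixes z :: 'k and t :: "nat \<Rightarrow> 'h"
  assumes M: "M > 0" and z: "z ^ M = 1" "\<And>k. 0 < k \<Longrightarrow> k < M \<Longrightarrow> z ^ k \<noteq> 1"
    and t: "\<And>i j. t (i + j) = t i * t j" "t M = t 0"
  obtains m :: "nat \<Rightarrow> nat" where "\<And>k. k < M \<Longrightarrow> tau (t k) = (\<Sum>i<M. of_nat (m i) * z ^ (i * k))"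
proof -
  define y where "y = inverse z"
  have zy: "z * y = 1" unfolding y_def using z(1) M by (cases "z = 0") (auto simp: power_0_left)
  have y: "y ^ M = 1" unfolding y_def using z(1) by (simp add: power_inverse)
  have Mk: "(of_nat M :: 'k) \<noteq> 0" using M by simp
  define p where "p i = inverse (of_nat M) *s (\<Sum>j<M. y ^ (i * j) *s t j)" for i
  have step: "t 1 * p i = z ^ i *s p i" for i
  proof -
    define f where "f j = y ^ (i * j) *s t j" for j
    \<comment> \<open>The summand is periodic with period \<open>M\<close>.\<close>
    have shift: "(\<Sum>j<M. f (Suc j)) = (\<Sum>j<M. f j)"
    proof -
      have "(\<Sum>j<M. f (Suc j)) + f 0 = (\<Sum>j<Suc M. f j)" by (simp only: sum.lessThan_Suc_shift add.commute)
      also have "\<dots> = (\<Sum>j<M. f j) + f M" by simp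
      also have "f M = f 0" using y by (simp add: f_def t(2) power_mult mult.commute[of i])
      finally show ?thesis by simp
    qed
    have "t 1 * f j = z ^ i *s f (Suc j)" for j
    proof -
      have "z ^ i * y ^ (i * Suc j) = y ^ (i * j)"
        using zy by (simp add: power_add mult.assoc[symmetric] power_mult_distrib[symmetric])
      then show ?thesis using t(1)[of 1 j] by (simp add: f_def scale_mult_right)
    qed
    then have "t 1 * (\<Sum>j<M. f j) = z ^ i *s (\<Sum>j<M. f (Suc j))"
      by (simp add: sum_distrib_left scale_sum_right)
    then show ?thesis unfolding p_def f_def[symmetric] shift
      by (simp add: scale_mult_right scale_left_commute)
  qed
  have t0: "t 0 * p i = p i" for i
    using t(1)[of 0] by (simp add: p_def scale_mult_right sum_distrib_left)
  have tp: "t j * p i = z ^ (i * j) *s p i" for i j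
  proof (induction j)
    case (Suc j)
    have "t (Suc j) * p i = t 1 * (t j * p i)" using t(1)[of 1 j] by (simp add: mult.assoc)
    then show ?case using Suc step by (simp add: scale_mult_right power_add mult.commute)
  qed (simp add: t0)
  have p_mult: "p i * x = inverse (of_nat M) *s (\<Sum>j<M. y ^ (i * j) *s (t j * x))" for i x
    by (simp add: p_def scale_mult_left sum_distrib_right)
  have "p i * p i = p i" for i
  proof -
    have "p i * p i = inverse (of_nat M) *s (\<Sum>j<M. (y ^ (i * j) * z ^ (i * j)) *s p i)"
      by (simp only: p_mult tp scale_scale)
    also have "(\<Sum>j<M. (y ^ (i * j) * z ^ (i * j)) *s p i) = of_nat M *s p i"
      using zy by (simp add: power_mult_distrib[symmetric] mult.commute sum_constant_scale del: sum_constant)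
    finally show ?thesis using Mk by simp
  qed
  then have m: "tau (p i) = of_nat (rank (p i))" for i by (rule tau_idempotent)
  have "t k = (\<Sum>i<M. z ^ (i * k) *s p i)" if k: "k < M" for k
  proof -
    have orth: "(\<Sum>i<M. z ^ (i * k) * y ^ (i * j)) = (if j = k then of_nat M else 0)" if j: "j < M" for j
    proof -
      define x where "x = z ^ k * y ^ j"
      have xi: "z ^ (i * k) * y ^ (i * j) = x ^ i" for i
        by (simp add: x_def power_mult_distrib power_mult[symmetric] mult.commute)
      have xM: "x ^ M = 1"
        using y z(1) by (simp add: x_def power_mult_distrib power_mult[symmetric] mult.commute[of _ M] power_mult)
      show ?thesis
      proof (cases "j = k")
        case True
        then have "x = 1" using zy by (simp add: x_def power_mult_distrib[symmetric])
        then show ?thesis using True xi by simp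
      next
        case False
        have "x \<noteq> 1"
        proof (cases "j < k")
          case True
          have "x = z ^ (k - j) * (z ^ j * y ^ j)" using True by (simp add: x_def mult.assoc[symmetric] power_add[symmetric])
          also have "\<dots> = z ^ (k - j)" using zy by (simp add: power_mult_distrib[symmetric])
          finally show ?thesis using z(2)[of "k - j"] True k by simp
        next
          case F: False
          have "z ^ (j - k) * x = (z ^ j * y ^ j)"
            using F by (simp add: x_def mult.assoc[symmetric] power_add[symmetric])
          also have "\<dots> = 1" using zy by (simp add: power_mult_distrib[symmetric])
          finally show ?thesis using z(2)[of "j - k"] F False j by auto
        qed
        then show ?thesis using sum_powers_root_of_unity[OF xM] False by (simp add: xi)
      qed
    qed
    have "(\<Sum>i<M. z ^ (i * k) *s p i) = inverse (of_nat M) *s (\<Sum>i<M. \<Sum>j<M. (z ^ (i * k) * y ^ (i * j)) *s t j)"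
      by (simp add: p_def scale_sum_right scale_left_commute) (simp add: mult_ac)
    also have "\<dots> = inverse (of_nat M) *s (\<Sum>j<M. (\<Sum>i<M. z ^ (i * k) * y ^ (i * j)) *s t j)"
      by (subst sum.swap) (simp add: scale_sum_left)
    also have "(\<Sum>j<M. (\<Sum>i<M. z ^ (i * k) * y ^ (i * j)) *s t j) = (\<Sum>j<M. if j = k then of_nat M *s t k else 0)"
      by (intro sum.cong) (auto simp: orth)
    also have "\<dots> = of_nat M *s t k" using k by simp
    finally show ?thesis using Mk by simp
  qed
  then have "tau (t k) = (\<Sum>i<M. of_nat (rank (p i)) * z ^ (i * k))" if "k < M" for k
    using that by (simp add: lin_sum[OF lin_tau] lin_scale[OF lin_tau] m mult.commute)
  then show ?thesis by (rule that)
qed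

text \<open>
  Some power of \<open>v\<close> is central, hence a scalar on the block. After division by a root of this
  scalar, \<open>v\<close> has finite order there, and the traces of \<open>v\<close> and \<open>v\<^sup>-\<^sup>1\<close> become sums of roots
  of unity with the same multiplicities.
\<close>

lemma tr_S2_primitive:
  assumes e: "primitive e" and M: "M > 0" "\<And>x. ((\<lambda>x. S2 x) ^^ M) x = x"
    and z: "z ^ M = 1" "\<And>k. 0 < k \<Longrightarrow> k < M \<Longrightarrow> z ^ k \<noteq> (1 :: 'k)"
  obtains m :: "nat \<Rightarrow> nat" where
    "tr (\<lambda>y. e * S2 y) * of_nat (rank e)
      = (\<Sum>i<M. of_nat (m i) * z ^ i) * (\<Sum>i<M. of_nat (m i) * z ^ (i * (M - 1)))"
proof (cases "M = 1")
  \<comment> \<open>Separate because \<open>t 1\<close> is then outside the range \<open>k < M\<close> of the Fourier formula.\<close>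
  case True
  then have S2: "S2 x = x" for x using M(2)[of x] by simp
  have ee: "e * e = e" using e unfolding primitive_def central_idempotent_def by blast
  show ?thesis
    using that[of "\<lambda>_. rank e"] True tau_idempotent[OF ee] by (simp add: S2 tau_def)
next
  case False
  obtain v w where vw: "v * w = 1" "w * v = 1" "\<And>x. S2 x = v * x * w" using S2_inner by blast
  have ee: "e * e = e" "\<And>x. e * x = x * e" "e \<noteq> 0"
    using e unfolding primitive_def central_idempotent_def by blast+
  have it: "((\<lambda>x. S2 x) ^^ j) x = v ^ j * x * w ^ j" for j x
    by (induction j) (auto simp: vw(3) mult.assoc power_commutes)
  have wv: "w ^ j * v ^ j = 1" for j by (rule left_right_inverse_power[OF vw(2)])
  have central: "v ^ M * x = x * v ^ M" for x
  proof -
    have "x * v ^ M = v ^ M * x * w ^ M * v ^ M" using it[of M x] M(2)[of x] by simp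
    then show ?thesis by (simp add: mult.assoc wv)
  qed
  have "(v ^ M * e) * x = x * (v ^ M * e)" for x
    using central[of "e * x"] ee(2)[of x] ee(2)[of "v ^ M"] by (simp add: mult.assoc)
  moreover have "v ^ M * e * e = v ^ M * e" by (simp add: mult.assoc ee(1))
  ultimately obtain c where c: "v ^ M * e = c *s e" by (rule primitive_center[OF e])
  have "c \<noteq> 0"
  proof
    assume "c = 0"
    then have "w ^ M * (v ^ M * e) = 0" using c by simp
    then show False using ee(3) by (simp add: mult.assoc[symmetric] wv)
  qed
  obtain b where b: "b ^ M = c" using nth_root_exists[OF M(1)] by blast
  have b0: "b \<noteq> 0" using b \<open>c \<noteq> 0\<close> M(1) by (auto simp: power_0_left)
  define t where "t j = inverse (b ^ j) *s (v ^ j * e)" for j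
  have vee: "v ^ i * e * (v ^ j * e) = v ^ (i + j) * e" for i j
  proof -
    have "e * (v ^ j * e) = v ^ j * e" using ee(2)[of "v ^ j * e"] by (simp add: mult.assoc ee(1))
    then show ?thesis by (simp add: mult.assoc power_add)
  qed
  have t: "t (i + j) = t i * t j" for i j
    by (simp add: t_def scale_mult_left scale_mult_right vee power_add)
  have tM: "t M = t 0" using b0 by (simp add: t_def b c \<open>c \<noteq> 0\<close>)
  obtain m where m: "\<And>k. k < M \<Longrightarrow> tau (t k) = (\<Sum>i<M. of_nat (m i) * z ^ (i * k))"
    using fourier_idempotents[of M z t, OF M(1) z t tM] by blast
  have e_v: "e * v = b *s t 1" using b0 ee(2)[of v] by (simp add: t_def)
  have e_w: "e * w = inverse b *s t (M - 1)"
  proof -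
    have "w * (c *s e) = v ^ (M - 1) * e"
    proof -
      have "w * (v ^ M * e) = (w * v) * (v ^ (M - 1) * e)"
        using M(1) by (cases M) (simp_all add: mult.assoc)
      then show ?thesis by (simp only: c vw(2) mult_1_left)
    qed
    moreover have "inverse b * inverse (b ^ (M - 1)) = inverse c"
      using b M(1) by (cases M) (auto simp: mult.commute)
    ultimately have "inverse b *s t (M - 1) = inverse c *s (w * (c *s e))"
      by (simp add: t_def)
    then show ?thesis using \<open>c \<noteq> 0\<close> ee(2)[of w] by (simp add: scale_mult_right)
  qed
  have "tr (\<lambda>y. e * S2 y) * tau e = tau (e * v) * tau (e * w)"
    using tr_primitive[OF e, of v w] by (simp add: vw(3))
  also have "\<dots> = tau (t 1) * tau (t (M - 1))"
    using b0 by (simp add: e_v e_w lin_scale[OF lin_tau])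
  also have "\<dots> = (\<Sum>i<M. of_nat (m i) * z ^ i) * (\<Sum>i<M. of_nat (m i) * z ^ (i * (M - 1)))"
    using m[of 1] m[of "M - 1"] False M(1) by simp
  finally show ?thesis using that[of m] tau_idempotent[OF ee(1)] by simp
qed

text \<open>
  The field need not embed into the complex numbers, so positivity is expressed by a rational
  polynomial \<open>P\<close> whose value at \<open>z\<close> is the given trace and whose value at the complex root of
  unity \<open>w\<close> is a nonnegative real. Adding over the blocks, with the value \<open>1\<close> for the block
  of \<open>\<Lambda>\<close>, gives a polynomial that does not vanish at \<open>w\<close>.
\<close>

lemma tr_S2_nonzero: "tr (\<lambda>x. S2 x) \<noteq> 0"
proof
  assume zero: "tr (\<lambda>x. S2 x) = 0"
  obtain N where N: "N > 0" "\<And>x. ((\<lambda>x. S2 x) ^^ (2 * N)) x = x"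
    using S2_power_finite_order by blast
  define M where "M = 2 * N"
  have M: "M > 0" "\<And>x. ((\<lambda>x. S2 x) ^^ M) x = x" using N by (simp_all add: M_def)
  obtain z :: 'k where z: "z ^ M = 1" "\<And>k. 0 < k \<Longrightarrow> k < M \<Longrightarrow> z ^ k \<noteq> 1"
    using primitive_root_of_unity[OF M(1)] by blast
  obtain w :: complex where w: "w ^ M = 1" "\<And>P. qev P z = 0 \<Longrightarrow> qev P w = 0"
    using embed_root_of_unity[OF M(1) z(1)] by blast
  \<comment> \<open>The image of \<open>t\<close> under \<open>P(z) \<mapsto> P(w)\<close> is real and nonnegative.\<close>
  define pos where "pos t = (\<exists>P r. t = qev P z \<and> qev P w = complex_of_real r \<and> r \<ge> 0)" for t
  \<comment> \<open>So the second sum in \<open>tr_S2_primitive\<close> maps to the conjugate of the first.\<close>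
  have wM: "w ^ (M - 1) = cnj w"
  proof -
    have "norm w ^ M = 1" using w(1) by (metis norm_one norm_power)
    then have "norm w = 1" using M(1) power_eq_imp_eq_base[of "norm w" M 1] by simp
    then have "w * cnj w = 1" by (simp add: complex_norm_square[symmetric])
    moreover have "w * w ^ (M - 1) = 1" using w(1) M(1) by (cases M) auto
    moreover have "w \<noteq> 0" using \<open>norm w = 1\<close> by auto
    ultimately show ?thesis by (metis mult_left_cancel)
  qed
  have prim: "pos (tr (\<lambda>y. e * S2 y))" if e: "primitive e" for e
  proof -
    obtain m :: "nat \<Rightarrow> nat" where m: "tr (\<lambda>y. e * S2 y) * of_nat (rank e)
        = (\<Sum>i<M. of_nat (m i) * z ^ i) * (\<Sum>i<M. of_nat (m i) * z ^ (i * (M - 1)))"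
      using tr_S2_primitive[OF e M z] by blast
    have "rank e \<noteq> 0" using e by (simp add: primitive_def rank_eq_0)
    define A :: "rat poly" where "A = (\<Sum>i<M. monom (of_nat (m i)) i)"
    define B :: "rat poly" where "B = (\<Sum>i<M. monom (of_nat (m i)) (i * (M - 1)))"
    define P where "P = smult (inverse (of_nat (rank e))) (A * B)"
    have P: "qev P x = inverse (of_nat (rank e)) * ((\<Sum>i<M. of_nat (m i) * x ^ i)
        * (\<Sum>i<M. of_nat (m i) * x ^ (i * (M - 1))))" for x :: "'c::field_char_0"
      by (simp add: P_def A_def B_def qev_sum of_rat_inverse)
    have "tr (\<lambda>y. e * S2 y) = qev P z"
      unfolding P m[symmetric] using \<open>rank e \<noteq> 0\<close> by simp
    moreover have "qev P w = complex_of_real ((norm (\<Sum>i<M. of_nat (m i) * w ^ i))\<^sup>2 / real (rank e))"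
    proof -
      have "w ^ (i * (M - 1)) = cnj w ^ i" for i
        by (metis wM mult.commute power_mult)
      then have "(\<Sum>i<M. of_nat (m i) * w ^ (i * (M - 1))) = cnj (\<Sum>i<M. of_nat (m i) * w ^ i)"
        by simp
      then show ?thesis
        unfolding P by (simp add: complex_norm_square[symmetric] divide_inverse mult.commute del: cnj_sum)
    qed
    ultimately show ?thesis unfolding pos_def by (metis divide_nonneg_nonneg of_nat_0_le_iff zero_le_power2)
  qed
  have all: "pos (tr (\<lambda>y. e * S2 y))" if "central_idempotent e" for e
    using that
  proof (induction rule: central_idempotent_induct)
    case zero
    have "tr (\<lambda>y. 0 * S2 y) = 0" using tr_scale[of 0 "\<lambda>y. y"] by simp
    then show ?case unfolding pos_def by (intro exI[of _ 0]) (auto intro!: exI[of _ "0::real"])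
  next
    case (primitive e)
    then show ?case by (rule prim)
  next
    case (add e f)
    obtain P r where P: "tr (\<lambda>y. e * S2 y) = qev P z" "qev P w = complex_of_real r" "r \<ge> 0"
      using add unfolding pos_def by blast
    obtain Q s where Q: "tr (\<lambda>y. f * S2 y) = qev Q z" "qev Q w = complex_of_real s" "s \<ge> 0"
      using add unfolding pos_def by blast
    have "tr (\<lambda>y. (e + f) * S2 y) = qev (P + Q) z"
      by (simp add: distrib_right tr_add P Q)
    moreover have "qev (P + Q) w = complex_of_real (r + s)" by (simp add: P Q)
    ultimately show ?case unfolding pos_def using P(3) Q(3) by (metis add_nonneg_nonneg)
  qed
  have "central_idempotent (1 - Lam)"
    unfolding central_idempotent_def by (simp add: left_diff_distrib right_diff_distrib Lam_left Lam_right counit_Lam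
        lin_diff[OF lin_counit] counit_one)
  then obtain P r where P: "tr (\<lambda>y. (1 - Lam) * S2 y) = qev P z" "qev P w = complex_of_real r" "r \<ge> 0"
    using all unfolding pos_def by blast
  have "tr (\<lambda>y. (1 - Lam) * S2 y) = tr (\<lambda>x. S2 x) - lam Lam"
    by (simp add: left_diff_distrib tr_diff lam_def)
  then have "qev (P + [:1:]) z = 0" using P zero lam_Lam by simp
  then have "qev (P + [:1:]) w = 0" by (rule w(2))
  then have "complex_of_real (r + 1) = 0" using P by simp
  then show False using P(3) by (simp only: of_real_eq_0_iff)
qed

text \<open>
  Evaluate \<open>lam_right\<close> at \<open>1\<close>, where \<open>lam 1 = Tr(S\<^sup>2)\<close>.
\<close>

lemma modular_eq_one: "modular = 1"
proof -
  have "sw 1 (\<lambda>a b. lam a *s b) = lam 1 *s modular" by (rule lam_right)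
  moreover have "sw 1 (\<lambda>a b. lam a *s b) = lam 1 *s 1"
    by (subst sw_one_H) (simp_all add: lin_lam)
  ultimately have "lam 1 *s modular = lam 1 *s 1" by simp
  moreover have "lam 1 \<noteq> 0" using tr_S2_nonzero by (simp add: lam_def)
  ultimately show ?thesis by simp
qed

lemma S4_id: "S2 (S2 x) = x"
  by (simp add: S4_eq modular_eq_one)

section \<open>The antipode is an involution\<close>

lemma tr_id: "tr (\<lambda>x. x) = of_nat (dim UNIV)"
  using tr_idempotent[of "\<lambda>x. x"] by simp

text \<open>
  With \<open>h\<close> acting as \<open>h\<^sub>2 \<otimes> h\<^sub>1\<close>, the module \<open>H \<otimes> H\<close> is free of rank \<open>dim H\<close>, by the map \<open>a \<otimes> b \<mapsto> \<Sum> S(b\<^sub>2) a \<otimes> b\<^sub>1\<close>. On traces this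
  is again cyclicity for two families of maps \<open>A\<close> and \<open>B\<close>.
\<close>

lemma tau_convolution: "sw h (\<lambda>a b. tau a * tau b) = of_nat (dim UNIV) * tau h"
proof -
  define A where "A i j y = sw y (\<lambda>u q. coord j (S q * i) *s u)" for i j y
  define B where "B i j x = sw (h * x) (\<lambda>c d. coord i (d * j) *s c)" for i j x
  have linA: "lin scale (A i j)" for i j unfolding A_def[abs_def] by simp
  have linB: "lin scale (B i j)" for i j unfolding B_def[abs_def] by simp
  have expand: "(\<Sum>j\<in>bas. coord j x * f j) = f x" if "lin (*) f" for f x
    using lin_expand[OF that, of x] by simp
  have BA: "(\<Sum>i\<in>bas. \<Sum>j\<in>bas. B i j (A i j y)) = sw h (\<lambda>a b. tau b *s (a * y))" for y
  proof -
    have "(\<Sum>j\<in>bas. B i j (A i j y)) = sw h (\<lambda>a b. coord i (b * i) *s (a * y))" for i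
    proof -
      have "(\<Sum>j\<in>bas. B i j (A i j y)) =
        sw y (\<lambda>u q. sw (h * u) (\<lambda>c d. (\<Sum>j\<in>bas. coord j (S q * i) * coord i (d * j)) *s c))"
        by (simp add: A_def lin_sw[OF linB] lin_scale[OF linB] sw_sum[symmetric])
          (simp add: B_def scale_sw scale_sum_left sw_sum)
      also have "\<dots> = sw y (\<lambda>u q. sw (h * u) (\<lambda>c d. coord i (d * (S q * i)) *s c))"
        by (simp add: expand)
      also have "\<dots> = sw y (\<lambda>u q. sw u (\<lambda>c d. sw h (\<lambda>a b. coord i (b * (d * S q) * i) *s (a * c))))"
        by (rule sw_cong, subst sw_mult[where s=scale], simp, subst sw_swap) (simp add: mult.assoc)
      also have "\<dots> = sw y (\<lambda>c z. sw z (\<lambda>d q. sw h (\<lambda>a b. coord i (b * (d * S q) * i) *s (a * c))))"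
        by (rule sw_assoc[where s=scale]) simp
      also have "\<dots> = sw h (\<lambda>a b. coord i (b * i) *s (a * y))"
        by (subst sw_cancel(4)[where s=scale and F="\<lambda>c z. sw h (\<lambda>a b. coord i (b * z * i) *s (a * c))"]) simp_all
      finally show ?thesis .
    qed
    then have "(\<Sum>i\<in>bas. \<Sum>j\<in>bas. B i j (A i j y)) = (\<Sum>i\<in>bas. sw h (\<lambda>a b. coord i (b * i) *s (a * y)))"
      by simp
    also have "\<dots> = sw h (\<lambda>a b. tau b *s (a * y))"
      by (simp add: sw_sum[symmetric] tau_def tr_def scale_sum_left)
    finally show ?thesis .
  qed
  have AB: "(\<Sum>i\<in>bas. \<Sum>j\<in>bas. A i j (B i j x)) = of_nat (dim UNIV) *s (h * x)" for x
  proof -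
    have "(\<Sum>i\<in>bas. A i j (B i j x)) = coord j j *s (h * x)" for j
    proof -
      have "(\<Sum>i\<in>bas. A i j (B i j x)) =
        sw (h * x) (\<lambda>c d. sw c (\<lambda>u q. (\<Sum>i\<in>bas. coord i (d * j) * coord j (S q * i)) *s u))"
        by (simp add: B_def lin_sw[OF linA] lin_scale[OF linA] sw_sum[symmetric])
          (simp add: A_def scale_sw scale_sum_left sw_sum)
      also have "\<dots> = sw (h * x) (\<lambda>c d. sw c (\<lambda>u q. coord j (S q * d * j) *s u))"
        by (simp add: expand mult.assoc)
      also have "\<dots> = sw (h * x) (\<lambda>u z. sw z (\<lambda>q d. coord j (S q * d * j) *s u))"
        by (rule sw_assoc[where s=scale]) simp
      also have "\<dots> = coord j j *s (h * x)"
        by (subst sw_cancel(3)[where s=scale and F="\<lambda>u z. coord j (z * j) *s u"]) simp_all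
      finally show ?thesis .
    qed
    then have "(\<Sum>i\<in>bas. \<Sum>j\<in>bas. A i j (B i j x)) = (\<Sum>j\<in>bas. coord j j *s (h * x))"
      by (subst sum.swap) simp
    also have "\<dots> = tr (\<lambda>x. x) *s (h * x)" by (simp add: tr_def scale_sum_left)
    finally show ?thesis by (simp add: tr_id)
  qed
  have "sw h (\<lambda>a b. tau a * tau b) = tr (\<lambda>y. sw h (\<lambda>a b. tau b *s (a * y)))"
    by (simp add: tr_sw tr_scale mult.commute tau_def[symmetric])
  also have "\<dots> = (\<Sum>i\<in>bas. \<Sum>j\<in>bas. tr (\<lambda>y. B i j (A i j y)))"
    by (simp add: BA[symmetric] tr_sum)
  also have "\<dots> = (\<Sum>i\<in>bas. \<Sum>j\<in>bas. tr (\<lambda>y. A i j (B i j y)))"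
    by (rule sum.cong[OF HOL.refl], rule sum.cong[OF HOL.refl], rule tr_commute[OF linB linA])
  also have "\<dots> = of_nat (dim UNIV) * tau h"
    by (simp add: tr_sum[symmetric] AB tr_scale tau_def)
  finally show ?thesis .
qed

lemma tau_Lam: "tau Lam = 1"
proof -
  have "tau Lam = tr (\<lambda>y. counit y *s Lam)" by (simp add: tau_def Lam_right)
  then show ?thesis by (simp add: tr_rank_one lin_counit counit_Lam)
qed

lemma tau_S2: "tau (S2 x) = tau x"
proof -
  obtain v w where vw: "v * w = 1" "w * v = 1" "\<And>x. S2 x = v * x * w" using S2_inner by blast
  have "tau (S2 x) = tau (w * (v * x))" using tau_commute[of "v * x" w] by (simp add: vw(3))
  then show ?thesis by (simp add: mult.assoc[symmetric] vw)
qed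

definition tau_hit :: "'h \<Rightarrow> 'h" where "tau_hit h = sw h (\<lambda>a b. tau a *s b)"

lemma lin_tau_hit [simp]: "lin scale tau_hit"
  unfolding tau_hit_def[abs_def] by (simp add: lin_tau)

lemma tau_hit_idem: "tau_hit (tau_hit h) = of_nat (dim UNIV) *s tau_hit h"
proof -
  have "tau_hit (tau_hit h) = sw h (\<lambda>a b. sw b (\<lambda>c d. (tau a * tau c) *s d))"
    by (subst (2) tau_hit_def) (simp add: lin_sw[OF lin_tau_hit] lin_scale[OF lin_tau_hit],
      simp add: tau_hit_def scale_sw)
  also have "\<dots> = sw h (\<lambda>u d. sw u (\<lambda>a c. (tau a * tau c) *s d))"
    by (rule sw_assoc[where s=scale, symmetric]) (simp add: lin_tau)
  also have "\<dots> = of_nat (dim UNIV) *s tau_hit h"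
    by (simp add: sw_scale_vec[symmetric] tau_convolution tau_hit_def scale_sw)
  finally show ?thesis .
qed

lemma tau_hit_S2: "tau_hit (S2 h) = S2 (tau_hit h)"
proof -
  have "tau_hit (S2 h) = sw h (\<lambda>a b. tau (S2 a) *s S2 b)"
    unfolding tau_hit_def by (subst sw_S2[where s=scale]) (simp_all add: lin_tau)
  also have "\<dots> = S2 (tau_hit h)"
    by (simp add: tau_hit_def tau_S2 lin_sw[OF lin_antipode] lin_scale[OF lin_antipode])
  finally show ?thesis .
qed

text \<open>
  In the trace formula the last two antipodes cancel, and what is left is \<open>tau(\<Lambda>) mu(1)\<close>.
\<close>

lemma tr_S2_tau_hit: "tr (\<lambda>x. S2 (tau_hit x)) = tr (\<lambda>x. S2 x)"
proof -
  have "tr (\<lambda>x. S2 (tau_hit x)) = sw Lam (\<lambda>p q. mu (S q * S2 (tau_hit p)))"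
    by (rule tr_formula) (simp add: lin_compose[OF lin_tau_hit])
  also have "\<dots> = sw Lam (\<lambda>p q. sw p (\<lambda>a b. tau a * mu (S (S b * q))))"
    by (simp add: tau_hit_def lin_sw[OF lin_antipode] lin_scale[OF lin_antipode] mult_sw
       scale_mult_right lin_sw[OF lin_mu] lin_scale[OF lin_mu] antipode_mult)
  also have "\<dots> = sw Lam (\<lambda>a z. sw z (\<lambda>b q. tau a * mu (S (S b * q))))"
    by (rule sw_assoc[where s="(*)"]) (simp add: lin_tau)
  also have "\<dots> = tau Lam * mu (S 1)"
    by (rule sw_cancel(3)[where s="(*)" and F="\<lambda>a z. tau a * mu (S z)"]) (simp add: lin_tau)
  finally show ?thesis by (simp add: tau_Lam mu_def)
qed

text \<open>
  Let \<open>n = dim H\<close>. The operators \<open>Q = (1 + S\<^sup>2)/2\<close> and \<open>E = tau_hit/n\<close> are commuting projections, so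
  \<open>Tr(S\<^sup>2) = 2r - n\<close> with \<open>r\<close> the rank of \<open>Q\<close>, and \<open>Tr(S\<^sup>2) = n m\<close> with an integer \<open>m\<close>. Since
  \<open>0 < r \<le> n\<close> and the trace is not zero, \<open>m = 1\<close> and \<open>r = n\<close>.
\<close>

theorem antipode_involutive: "S (S x) = x"
proof -
  define n where "n = dim (UNIV :: 'h set)"
  have n0: "(of_nat n :: 'k) \<noteq> 0"
  proof
    assume "(of_nat n :: 'k) = 0"
    then have "rank 1 = 0" by (simp add: rank_def n_def)
    then show False by (simp add: rank_eq_0)
  qed
  define Q where "Q x = (1/2) *s (x + S2 x)" for x
  define E where "E x = (1 / of_nat n) *s tau_hit x" for x
  have linQ: "lin scale Q" unfolding Q_def[abs_def] by simp
  have linE: "lin scale E" unfolding E_def[abs_def] by simp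
  have half: "(1/2) *s x + (1/2) *s x = x" for x
    by (simp add: scale_left_distrib[symmetric])
  have QQ: "Q (Q x) = Q x" for x
  proof -
    have "S2 (Q x) = Q x"
      by (simp add: Q_def lin_scale[OF lin_antipode] lin_add[OF lin_antipode] S4_id add.commute)
    then have "Q (Q x) = (1/2) *s (Q x + Q x)" by (subst Q_def) simp
    then show ?thesis by (simp add: scale_right_distrib half)
  qed
  have EE: "E (E x) = E x" for x
    using n0 by (simp add: E_def lin_scale[OF lin_tau_hit] tau_hit_idem n_def)
  have ES: "E (S2 x) = S2 (E x)" for x
    by (simp add: E_def tau_hit_S2 lin_scale[OF lin_antipode])
  have EQ: "E (Q x) = Q (E x)" for x
    by (subst Q_def, subst Q_def) (simp add: lin_scale[OF linE] lin_add[OF linE] ES)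
  have trQ: "tr Q = of_nat (dim (range Q))" by (rule tr_idempotent[OF linQ QQ])
  have trE: "tr E = of_nat (dim (range E))" by (rule tr_idempotent[OF linE EE])
  have trQE: "tr (\<lambda>x. Q (E x)) = of_nat (dim (range (\<lambda>x. Q (E x))))"
    by (rule tr_idempotent) (simp_all add: lin_compose[OF linQ linE] EQ QQ EE)
  have S2Q: "S2 x = 2 *s Q x - x" for x
    by (simp add: Q_def)
  have t1: "tr (\<lambda>x. S2 x) = 2 * of_nat (dim (range Q)) - of_nat n"
    by (subst S2Q) (simp add: tr_diff tr_scale trQ tr_id n_def)
  have t2: "tr (\<lambda>x. S2 (E x)) = 2 * of_nat (dim (range (\<lambda>x. Q (E x)))) - of_nat (dim (range E))"
    by (subst S2Q) (simp add: tr_diff tr_scale trQE trE)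
  have "tr (\<lambda>x. S2 (E x)) = (1 / of_nat n) * tr (\<lambda>x. S2 (tau_hit x))"
    by (simp add: E_def lin_scale[OF lin_antipode] tr_scale)
  then have t3: "tr (\<lambda>x. S2 x) = of_nat n * tr (\<lambda>x. S2 (E x))"
    using n0 by (simp add: tr_S2_tau_hit)
  define r m where "r = dim (range Q)" and "m = 2 * int (dim (range (\<lambda>x. Q (E x)))) - int (dim (range E))"
  have "(of_int (2 * int r - int n) :: 'k) = of_int (int n * m)"
    using t1 t2 t3 by (simp add: r_def m_def)
  then have eq: "2 * int r - int n = int n * m" by (simp only: of_int_eq_iff)
  have ne: "2 * int r - int n \<noteq> 0"
  proof
    assume "2 * int r - int n = 0"
    then have "(of_int (2 * int r - int n) :: 'k) = 0" by simp
    then show False using t1 tr_S2_nonzero by (simp add: r_def)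
  qed
  have "r \<le> n" unfolding r_def n_def using fd.dim_subset_UNIV[of "range Q"] by (simp add: fd.dimension_def)
  have "r \<noteq> 0"
  proof
    assume "r = 0"
    then have "range Q \<subseteq> {0}" unfolding r_def using fd.dim_eq_0 by simp
    then have "Q 1 = 0" by blast
    moreover have "Q 1 = 1" unfolding Q_def antipode_one scale_right_distrib by (rule half)
    ultimately show False by simp
  qed
  have "int n * (m + 1) = 2 * int r" using eq by (simp add: algebra_simps)
  moreover have "m + 1 > 0"
    using calculation \<open>r \<noteq> 0\<close> by (metis mult_nonneg_nonpos not_less of_nat_0_less_iff of_nat_0_le_iff neq0_conv linorder_not_le mult_pos_pos zero_less_numeral)
  moreover have "m + 1 \<le> 2"
  proof (rule ccontr)
    assume "\<not> m + 1 \<le> 2"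
    then have "int n * (m + 1) \<ge> int n * 3" by (intro mult_left_mono) auto
    then show False using calculation \<open>r \<le> n\<close> \<open>r \<noteq> 0\<close> by auto
  qed
  ultimately have "m + 1 = 1 \<or> m + 1 = 2" by auto
  then have "r = n" using eq ne by auto
  have "range Q = UNIV"
  proof (rule fd.subspace_dim_equal)
    show "subspace (range Q)"
      by (rule subspace_image[OF linQ subspace_UNIV])
  qed (use \<open>r = n\<close> in \<open>auto simp: r_def n_def\<close>)
  then obtain y where "x = Q y" by blast
  then have "Q x = x" by (simp add: QQ)
  then show ?thesis using S2Q[of x] half[of x] by (simp add: scale_left_distrib[of 1 1, simplified])
qed

end

context hopf_algebra
begin

section \<open>Left coideals\<close>

lemma tensor_eq_singleton_zero: "tensor_eq scale [(a, 0)] []"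
proof -
  have "tensor_eq scale [(0 *s a, 0)] [(a, 0 *s 0)]" by (rule tensor_eq.scale)
  then have "tensor_eq scale [(a, 0)] [(0, 0)]" by (simp add: tensor_eq.sym)
  then show ?thesis using tensor_eq.zero tensor_eq.trans by blast
qed

lemma tensor_eq_map_zero: "tensor_eq scale (map (\<lambda>b. (b, 0)) bs) []"
proof (induction bs)
  case (Cons b bs)
  then show ?case using tensor_eq.append[OF tensor_eq_singleton_zero Cons.IH] by simp
qed (simp add: tensor_eq.refl)

lemma tensor_eq_map_add:
  "tensor_eq scale (map (\<lambda>b. (b, f b)) bs @ map (\<lambda>b. (b, h b)) bs) (map (\<lambda>b. (b, f b + h b)) bs)"
proof (induction bs)
  case (Cons b bs)
  let ?F = "map (\<lambda>b. (b, f b)) bs" and ?G = "map (\<lambda>b. (b, h b)) bs"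
  have "tensor_eq scale ((b, f b) # ?F @ (b, h b) # ?G) ([(b, f b)] @ ([(b, h b)] @ ?F) @ ?G)"
    using tensor_eq.append[OF tensor_eq.refl[of scale "[(b, f b)]"]
        tensor_eq.append[OF tensor_eq.comm[of scale ?F "[(b, h b)]"] tensor_eq.refl[of scale ?G]]]
    by simp
  moreover have "tensor_eq scale ([(b, f b), (b, h b)] @ (?F @ ?G)) ([(b, f b + h b)] @ map (\<lambda>b. (b, f b + h b)) bs)"
    by (rule tensor_eq.append[OF tensor_eq.sym[OF tensor_eq.add_right] Cons.IH])
  ultimately show ?case using tensor_eq.trans by fastforce
qed (simp add: tensor_eq.refl)

lemma tensor_eq_expand_left:
  "tensor_eq scale [((\<Sum>b\<leftarrow>bs. c b *s b), y)] (map (\<lambda>b. (b, c b *s y)) bs)"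
proof (induction bs)
  case (Cons b bs)
  have "tensor_eq scale [(c b *s b + (\<Sum>b\<leftarrow>bs. c b *s b), y)] ([(c b *s b, y)] @ [((\<Sum>b\<leftarrow>bs. c b *s b), y)])"
    using tensor_eq.add_left by simp
  moreover have "tensor_eq scale \<dots> ([(b, c b *s y)] @ map (\<lambda>b. (b, c b *s y)) bs)"
    by (rule tensor_eq.append[OF tensor_eq.scale Cons.IH])
  ultimately show ?case using tensor_eq.trans by fastforce
qed (simp add: tensor_eq.zero)

text \<open>
  Every tensor has a normal form in which the left factors run through the basis.
\<close>

lemma tensor_eq_basis_expansion:
  assumes bs: "distinct bs" "set bs = bas"
  shows "tensor_eq scale xs (map (\<lambda>c. (c, \<Sum>(a, b)\<leftarrow>xs. coord c a *s b)) bs)"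
proof (induction xs)
  case Nil
  show ?case using tensor_eq.sym[OF tensor_eq_map_zero[of bs]] by simp
next
  case (Cons x xs)
  obtain a b where x: "x = (a, b)" by (cases x)
  have "a = (\<Sum>c\<leftarrow>bs. coord c a *s c)"
    using coord_expand[of a] bs by (simp add: sum_list_distinct_conv_sum_set)
  then have "tensor_eq scale [x] (map (\<lambda>c. (c, coord c a *s b)) bs)"
    using tensor_eq_expand_left[where c="\<lambda>c. coord c a" and bs=bs and y=b] x by simp
  from tensor_eq.trans[OF tensor_eq.append[OF this Cons.IH] tensor_eq_map_add]
  show ?case by (simp add: x)
qed

lemma right_hit_sw: "right_hit x p = sw x (\<lambda>a b. p a *s b)"
  by (simp add: right_hit_def sw_def)

lemma lin_right_hit: "lin (*) p \<Longrightarrow> lin scale (\<lambda>x. right_hit x p)"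
  unfolding right_hit_sw by simp

text \<open>
  In the normal form above, the right factors of \<open>\<Delta>(x)\<close> come from \<open>x\<close> by the action of the coordinate
  functionals. This criterion avoids representatives of tensors altogether.
\<close>

lemma left_coideal_iff:
  "left_coideal N \<longleftrightarrow> subspace N \<and> (\<forall>x\<in>N. \<forall>p. lin (*) p \<longrightarrow> right_hit x p \<in> N)"
proof (intro iffI conjI ballI allI impI)
  assume N: "left_coideal N"
  then show sub: "subspace N" by (simp add: left_coideal_def)
  fix x and p :: "'h \<Rightarrow> 'k" assume x: "x \<in> N" and p: "lin (*) p"
  obtain ys where ys: "tensor_eq scale (comult x) ys" "snd ` set ys \<subseteq> N"
    using N x unfolding left_coideal_def by blast
  have "right_hit x p = (\<Sum>(a, b)\<leftarrow>ys. p a *s b)"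
    unfolding right_hit_def by (rule tensor_eq_sum_list[OF ys(1), of scale]) (use p in simp)
  moreover have "(\<Sum>(a, b)\<leftarrow>ys. p a *s b) \<in> N"
    using ys(2) by (induction ys) (auto intro!: subspace_0[OF sub] subspace_add[OF sub] subspace_scale[OF sub])
  ultimately show "right_hit x p \<in> N" by simp
next
  assume N: "subspace N \<and> (\<forall>x\<in>N. \<forall>p. lin (*) p \<longrightarrow> right_hit x p \<in> N)"
  obtain bs where bs: "distinct bs" "set bs = bas" using finite_distinct_list[OF bas(1)] by blast
  have "tensor_eq scale (comult x) (map (\<lambda>c. (c, right_hit x (coord c))) bs)" for x
    using tensor_eq_basis_expansion[OF bs] by (simp add: right_hit_def)
  moreover have "snd ` set (map (\<lambda>c. (c, right_hit x (coord c))) bs) \<subseteq> N" if "x \<in> N" for x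
    using N that by auto
  ultimately show "left_coideal N" unfolding left_coideal_def using N by blast
qed

lemma subspace_sw: "subspace N \<Longrightarrow> (\<And>a b. F a b \<in> N) \<Longrightarrow> sw x F \<in> N"
proof -
  assume N: "subspace N" and F: "\<And>a b. F a b \<in> N"
  have "(\<Sum>(a, b)\<leftarrow>xs. F a b) \<in> N" for xs
    by (induction xs) (auto intro: subspace_0[OF N] subspace_add[OF N] F)
  then show ?thesis by (simp add: sw_def)
qed

lemma right_hit_right_hit:
  assumes "lin (*) p" "lin (*) q"
  shows "right_hit (right_hit x p) q = right_hit x (\<lambda>u. sw u (\<lambda>a b. p a * q b))"
proof -
  note [simp] = lin_compose[OF assms(1)] lin_compose[OF assms(2)] assms
  have "right_hit (right_hit x p) q = sw x (\<lambda>a b. sw b (\<lambda>c d. (p a * q c) *s d))"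
    by (simp only: right_hit_sw[of x p] lin_sw[OF lin_right_hit[OF assms(2)]]
        lin_scale[OF lin_right_hit[OF assms(2)]]) (simp add: right_hit_sw scale_sw)
  also have "\<dots> = sw x (\<lambda>u d. sw u (\<lambda>a c. (p a * q c) *s d))"
    by (rule sw_assoc[where s=scale, symmetric]) simp
  finally show ?thesis by (simp add: right_hit_sw sw_scale_vec)
qed

lemma right_hit_counit: "right_hit x counit = x"
  by (simp add: right_hit_sw sw_counit_left_H[of "\<lambda>x. x"])

lemma right_hit_mult:
  assumes "lin (*) p"
  shows "right_hit (x * y) p = (\<Sum>c\<in>bas. right_hit x (coord c) * right_hit y (\<lambda>u. p (c * u)))"
proof -
  note [simp] = lin_compose[OF assms]
  have e: "p (a * u) = (\<Sum>c\<in>bas. coord c a * p (c * u))" for a u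
    using lin_expand[of "(*)" "\<lambda>a. p (a * u)" a] by simp
  have "right_hit (x * y) p = sw x (\<lambda>a b. sw y (\<lambda>u v. p (a * u) *s (b * v)))"
    by (simp add: right_hit_sw sw_mult[where s=scale])
  also have "\<dots> = sw x (\<lambda>a b. sw y (\<lambda>u v. \<Sum>c\<in>bas. (coord c a * p (c * u)) *s (b * v)))"
    by (rule sw_cong, rule sw_cong, subst e, rule scale_sum_left)
  also have "\<dots> = (\<Sum>c\<in>bas. sw x (\<lambda>a b. sw y (\<lambda>u v. (coord c a * p (c * u)) *s (b * v))))"
    by (simp add: sw_sum)
  also have "\<dots> = (\<Sum>c\<in>bas. right_hit x (coord c) * right_hit y (\<lambda>u. p (c * u)))"
    by (simp only: right_hit_sw sw_times) (simp add: mult_sw scale_mult_left scale_mult_right mult.commute[of "coord _ _"])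
  finally show ?thesis .
qed

lemma counit_right_hit: "lin (*) p \<Longrightarrow> counit (right_hit x p) = p x"
  by (simp add: right_hit_sw lin_sw[OF lin_counit] lin_scale[OF lin_counit])
    (simp add: mult.commute[of _ "counit _"] sw_counit_right_K)

section \<open>The adjoint action\<close>

definition ad :: "'h \<Rightarrow> 'h \<Rightarrow> 'h" where "ad h x = sw h (\<lambda>a b. a * x * S b)"

lemma lin_ad [simp]: "lin scale (ad h)"
  unfolding ad_def[abs_def] by simp

lemma normal_ad: "normal N \<longleftrightarrow> (\<forall>h. \<forall>x\<in>N. ad h x \<in> N)"
  by (simp add: normal_def ad_def sw_def)

lemma ad_one: "ad h 1 = counit h *s 1"
  by (simp add: ad_def antipode_right_sw)

lemma counit_ad: "counit (ad h x) = counit h * counit x"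
proof -
  have "counit (ad h x) = sw h (\<lambda>a b. counit b * (counit a * counit x))"
    by (simp add: ad_def lin_sw[OF lin_counit] counit_mult mult_ac)
  also have "\<dots> = counit h * counit x" by (rule sw_counit_right_K) (simp add: lin_counit)
  finally show ?thesis .
qed

lemma ad_mult: "ad h (x * y) = sw h (\<lambda>a b. ad a x * ad b y)"
proof -
  have "sw h (\<lambda>a b. ad a x * ad b y)
    = sw h (\<lambda>u v. sw u (\<lambda>a b. sw v (\<lambda>c d. a * x * (S b * c) * y * S d)))"
    by (simp add: ad_def sw_times mult_sw mult.assoc) (rule sw_cong, rule sw_swap)
  also have "\<dots> = sw h (\<lambda>a w. sw w (\<lambda>b v. sw v (\<lambda>c d. a * x * (S b * c) * y * S d)))"
    by (rule sw_assoc[where s=scale]) simp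
  also have "\<dots> = sw h (\<lambda>a w. a * x * 1 * y * S w)"
    by (rule sw_cong, rule sw_cancel(1)[where s=scale and F="\<lambda>z d. _ * x * z * y * S d"]) simp
  finally show ?thesis by (simp add: ad_def mult.assoc)
qed

lemma mult_eq_ad: "h * x = sw h (\<lambda>a b. ad a x * b)"
proof -
  have "sw h (\<lambda>a b. ad a x * b) = sw h (\<lambda>u c. sw u (\<lambda>a b. a * x * (S b * c)))"
    by (simp add: ad_def sw_times mult.assoc)
  also have "\<dots> = sw h (\<lambda>a w. sw w (\<lambda>b c. a * x * (S b * c)))"
    by (rule sw_assoc[where s=scale]) simp
  also have "\<dots> = h * x * 1"
    by (rule sw_cancel(3)[where s=scale and F="\<lambda>a z. a * x * z"]) simp
  finally show ?thesis by simp
qed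

text \<open>
  The sum \<open>\<Sum> S(h\<^sub>1) h\<^sub>2 z\<^sub>1 \<otimes> h\<^sub>3 z\<^sub>2 S(h\<^sub>4)\<close> is also \<open>\<Sum> S(h\<^sub>1) z\<^sub>1 h\<^sub>2 \<otimes> z\<^sub>2 h\<^sub>3 S(h\<^sub>4)\<close>, because \<open>\<Delta>(hz) = \<Delta>(zh)\<close>.
  On one side the first pair of factors cancels, on the other side the last one.
\<close>

lemma ad_right_hit_central:
  assumes z: "\<And>h. h * z = z * h" and p: "lin (*) p"
  shows "ad h (right_hit z p) = right_hit z (\<lambda>u. sw h (\<lambda>a b. p (S a * u * b)))"
proof -
  note [simp] = lin_compose[OF p]
  define E where "E = sw h (\<lambda>a y. sw y (\<lambda>m d. sw (m * z) (\<lambda>u w. p (S a * u) *s (w * S d))))"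
  have "E = sw h (\<lambda>a y. sw y (\<lambda>m d. sw m (\<lambda>b c. sw z (\<lambda>u w. p (S a * b * u) *s (c * w * S d)))))"
    by (simp add: E_def sw_mult[where s=scale] mult.assoc)
  also have "\<dots> = sw h (\<lambda>a y. sw y (\<lambda>b y'. sw y' (\<lambda>c d. sw z (\<lambda>u w. p (S a * b * u) *s (c * w * S d)))))"
    by (rule sw_cong, rule sw_assoc[where s=scale]) simp
  also have "\<dots> = sw h (\<lambda>c d. sw z (\<lambda>u w. p (1 * u) *s (c * w * S d)))"
    by (rule sw_cancel(1)[where s=scale and F="\<lambda>x y'. sw y' (\<lambda>c d. sw z (\<lambda>u w. p (x * u) *s (c * w * S d)))"]) simp
  also have "\<dots> = ad h (right_hit z p)"
    by (simp add: ad_def right_hit_sw mult_sw sw_times scale_mult_left scale_mult_right mult.assoc)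
  finally have 1: "E = ad h (right_hit z p)" .
  have "E = sw h (\<lambda>a y. sw y (\<lambda>m d. sw m (\<lambda>b c. sw z (\<lambda>u w. p (S a * u * b) *s (w * (c * S d))))))"
    unfolding E_def z by (rule sw_cong, rule sw_cong, subst sw_swap) (simp add: sw_mult[where s=scale] mult.assoc)
  also have "\<dots> = sw h (\<lambda>a y. sw y (\<lambda>b y'. sw y' (\<lambda>c d. sw z (\<lambda>u w. p (S a * u * b) *s (w * (c * S d))))))"
    by (rule sw_cong, rule sw_assoc[where s=scale]) simp
  also have "\<dots> = sw h (\<lambda>a y. sw z (\<lambda>u w. p (S a * u * y) *s (w * 1)))"
    by (rule sw_cong, rule sw_cancel(4)[where s=scale and F="\<lambda>b x. sw z (\<lambda>u w. p (S _ * u * b) *s (w * x))"]) simp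
  also have "\<dots> = sw z (\<lambda>u w. sw h (\<lambda>a y. p (S a * u * y) *s w))"
    by (subst sw_swap) simp
  finally show ?thesis using 1 by (simp add: right_hit_sw sw_scale_vec)
qed

section \<open>Generated subalgebras and quotient ideals\<close>

lemma subalgebra_generated: "subalgebra (generated_algebra X)"
  unfolding generated_algebra_def
proof (rule hull_in)
  fix T assume "Ball T subalgebra"
  then show "subalgebra (\<Inter>T)"
    unfolding subalgebra_def by (auto intro: subspace_Inter)
qed

lemma generated_superset: "X \<subseteq> generated_algebra X"
  unfolding generated_algebra_def by (rule hull_subset)

lemma generated_minimal: "X \<subseteq> N \<Longrightarrow> subalgebra N \<Longrightarrow> generated_algebra X \<subseteq> N"
  unfolding generated_algebra_def by (rule hull_minimal)

lemma generated_induct [consumes 1, case_names base one add scale mult]: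
  assumes "x \<in> generated_algebra X" "\<And>x. x \<in> X \<Longrightarrow> P x" "P 1"
    "\<And>x y. P x \<Longrightarrow> P y \<Longrightarrow> P (x + y)" "\<And>c x. P x \<Longrightarrow> P (c *s x)" "\<And>x y. P x \<Longrightarrow> P y \<Longrightarrow> P (x * y)"
  shows "P x"
proof -
  have "P (0 *s 1)" using assms(3,5) by blast
  then have "subalgebra {x. P x}"
    unfolding subalgebra_def using assms(3-) by (auto intro!: subspaceI)
  then show ?thesis using generated_minimal[of X "{x. P x}"] assms(1,2) by blast
qed

lemma left_coideal_generated:
  assumes X: "left_coideal X"
  shows "left_coideal (generated_algebra X)"
proof -
  let ?A = "generated_algebra X"
  have sub: "subspace ?A" "1 \<in> ?A" "\<And>x y. x \<in> ?A \<Longrightarrow> y \<in> ?A \<Longrightarrow> x * y \<in> ?A"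
    using subalgebra_generated unfolding subalgebra_def by blast+
  have "\<forall>p. lin (*) p \<longrightarrow> right_hit x p \<in> ?A" if "x \<in> ?A" for x
    using that
  proof (induction rule: generated_induct)
    case (base x)
    then show ?case using X generated_superset unfolding left_coideal_iff by blast
  next
    case (mult x y)
    show ?case
    proof (intro allI impI)
      fix p :: "'h \<Rightarrow> 'k" assume p: "lin (*) p"
      have "right_hit x (coord c) * right_hit y (\<lambda>u. p (c * u)) \<in> ?A" for c
        using mult sub(3) lin_compose[OF p, of "\<lambda>u. c * u"] by simp
      then show "right_hit (x * y) p \<in> ?A"
        unfolding right_hit_mult[OF p] by (intro subspace_sum[OF sub(1)]) auto
    qed
  qed (use sub(1,2) in \<open>auto simp: right_hit_sw sw_one[where s=scale] lin_add[OF lin_right_hit]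
      lin_scale[OF lin_right_hit] sw_add[where s=scale] sw_scale[where s=scale]
      intro: subspace_add subspace_scale\<close>)
  then show ?thesis using sub(1) unfolding left_coideal_iff by blast
qed

lemma normal_generated:
  assumes X: "normal X"
  shows "normal (generated_algebra X)"
proof -
  let ?A = "generated_algebra X"
  have sub: "subspace ?A" "1 \<in> ?A" "\<And>x y. x \<in> ?A \<Longrightarrow> y \<in> ?A \<Longrightarrow> x * y \<in> ?A"
    using subalgebra_generated unfolding subalgebra_def by blast+
  have "\<forall>h. ad h x \<in> ?A" if "x \<in> ?A" for x
    using that
  proof (induction rule: generated_induct)
    case (base x)
    then show ?case using X generated_superset unfolding normal_ad by blast
  next
    case (mult x y)
    then show ?case using sub(3) by (auto simp: ad_mult intro!: subspace_sw[OF sub(1)])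
  qed (use sub(1,2) in \<open>auto simp: ad_one lin_add[OF lin_ad] lin_scale[OF lin_ad]
      intro: subspace_add subspace_scale\<close>)
  then show ?thesis unfolding normal_ad by blast
qed

lemma augmentation_mem: "x \<in> augmentation N \<longleftrightarrow> x \<in> N \<and> counit x = 0"
  by (simp add: augmentation_def)

lemma minus_counit_in_augmentation:
  "subalgebra N \<Longrightarrow> x \<in> N \<Longrightarrow> x - counit x *s 1 \<in> augmentation N"
  unfolding augmentation_mem subalgebra_def
  by (auto intro!: subspace_diff subspace_scale
      simp: lin_diff[OF lin_counit] lin_scale[OF lin_counit] counit_one)

lemma quotient_ideal_base: "x \<in> augmentation N \<Longrightarrow> h * x \<in> quotient_ideal N"
  unfolding quotient_ideal_def by (rule span_base) blast

lemma quotient_ideal_base': "x \<in> augmentation N \<Longrightarrow> x \<in> quotient_ideal N"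
  using quotient_ideal_base[of x N 1] by simp

lemma left_ideal_quotient_ideal: "left_ideal (quotient_ideal N)"
  unfolding left_ideal_def
proof (intro conjI allI ballI)
  show "subspace (quotient_ideal N)" by (simp add: quotient_ideal_def)
  fix a x assume "x \<in> quotient_ideal N"
  then show "a * x \<in> quotient_ideal N"
    unfolding quotient_ideal_def
  proof (induction rule: span_induct_alt)
    case (step c y z)
    then obtain h v where y: "y = h * v" "v \<in> augmentation N" by blast
    have "a * y \<in> quotient_ideal N" unfolding y(1) mult.assoc[symmetric] using y(2) by (rule quotient_ideal_base)
    then show ?case using step unfolding quotient_ideal_def
      by (simp add: distrib_left scale_mult_right span_add span_scale)
  qed (simp add: span_zero)
qed

lemma quotient_ideal_counit: "x \<in> quotient_ideal N \<Longrightarrow> counit x = 0"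
  unfolding quotient_ideal_def
  by (induction rule: span_induct_alt)
    (auto simp: lin_zero[OF lin_counit] lin_add[OF lin_counit] lin_scale[OF lin_counit] counit_mult augmentation_mem)

end

context semisimple_hopf_algebra
begin

section \<open>The elements \<open>z\<^bsub>n\<^esub>\<close>\<close>

text \<open>
  From now on \<open>S\<^sup>2 = id\<close>, so \<open>lam\<close> and \<open>mu\<close> both become the regular trace.
\<close>

declare antipode_involutive [simp]

lemma mu_eq_tau: "mu x = tau x"
proof -
  have "lam x = mu x" by (simp add: lam_eq_mu_modular modular_eq_one)
  then show ?thesis by (simp add: lam_def tau_def)
qed

lemma lam_eq_tau: "lam x = tau x"
  by (simp add: lam_def tau_def)

lemma tau_right_integral: "sw x (\<lambda>a b. tau a *s b) = tau x *s 1"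
  using mu_right_integral[of x] by (simp add: mu_eq_tau)

lemma casimir_commute: "casimir (x * y) = casimir (y * x)"
proof -
  have "casimir (y * x) = sw Lam (\<lambda>a b. a * y * x * S b)" by (simp add: casimir_def mult.assoc)
  also have "\<dots> = sw Lam (\<lambda>a b. a * x * (S2 y * S b))"
    by (rule Lam_casimir_S2[where s=scale and F="\<lambda>a b. a * x * b"]) simp
  also have "\<dots> = casimir (x * y)" by (simp add: casimir_def mult.assoc)
  finally show ?thesis by simp
qed

lemma casimir_mult_central: "(\<And>x. z * x = x * z) \<Longrightarrow> casimir (z * x) = z * casimir x"
  by (simp add: casimir_def mult_sw) (metis mult.assoc)

lemma counit_casimir: "counit (casimir x) = counit x"
proof -
  have "counit (casimir x) = sw Lam (\<lambda>a b. counit b * (counit a * counit x))"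
    by (simp add: casimir_def lin_sw[OF lin_counit] counit_mult mult_ac)
  also have "\<dots> = counit Lam * counit x" by (rule sw_counit_right_K) (simp add: lin_counit)
  finally show ?thesis by (simp add: counit_Lam)
qed

text \<open>
  This is \<open>z\<^sub>2\<close>, with the first tensor \<open>\<Lambda>\<^sub>1 \<otimes> S(\<Lambda>\<^sub>2)\<close> collected into the Casimir average.
\<close>

definition z2 :: 'h where "z2 = sw Lam (\<lambda>a b. casimir a * S b)"

lemma z2_central: "h * z2 = z2 * h"
proof -
  have lc: "lin scale (\<lambda>x. casimir (f x))" if "lin scale f" for f using lin_compose[OF lin_casimir that] .
  have "h * z2 = sw Lam (\<lambda>a b. casimir a * (S2 h * S b))"
    by (simp add: z2_def mult_sw mult.assoc[symmetric] casimir_central)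
  also have "\<dots> = sw Lam (\<lambda>a b. casimir (a * h) * S b)"
    by (rule Lam_casimir_S2[where s=scale and F="\<lambda>a b. casimir a * b", symmetric]) (simp add: lc lin_casimir)
  also have "\<dots> = sw Lam (\<lambda>a b. casimir (h * a) * S b)"
    by (simp add: casimir_commute[of h])
  also have "\<dots> = sw Lam (\<lambda>a b. casimir a * (S b * h))"
    by (rule Lam_casimir(3)[where s=scale and F="\<lambda>a b. casimir a * b"]) (simp add: lc lin_casimir)
  also have "\<dots> = z2 * h" by (simp add: z2_def sw_times mult.assoc)
  finally show ?thesis .
qed

lemma counit_z2: "counit z2 = 1"
proof -
  have "counit z2 = sw Lam (\<lambda>a b. counit b * counit a)"
    by (simp add: z2_def lin_sw[OF lin_counit] counit_mult counit_casimir mult.commute)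
  also have "\<dots> = counit Lam" by (rule sw_counit_right_K) (simp add: lin_counit)
  finally show ?thesis by (simp add: counit_Lam)
qed

definition z_sum :: "nat \<Rightarrow> ('h \<Rightarrow> 'h \<Rightarrow> 'h) \<Rightarrow> 'h" where
  "z_sum n F = (\<Sum>(u, v)\<leftarrow>z_tensor n. F u v)"

lemma z_sum_0: "z_sum 0 F = F 1 1"
  by (simp add: z_sum_def)

lemma z_sum_Suc: "z_sum (Suc n) F = z_sum n (\<lambda>u v. sw Lam (\<lambda>a b. F (u * a) (v * S b)))"
  by (simp add: z_sum_def sw_def map_concat sum_list_concat split_def o_def)

lemma z_sum_cong: "(\<And>u v. F u v = G u v) \<Longrightarrow> z_sum n F = z_sum n G"
  by (simp add: z_sum_def)

lemma lin_z_sum: "lin scale f \<Longrightarrow> f (z_sum n F) = z_sum n (\<lambda>u v. f (F u v))"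
  unfolding z_sum_def by (simp add: lin_sum_list split_def)

lemma z_elem_z_sum: "z_elem n = z_sum n (\<lambda>u v. u * v)"
  by (simp add: z_elem_def z_sum_def)

text \<open>
  The last two copies of \<open>\<Lambda>\<close> contribute \<open>u c(a' v) b'\<close>, where \<open>c\<close> is the Casimir average and
  \<open>a' \<otimes> b'\<close> the last Casimir element. As \<open>c\<close> is a trace, \<open>v\<close> can be moved through \<open>a'\<close> to the right
  of \<open>b'\<close>, which leaves \<open>u z\<^sub>2 v\<close> with central \<open>z\<^sub>2\<close>.
\<close>

lemma z_elem_Suc_Suc: "z_elem (Suc (Suc n)) = z2 * z_elem n"
proof -
  have lc: "lin scale (\<lambda>x. casimir (f x))" if "lin scale f" for f using lin_compose[OF lin_casimir that] .
  have "sw Lam (\<lambda>a b. sw Lam (\<lambda>c d. u * a * c * (v * S b * S d))) = z2 * (u * v)" for u v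
  proof -
    have "sw Lam (\<lambda>a b. sw Lam (\<lambda>c d. u * a * c * (v * S b * S d)))
      = sw Lam (\<lambda>c d. u * casimir (v * c) * S d)"
      by (subst sw_swap) (simp add: casimir_commute[of v] casimir_def[of "_ * v"] mult_sw sw_times mult.assoc)
    also have "\<dots> = sw Lam (\<lambda>c d. u * casimir c * (S d * v))"
      by (rule Lam_casimir(3)[where s=scale and F="\<lambda>a b. u * casimir a * b"]) (simp add: lc lin_casimir)
    also have "\<dots> = u * (z2 * v)" by (simp add: z2_def mult_sw sw_times mult.assoc)
    also have "\<dots> = z2 * (u * v)" using z2_central[of u] by (simp add: mult.assoc[symmetric])
    finally show ?thesis .
  qed
  then show ?thesis
    using lin_z_sum[of "\<lambda>x. z2 * x"] by (simp add: z_elem_z_sum z_sum_Suc)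
qed

lemma z_elem_eq: "z_elem n = z2 ^ (n div 2)"
proof (induction n rule: less_induct)
  case (less n)
  consider "n = 0" | "n = 1" | m where "n = Suc (Suc m)"
    by (metis One_nat_def old.nat.exhaust)
  then show ?case
  proof cases
    case 2
    then show ?thesis by (simp add: z_elem_z_sum z_sum_Suc z_sum_0 antipode_right_sw counit_Lam)
  next
    case 3
    then show ?thesis using less.IH[of m] by (simp add: z_elem_Suc_Suc)
  qed (simp add: z_elem_z_sum z_sum_0)
qed

lemma z_elem_central: "h * z_elem n = z_elem n * h"
  unfolding z_elem_eq by (rule power_commuting_commutes[OF z2_central[symmetric], symmetric])

lemma counit_z_elem: "counit (z_elem n) = 1"
proof -
  have "counit (z2 ^ k) = 1" for k by (induction k) (simp_all add: counit_one counit_mult counit_z2)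
  then show ?thesis by (simp add: z_elem_eq)
qed

text \<open>
  The map \<open>x \<mapsto> c(e x)\<close> projects \<open>H\<close> onto the center of the block, which is one dimensional, so its
  trace is \<open>1\<close>. The trace formula computes the same trace as \<open>tau(e z\<^sub>2)\<close>. In other words, \<open>z\<^sub>2\<close> acts
  on the block as the inverse of its dimension.
\<close>

lemma tau_z2: "primitive e \<Longrightarrow> tau (e * z2) = 1"
proof -
  assume e: "primitive e"
  have ee: "e * e = e" "\<And>x. e * x = x * e" "e \<noteq> 0"
    using e unfolding primitive_def central_idempotent_def by blast+
  have casimir_e: "casimir (e * x) = e * casimir x" for x by (rule casimir_mult_central) (rule ee(2))
  define T where "T x = casimir (e * x)" for x
  have linT: "lin scale T" unfolding T_def[abs_def] by (rule lin_compose[OF lin_casimir]) simp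
  have Tc: "\<exists>c. T x = c *s e" for x
  proof -
    have "T x * y = y * T x" for y unfolding T_def by (rule casimir_central[symmetric])
    moreover have "T x * e = T x"
      using ee(2)[of "T x"] by (simp add: T_def casimir_e mult.assoc[symmetric] ee(1))
    ultimately show ?thesis using primitive_center[OF e] by metis
  qed
  have Te: "T e = e"
    using casimir_e[of 1] by (simp add: T_def ee(1) casimir_one)
  have "T (T x) = T x" for x using Tc[of x] Te by (auto simp: lin_scale[OF linT])
  then have "tr T = of_nat (dim (range T))" by (rule tr_idempotent[OF linT])
  moreover have "range T = span {e}"
  proof
    show "range T \<subseteq> span {e}" using Tc by (auto simp: span_singleton)
    show "span {e} \<subseteq> range T"
    proof
      fix x assume "x \<in> span {e}"
      then obtain c where "x = c *s e" by (auto simp: span_singleton)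
      then have "x = T (c *s e)" by (simp add: lin_scale[OF linT] Te)
      then show "x \<in> range T" by blast
    qed
  qed
  ultimately have "tr T = of_nat (dim (span {e}))" by simp
  moreover have "dim (span {e}) = 1"
    using ee(3) by (simp add: dim_span dim_eq_card_independent)
  moreover have "tr T = tau (e * z2)"
  proof -
    have "tr T = sw Lam (\<lambda>a b. tau (S b * (e * casimir a)))"
      by (subst tr_formula[OF linT]) (simp add: mu_eq_tau T_def casimir_e)
    also have "\<dots> = sw Lam (\<lambda>a b. tau (e * casimir a * S b))"
      by (rule sw_cong, rule tau_commute)
    finally show ?thesis by (simp add: z2_def mult_sw mult.assoc lin_sw[OF lin_tau])
  qed
  ultimately show ?thesis by simp
qed

text \<open>
  On a primitive block the power \<open>dim(He)\<^bsup>n div 2\<^esup>\<close> equals \<open>1\<close>, so \<open>dim(He) = 1\<close>. Here \<open>n \<ge> 2\<close> ensures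
  that the exponent is positive.
\<close>

lemma commute_if_z_elem_trivial:
  assumes "n \<ge> 2" "central_idempotent f" "z_elem n * f = f"
  shows "x * y * f = y * x * f"
  using assms(2,3)
proof (induction arbitrary: x y rule: central_idempotent_induct)
  case (primitive e)
  have ee: "e * e = e" "\<And>x. e * x = x * e" "e \<noteq> 0"
    using primitive(1) unfolding primitive_def central_idempotent_def by blast+
  have "z2 * e * u = u * (z2 * e)" for u
    by (metis ee(2) mult.assoc z2_central)
  then obtain c where c: "z2 * e = c *s e"
    using primitive_center[OF primitive(1), of "z2 * e"] ee(1) by (metis mult.assoc)
  have "c * of_nat (rank e) = 1"
    using tau_z2[OF primitive(1)] tau_idempotent[OF ee(1)] ee(2)[of z2]
    by (simp add: c lin_scale[OF lin_tau])
  moreover have "z2 ^ k * e = c ^ k *s e" for k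
    by (induction k) (simp_all add: mult.assoc scale_mult_right c mult.commute)
  then have "c ^ (n div 2) *s e = 1 *s e" using primitive(2) by (simp add: z_elem_eq)
  then have "c ^ (n div 2) = 1" using ee(3) by (simp only: scale_cancel_right) simp
  ultimately have "(of_nat (rank e) :: 'k) ^ (n div 2) = 1"
    by (metis mult.left_neutral power_mult_distrib power_one)
  then have "of_nat (rank e ^ (n div 2)) = (of_nat 1 :: 'k)" by simp
  then have "rank e ^ (n div 2) = 1" by (simp only: of_nat_eq_iff)
  moreover have "n div 2 > 0" using assms(1) by (simp add: div_greater_zero_iff)
  ultimately have rank: "rank e = 1" by simp
  have "span {e} = range (\<lambda>y. e * y)"
  proof (rule fd.subspace_dim_equal)
    show "subspace (range (\<lambda>y. e * y))" by (rule subspace_image) simp_all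
    have "e \<in> range (\<lambda>y. e * y)" using ee(1) by (metis rangeI)
    then show "span {e} \<subseteq> range (\<lambda>y. e * y)"
      using \<open>subspace (range (\<lambda>y. e * y))\<close> by (intro span_minimal) auto
    show "dim (range (\<lambda>y. e * y)) \<le> dim (span {e})"
      using rank ee(3) by (simp add: rank_def dim_span dim_eq_card_independent)
  qed simp
  then have "\<exists>a. e * u = a *s e" for u by (metis (no_types, lifting) rangeE rangeI span_singleton)
  then obtain a b where "e * x = a *s e" "e * y = b *s e" by blast
  then have xe: "x * e = a *s e" "y * e = b *s e" using ee(2) by metis+
  then show ?case by (simp add: mult.assoc scale_mult_right mult.commute)
next
  case (add e f)
  have ee: "e * e = e" "\<And>x. e * x = x * e" and ff: "f * f = f" "\<And>x. f * x = x * f"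
    using add(1,2) unfolding central_idempotent_def by blast+
  have fe: "f * e = 0" using add(3) ff(2)[of e] by simp
  have "z_elem n * e = e"
    using arg_cong[OF add(6), of "\<lambda>x. x * e"] by (simp add: distrib_right mult.assoc ee(1) fe)
  moreover have "z_elem n * f = f"
    using arg_cong[OF add(6), of "\<lambda>x. x * f"] by (simp add: distrib_right mult.assoc ff(1) add(3))
  ultimately show ?case using add(4,5) by (simp add: distrib_left)
qed simp

section \<open>Normal left coideal subalgebras\<close>

lemma antipode_flip: "sw h (\<lambda>a b. b * S a) = counit h *s 1"
  using arg_cong[OF antipode_right_sw[of h], of S]
  by (simp add: lin_sw[OF lin_antipode] antipode_mult lin_scale[OF lin_antipode])

text \<open>
  For an involutive antipode the right adjoint action is the left one twisted by \<open>S\<close>. Together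
  with \<open>mult_eq_ad\<close> this makes \<open>HN\<^sup>+\<close> a two-sided ideal for normal \<open>N\<close>.
\<close>

lemma mult_eq_ad_right: "x * h = sw h (\<lambda>a b. b * ad (S a) x)"
proof -
  have ad: "ad (S a) x = sw a (\<lambda>u v. S v * x * u)" for a
    by (simp add: ad_def sw_antipode[where s=scale])
  have "sw h (\<lambda>a b. b * ad (S a) x) = sw h (\<lambda>a b. sw a (\<lambda>u v. b * S v * x * u))"
    by (simp add: ad mult_sw mult.assoc)
  also have "\<dots> = sw h (\<lambda>u w. sw w (\<lambda>v b. b * S v * x * u))"
    by (rule sw_assoc[where s=scale]) simp
  also have "\<dots> = sw h (\<lambda>u w. counit w *s (x * u))"
    by (simp add: sw_times[symmetric] antipode_flip scale_mult_left)
  also have "\<dots> = x * h" by (rule sw_counit_right_H) simp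
  finally show ?thesis by simp
qed

lemma quotient_ideal_right:
  assumes N: "normal N" and x: "x \<in> quotient_ideal N"
  shows "x * a \<in> quotient_ideal N"
  using x unfolding quotient_ideal_def
proof (induction rule: span_induct_alt)
  case (step c y z)
  then obtain h v where y: "y = h * v" "v \<in> augmentation N" by blast
  have "ad (S u) v \<in> augmentation N" for u
    using y(2) N by (auto simp: augmentation_mem normal_ad counit_ad)
  then have "v * a \<in> quotient_ideal N"
    unfolding mult_eq_ad_right[of v a] using left_ideal_quotient_ideal[of N]
    by (auto simp: left_ideal_def intro!: subspace_sw quotient_ideal_base)
  then have "y * a \<in> quotient_ideal N"
    unfolding y(1) mult.assoc using left_ideal_quotient_ideal[of N] by (auto simp: left_ideal_def)
  then show ?case using step unfolding quotient_ideal_def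
    by (simp add: distrib_right scale_mult_left span_add span_scale)
qed (simp add: span_zero)

text \<open>
  The algebra \<open>H / HN\<^sup>+\<close> is realized as the block \<open>Hf\<close> inside \<open>H\<close>, where \<open>N\<close> acts through \<open>\<epsilon>\<close>.
\<close>

lemma quotient_idempotent:
  assumes "subalgebra N" "normal N"
  obtains f where "central_idempotent f" "\<And>x. x \<in> quotient_ideal N \<Longrightarrow> x * f = 0" "1 - f \<in> quotient_ideal N"
    "\<And>m. m \<in> N \<Longrightarrow> m * f = counit m *s f" "f \<noteq> 0"
proof -
  obtain f where f: "central_idempotent f" "\<And>x. x \<in> quotient_ideal N \<Longrightarrow> x * f = 0" "1 - f \<in> quotient_ideal N"
    using ideal_central_idempotent[OF left_ideal_quotient_ideal quotient_ideal_right[OF assms(2)]] by blast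
  have "m * f = counit m *s f" if "m \<in> N" for m
    using f(2)[OF quotient_ideal_base'[OF minus_counit_in_augmentation[OF assms(1) that]]]
    by (simp add: left_diff_distrib scale_mult_left)
  moreover have "f \<noteq> 0"
    using quotient_ideal_counit[OF f(3)] counit_one by auto
  ultimately show ?thesis using that f by blast
qed

lemma z_coideal_alt: "z_coideal n = {right_hit (z_elem n) p | p. lin (*) p}"
  by (simp add: z_coideal_def lin_dual)

lemma left_coideal_z_coideal: "left_coideal (z_coideal n)"
  unfolding left_coideal_iff
proof (intro conjI subspaceI ballI allI impI)
  have zero: "lin (*) (\<lambda>_. 0 :: 'k)" by simp
  have "right_hit (z_elem n) (\<lambda>_. 0) = 0" by (simp add: right_hit_sw sw_def split_def)
  then show "0 \<in> z_coideal n" using zero unfolding z_coideal_alt by (metis (mono_tags, lifting) mem_Collect_eq)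
next
  fix x y assume "x \<in> z_coideal n" "y \<in> z_coideal n"
  then obtain p q where pq: "lin (*) p" "lin (*) q" "x = right_hit (z_elem n) p" "y = right_hit (z_elem n) q"
    unfolding z_coideal_alt by blast
  then have "x + y = right_hit (z_elem n) (\<lambda>u. p u + q u)"
    by (simp add: right_hit_sw scale_left_distrib sw_plus)
  moreover have "lin (*) (\<lambda>u. p u + q u)" using pq by simp
  ultimately show "x + y \<in> z_coideal n" unfolding z_coideal_alt by blast
next
  fix c x assume "x \<in> z_coideal n"
  then obtain p where p: "lin (*) p" "x = right_hit (z_elem n) p" unfolding z_coideal_alt by blast
  then have "c *s x = right_hit (z_elem n) (\<lambda>u. c * p u)"
    by (simp add: right_hit_sw scale_sw)
  moreover have "lin (*) (\<lambda>u. c * p u)" using p by simp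
  ultimately show "c *s x \<in> z_coideal n" unfolding z_coideal_alt by blast
next
  fix x and q :: "'h \<Rightarrow> 'k" assume "x \<in> z_coideal n" and q: "lin (*) q"
  then obtain p where p: "lin (*) p" "x = right_hit (z_elem n) p" unfolding z_coideal_alt by blast
  have "lin (*) (\<lambda>u. sw u (\<lambda>a b. p a * q b))" using p(1) q by simp
  then show "right_hit x q \<in> z_coideal n"
    unfolding p(2) right_hit_right_hit[OF p(1) q] z_coideal_alt by blast
qed

lemma z_elem_in_z_coideal: "z_elem n \<in> z_coideal n"
  unfolding z_coideal_alt using right_hit_counit lin_counit by (metis (mono_tags, lifting) mem_Collect_eq)

lemma normal_z_coideal: "normal (z_coideal n)"
  unfolding normal_ad
proof (intro allI ballI)
  fix h x assume "x \<in> z_coideal n"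
  then obtain p where p: "lin (*) p" "x = right_hit (z_elem n) p" unfolding z_coideal_alt by blast
  have "lin (*) (\<lambda>u. sw h (\<lambda>a b. p (S a * u * b)))" by (simp add: lin_compose[OF p(1)])
  then show "ad h x \<in> z_coideal n"
    unfolding p(2) ad_right_hit_central[OF z_elem_central p(1)] z_coideal_alt by blast
qed

text \<open>
  Since \<open>z\<^bsub>n\<^esub>\<close> lies in the generated algebra and \<open>\<epsilon>(z\<^bsub>n\<^esub>) = 1\<close>, it acts as \<open>1\<close> on \<open>Hf\<close>.
\<close>

lemma abelianizing_generated:
  assumes "n \<ge> 2"
  shows "abelianizing (generated_algebra (z_coideal n))"
proof -
  let ?A = "generated_algebra (z_coideal n)"
  have A: "subalgebra ?A" "normal ?A" "left_coideal ?A"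
    by (rule subalgebra_generated, rule normal_generated[OF normal_z_coideal],
      rule left_coideal_generated[OF left_coideal_z_coideal])
  obtain f where f: "central_idempotent f" "1 - f \<in> quotient_ideal ?A" "\<And>m. m \<in> ?A \<Longrightarrow> m * f = counit m *s f"
    using quotient_idempotent[OF A(1,2)] by metis
  have "z_elem n * f = f"
    using f(3)[of "z_elem n"] generated_superset z_elem_in_z_coideal by (auto simp: counit_z_elem)
  then have comm: "x * y * f = y * x * f" for x y
    by (rule commute_if_z_elem_trivial[OF assms f(1)])
  have "x * y - y * x \<in> quotient_ideal ?A" for x y
  proof -
    have "x * y - y * x = (x * y - y * x) * (1 - f)"
      using comm[of x y] by (simp add: left_diff_distrib right_diff_distrib)
    moreover have "(x * y - y * x) * (1 - f) \<in> quotient_ideal ?A"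
      using left_ideal_quotient_ideal[of ?A] f(2) unfolding left_ideal_def by blast
    ultimately show ?thesis by simp
  qed
  then show ?thesis using A unfolding abelianizing_def commutative_quotient_def by blast
qed

section \<open>Minimality of the generated algebra\<close>

text \<open>
  The radical \<open>N\<close> of the form on \<open>M\<close> is a left coideal, because \<open>tau\<close> is an integral. An element \<open>y\<close>
  of \<open>N\<close> is nilpotent: otherwise a power of the Fitting element would be a nonzero idempotent in
  \<open>N\<close>, of nonzero trace. Hence \<open>\<epsilon>\<close> vanishes on \<open>N\<close>, and a left coideal in \<open>ker \<epsilon>\<close> is zero.
\<close>

lemma tau_nondegenerate_coideal:
  assumes sub: "subalgebra M" and coideal: "left_coideal M"
    and x: "x \<in> M" "\<And>m. m \<in> M \<Longrightarrow> tau (x * m) = 0"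
  shows "x = 0"
proof -
  have M: "subspace M" "1 \<in> M" "\<And>x y. x \<in> M \<Longrightarrow> y \<in> M \<Longrightarrow> x * y \<in> M"
    using sub unfolding subalgebra_def by blast+
  have hit: "right_hit m p \<in> M" if "m \<in> M" "lin (*) p" for m p
    using coideal that unfolding left_coideal_iff by blast
  define N where "N = {x \<in> M. \<forall>m\<in>M. tau (x * m) = 0}"
  have N: "subspace N"
    unfolding N_def using M(1)
    by (auto intro!: subspaceI simp: subspace_0 subspace_add subspace_scale distrib_right scale_mult_left
      lin_zero[OF lin_tau] lin_add[OF lin_tau] lin_scale[OF lin_tau])
  have Nmult: "y * m \<in> N" if "y \<in> N" "m \<in> M" for y m
    using that M(3) unfolding N_def by (auto simp: mult.assoc)
  have counit: "counit y = 0" if y: "y \<in> N" for y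
  proof -
    obtain k r where kr: "y ^ k = y ^ k * (y * r)" "y * r = r * y"
      "\<And>N. subspace N \<Longrightarrow> (\<And>i. y ^ Suc i \<in> N) \<Longrightarrow> y * r \<in> N"
      using fitting[of y] by blast
    have pow: "y ^ i \<in> M" for i
      using y M(2,3) unfolding N_def by (induction i) auto
    define t where "t = y * r"
    have "t \<in> N" unfolding t_def
      by (rule kr(3)[OF N]) (simp add: Nmult[OF y pow])
    have tpow: "t ^ i \<in> M" for i
      using \<open>t \<in> N\<close> M(2,3) unfolding N_def by (induction i) auto
    \<comment> \<open>A positive exponent, so that \<open>t ^ j\<close> stays in \<open>N\<close>.\<close>
    define j where "j = Suc k"
    have yt: "y ^ j * t = y ^ j"
      using kr(1) by (simp add: j_def t_def mult.assoc)
    have ty: "t * y = y * t" unfolding t_def by (metis kr(2) mult.assoc)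
    have tyj: "t * y ^ i = y ^ i * t" for i
      by (induction i) (simp_all, metis ty mult.assoc)
    have split: "t ^ i = y ^ i * r ^ i" for i
    proof (induction i)
      case (Suc i)
      have "t ^ Suc i = t * y ^ i * r ^ i" using Suc by (simp add: mult.assoc)
      also have "\<dots> = y ^ i * y * r * r ^ i" by (simp add: tyj) (simp add: t_def mult.assoc)
      finally show ?case by (simp add: power_commutes mult.assoc)
    qed simp
    have "t * t ^ j = t ^ j"
      unfolding split[of j] by (metis mult.assoc tyj yt)
    then have "t ^ i * t ^ j = t ^ j" for i by (induction i) (simp_all add: mult.assoc)
    then have idem: "t ^ j * t ^ j = t ^ j" .
    have "t ^ j \<in> N" unfolding j_def using Nmult[OF \<open>t \<in> N\<close> tpow] by simp
    then have "tau (t ^ j * 1) = 0" using M(2) unfolding N_def by blast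
    then have "t ^ j = 0" using tau_idempotent_eq_0[OF idem] by simp
    have "y ^ j * t ^ i = y ^ j" for i
      by (induction i) (simp_all add: mult.assoc[symmetric] yt)
    from this[of j] have "y ^ j = 0" using \<open>t ^ j = 0\<close> by simp
    moreover have "counit (y ^ i) = counit y ^ i" for i
      by (induction i) (simp_all add: counit_one counit_mult)
    ultimately show ?thesis by (metis lin_zero[OF lin_counit] power_eq_0_iff)
  qed
  have hitN: "right_hit y p \<in> N" if y: "y \<in> N" and p: "lin (*) p" for y p
  proof -
    note [simp] = lin_compose[OF p]
    have "tau (right_hit y p * m) = 0" if m: "m \<in> M" for m
    proof -
      have "sw m (\<lambda>a b. lam (y * b) *s a) = sw y (\<lambda>a b. lam (b * m) *s S a)"
        by (rule left_integral_shift[OF lin_lam lam_left_integral])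
      from arg_cong[OF this, of "\<lambda>x. p (S x)"]
      have eq: "sw m (\<lambda>a b. tau (y * b) * p (S a)) = sw y (\<lambda>a b. tau (b * m) * p a)"
        by (simp add: lam_eq_tau lin_sw[OF lin_antipode] lin_scale[OF lin_antipode] lin_sw[OF p] lin_scale[OF p])
      have "tau (right_hit y p * m) = sw y (\<lambda>a b. tau (b * m) * p a)"
        by (simp add: right_hit_sw sw_times scale_mult_left lin_sw[OF lin_tau] lin_scale[OF lin_tau] mult.commute)
      also have "\<dots> = tau (y * right_hit m (\<lambda>u. p (S u)))"
        unfolding eq[symmetric]
        by (simp add: right_hit_sw mult_sw scale_mult_right lin_sw[OF lin_tau] lin_scale[OF lin_tau] mult.commute)
      also have "\<dots> = 0" using y hit[OF m, of "\<lambda>u. p (S u)"] unfolding N_def by simp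
      finally show ?thesis .
    qed
    moreover have "right_hit y p \<in> M" using y p hit unfolding N_def by blast
    ultimately show ?thesis unfolding N_def by blast
  qed
  have "x \<in> N" using x unfolding N_def by blast
  show "x = 0"
  proof (rule eq_if_functionals_eq)
    fix p :: "'h \<Rightarrow> 'k" assume p: "lin (*) p"
    have "p x = counit (right_hit x p)" by (simp add: counit_right_hit[OF p])
    also have "\<dots> = 0" by (rule counit[OF hitN[OF \<open>x \<in> N\<close> p]])
    finally show "p x = p 0" by (simp add: lin_zero[OF p])
  qed
qed

text \<open>
  In coordinates with respect to a basis \<open>C\<close> of \<open>M\<close>, the map \<open>y \<mapsto> tau(y \<cdot> _)\<close> is an injective
  endomorphism \<open>T\<close> of \<open>M\<close>, so it is onto.
\<close>

lemma tau_represents: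
  assumes sub: "subalgebra M" and coideal: "left_coideal M" and p: "lin (*) p"
  obtains y where "y \<in> M" "\<And>m. m \<in> M \<Longrightarrow> tau (y * m) = p m"
proof -
  have M: "subspace M" using sub unfolding subalgebra_def by blast
  obtain C where C: "C \<subseteq> M" "independent C" "M \<subseteq> span C"
    using maximal_independent_subset[of M] by blast
  have fin: "finite C" using C(2) fd.finiteI_independent by blast
  have agree: "f m = h m" if "lin (*) f" "lin (*) h" "\<And>c. c \<in> C \<Longrightarrow> f c = h c" "m \<in> M"
    for f h :: "'h \<Rightarrow> 'k" and m
  proof -
    have "m \<in> span C" using C(3) that(4) by blast
    then show ?thesis
      by (induction rule: span_induct_alt)
        (simp_all add: lin_zero[OF that(1)] lin_zero[OF that(2)] that(3) lin_add[OF that(1)] lin_add[OF that(2)] lin_scale[OF that(1)] lin_scale[OF that(2)])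
  qed
  define T where "T y = (\<Sum>c\<in>C. tau (y * c) *s c)" for y
  have linT: "lin scale T" unfolding T_def[abs_def] by simp
  have coeff: "u c = w c" if "(\<Sum>c\<in>C. u c *s c) = (\<Sum>c\<in>C. w c *s c)" "c \<in> C" for u w c
  proof -
    have "(\<Sum>c\<in>C. (u c - w c) *s c) = 0" using that(1) by (simp add: scale_left_diff_distrib sum_subtractf)
    then have "u c - w c = 0" using independentD[OF C(2) fin _ _ that(2), of "\<lambda>c. u c - w c"] by simp
    then show ?thesis by simp
  qed
  have "inj_on T M"
  proof (rule inj_onI)
    fix x y assume xy: "x \<in> M" "y \<in> M" "T x = T y"
    have "tau (x * c) = tau (y * c)" if "c \<in> C" for c
      using coeff[of "\<lambda>c. tau (x * c)" "\<lambda>c. tau (y * c)", OF _ that] xy(3) by (simp add: T_def)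
    then have "tau (x * m) = tau (y * m)" if "m \<in> M" for m
      using agree[of "\<lambda>m. tau (x * m)" "\<lambda>m. tau (y * m)", OF _ _ _ that] by simp
    then have "x - y = 0"
      using subspace_diff[OF M xy(1,2)]
      by (intro tau_nondegenerate_coideal[OF sub coideal]) (simp_all add: left_diff_distrib lin_diff[OF lin_tau])
    then show "x = y" by simp
  qed
  then have "inj_on T (span M)" using M by (metis span_eq_iff)
  interpret P: finite_dimensional_vector_space_pair_1 scale bas scale
    by unfold_locales
  have "dim (T ` M) = dim M"
    using linT \<open>inj_on T (span M)\<close> by (intro P.dim_image_eq) (simp_all add: lin_def)
  have "T ` M = M"
  proof (rule fd.subspace_dim_equal)
    show "subspace (T ` M)" by (rule subspace_image[OF linT M])
    show "T ` M \<subseteq> M" using C(1) by (auto simp: T_def intro!: subspace_sum[OF M] subspace_scale[OF M])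
  qed (simp_all add: M \<open>dim (T ` M) = dim M\<close>)
  moreover have "(\<Sum>c\<in>C. p c *s c) \<in> M"
    using C(1) by (auto intro!: subspace_sum[OF M] subspace_scale[OF M])
  ultimately obtain y where y: "y \<in> M" "T y = (\<Sum>c\<in>C. p c *s c)" by (metis imageE)
  have "tau (y * c) = p c" if "c \<in> C" for c
    using coeff[of "\<lambda>c. tau (y * c)" p, OF _ that] y(2) by (simp add: T_def)
  then have "tau (y * m) = p m" if "m \<in> M" for m
    using agree[of "\<lambda>m. tau (y * m)" p, OF _ p _ that] by simp
  then show ?thesis using that y(1) by blast
qed

text \<open>
  Let \<open>y \<in> M\<close> represent the restriction of \<open>tau(f \<cdot> _)\<close> to \<open>M\<close>. Then \<open>y m = \<epsilon>(m) y\<close> for \<open>m \<in> M\<close>, so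
  \<open>y\<close> annihilates \<open>HM\<^sup>+\<close> and \<open>y = y f = \<epsilon>(y) f\<close>. It is not zero since \<open>tau(y) = tau(f)\<close>.
\<close>

lemma quotient_idempotent_mem:
  assumes sub: "subalgebra M" and coideal: "left_coideal M" and normal: "normal M"
    and f: "central_idempotent f" "1 - f \<in> quotient_ideal M" "\<And>m. m \<in> M \<Longrightarrow> m * f = counit m *s f" "f \<noteq> 0"
  shows "f \<in> M"
proof -
  have M: "subspace M" "1 \<in> M" "\<And>x y. x \<in> M \<Longrightarrow> y \<in> M \<Longrightarrow> x * y \<in> M"
    using sub unfolding subalgebra_def by blast+
  have ff: "f * f = f" "\<And>x. f * x = x * f" using f(1) unfolding central_idempotent_def by blast+
  have "lin (*) (\<lambda>m. tau (f * m))" by simp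
  then obtain y where y: "y \<in> M" "\<And>m. m \<in> M \<Longrightarrow> tau (y * m) = tau (f * m)"
    using tau_represents[OF sub coideal] by blast
  have tauf: "tau (f * m) = counit m * tau f" if "m \<in> M" for m
    using f(3)[OF that] ff(2)[of m] by (simp add: lin_scale[OF lin_tau])
  have ym: "y * m = counit m *s y" if m: "m \<in> M" for m
  proof -
    have "y * m - counit m *s y = 0"
    proof (rule tau_nondegenerate_coideal[OF sub coideal])
      show "y * m - counit m *s y \<in> M" using M y(1) m by (simp add: subspace_diff subspace_scale)
      fix m' assume m': "m' \<in> M"
      have "tau (y * (m * m')) = counit m * counit m' * tau f"
        using y(2)[of "m * m'"] tauf[of "m * m'"] M(3) m m' by (simp add: counit_mult)
      moreover have "tau (y * m') = counit m' * tau f" using y(2) tauf m' by simp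
      ultimately show "tau ((y * m - counit m *s y) * m') = 0"
        by (simp add: left_diff_distrib lin_diff[OF lin_tau] scale_mult_left lin_scale[OF lin_tau] mult.assoc)
    qed
    then show ?thesis by simp
  qed
  have "y * q = 0" if "q \<in> quotient_ideal M" for q
    using that unfolding quotient_ideal_def
  proof (induction rule: span_induct_alt)
    case (step c b z)
    then obtain h v where b: "b = h * v" "v \<in> augmentation M" by blast
    have "y * ad a v = 0" for a
      using ym[of "ad a v"] normal b(2) by (auto simp: normal_ad augmentation_mem counit_ad)
    then have "y * b = 0"
      unfolding b(1) mult_eq_ad[of h v] by (simp add: mult_sw mult.assoc[symmetric]) (simp add: sw_def split_def)
    then show ?case using step by (simp add: distrib_left scale_mult_right)
  qed simp
  from this[OF f(2)] have "y = y * f" by (simp add: right_diff_distrib)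
  then have yf: "y = counit y *s f" using f(3)[OF y(1)] by simp
  have "tau y = tau f" using y(2)[OF M(2)] by simp
  moreover have "tau f \<noteq> 0" using tau_idempotent_eq_0[OF ff(1)] f(4) by blast
  ultimately have "counit y \<noteq> 0" using yf by (metis lin_zero[OF lin_tau] scale_zero_left)
  then have "f = inverse (counit y) *s y" using yf by (metis left_inverse scale_one scale_scale)
  then show ?thesis using M(1) y(1) by (metis subspace_scale)
qed

text \<open>
  The hypothesis on \<open>z\<close> says \<open>\<Delta>(z)(1 \<otimes> f) = z \<otimes> f\<close>. It gives the Casimir rule
  \<open>\<Sum> f\<^sub>1 \<otimes> z f\<^sub>2 = \<Sum> S(z) f\<^sub>1 \<otimes> f\<^sub>2\<close>, as for \<open>\<Lambda>\<close>. Applying the integral \<open>tau\<close> to the first factor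
  expresses \<open>tau(f) z\<close> through \<open>f\<close> and the action of the dual.
\<close>

lemma coinvariant_mem:
  assumes coideal: "left_coideal M" and f: "f \<in> M" "f * f = f" "f \<noteq> 0"
    and z: "\<And>F :: 'h \<Rightarrow> 'h \<Rightarrow> 'h. bil scale F \<Longrightarrow> sw z (\<lambda>a b. F a (b * f)) = F z f"
  shows "z \<in> M"
proof -
  have "sw f (\<lambda>p q. tau p *s (z * q))
     = sw z (\<lambda>a y. sw y (\<lambda>b c. sw f (\<lambda>p q. tau (S a * b * p) *s (c * q))))"
    by (subst sw_cancel(1)[where s=scale and F="\<lambda>x c. sw f (\<lambda>p q. tau (x * p) *s (c * q))"])
      (simp_all add: lin_tau)
  also have "\<dots> = sw z (\<lambda>a y. sw (y * f) (\<lambda>p q. tau (S a * p) *s q))"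
    by (simp add: sw_mult[where s=scale] mult.assoc)
  also have "\<dots> = sw f (\<lambda>p q. tau (S z * p) *s q)"
    by (rule z[of "\<lambda>a w. sw w (\<lambda>p q. tau (S a * p) *s q)"]) simp
  finally have "right_hit f (\<lambda>p. tau (S z * p)) = z * sw f (\<lambda>p q. tau p *s q)"
    by (simp add: right_hit_sw mult_sw scale_mult_right)
  then have "right_hit f (\<lambda>p. tau (S z * p)) = tau f *s z"
    by (simp add: tau_right_integral scale_mult_right)
  moreover have "right_hit f (\<lambda>p. tau (S z * p)) \<in> M"
    using coideal f(1) unfolding left_coideal_iff by simp
  moreover have "tau f \<noteq> 0" using tau_idempotent_eq_0[OF f(2)] f(3) by blast
  ultimately show ?thesis
    using coideal unfolding left_coideal_iff by (metis left_inverse scale_one scale_scale subspace_scale)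
qed

lemma lin_tril:
  assumes "tril s G" "lin scale h"
  shows "lin s (\<lambda>x. G (h x) b c)" "lin s (\<lambda>x. G a (h x) c)" "lin s (\<lambda>x. G a b (h x))"
  using assms(1) lin_compose[OF _ assms(2), of s "\<lambda>x. G x b c"] lin_compose[OF _ assms(2), of s "\<lambda>x. G a x c"]
    lin_compose[OF _ assms(2), of s "\<lambda>x. G a b x"] by auto

text \<open>
  In \<open>\<Delta>(uv)\<close> the newest copy of \<open>\<Lambda>\<close> contributes \<open>\<Lambda>\<^sub>2 \<dots> S(\<Lambda>\<^sub>3)\<close> to the second tensor factor. Modulo
  \<open>1 - f\<close> these two factors can be moved next to each other, and they cancel. The claim keeps
  \<open>u\<close> and \<open>v\<close> apart so that it can be proved by induction on the number of copies.
\<close>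

lemma z_sum_coinvariant:
  assumes f: "central_idempotent f" and comm: "\<And>x y. x * y * f = y * x * f"
  shows "tril scale G \<Longrightarrow> z_sum n (\<lambda>u v. sw u (\<lambda>a b. sw v (\<lambda>c d. G a c (b * d * f)))) = z_sum n (\<lambda>u v. G u v f)"
proof (induction n arbitrary: G)
  case 0
  show ?case by (simp add: z_sum_0 sw_one[where s=scale] lin_tril[OF 0])
next
  case (Suc n)
  have ff: "\<And>x. f * x = x * f" using f unfolding central_idempotent_def by blast
  note [simp] = lin_tril[OF Suc.prems]
  have move: "b * q * (d * s) * f = b * d * (q * s) * f" for b q d s
  proof -
    have "b * q * (d * s) * f = b * (q * d * f) * s" by (simp add: mult.assoc ff)
    also have "\<dots> = b * (d * q * f) * s" by (simp only: comm)
    finally show ?thesis by (simp add: mult.assoc ff)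
  qed
  define G' where "G' x y w = sw Lam (\<lambda>p q. G (x * p) (y * S q) w)" for x y w
  have "tril scale G'" unfolding G'_def by simp
  define K where "K a b c d p1 p2 q1 q2 =
    G (a * p1) (c * S q2) (b * d * (p2 * S q1) * f)" for a b c d p1 p2 q1 q2
  have step: "sw Lam (\<lambda>p q. sw (u * p) (\<lambda>a b. sw (v * S q) (\<lambda>c d. G a c (b * d * f))))
    = sw u (\<lambda>a b. sw v (\<lambda>c d. G' a c (b * d * f)))" for u v
  proof -
    have "sw Lam (\<lambda>p q. sw (u * p) (\<lambda>a b. sw (v * S q) (\<lambda>c d. G a c (b * d * f))))
      = sw Lam (\<lambda>p q. sw u (\<lambda>a b. sw p (\<lambda>p1 p2. sw v (\<lambda>c d. sw q (K a b c d p1 p2)))))"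
      by (simp add: sw_mult[where s=scale] sw_antipode[where s=scale] move K_def[abs_def])
    also have "\<dots> = sw u (\<lambda>a b. sw Lam (\<lambda>p q. sw p (\<lambda>p1 p2. sw v (\<lambda>c d. sw q (K a b c d p1 p2)))))"
      by (rule sw_swap)
    also have "\<dots> = sw u (\<lambda>a b. sw Lam (\<lambda>p q. sw v (\<lambda>c d. sw p (\<lambda>p1 p2. sw q (K a b c d p1 p2)))))"
      by (rule sw_cong, rule sw_cong, rule sw_swap)
    also have "\<dots> = sw u (\<lambda>a b. sw v (\<lambda>c d. sw Lam (\<lambda>p q. sw p (\<lambda>p1 p2. sw q (K a b c d p1 p2)))))"
      by (rule sw_cong, rule sw_swap)
    also have "\<dots> = sw u (\<lambda>a b. sw v (\<lambda>c d. G' a c (b * d * f)))"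
    proof (rule sw_cong, rule sw_cong)
      fix a b c d
      have "sw Lam (\<lambda>p q. sw p (\<lambda>p1 p2. sw q (K a b c d p1 p2)))
        = sw Lam (\<lambda>p1 w. sw w (\<lambda>p2 q. sw q (K a b c d p1 p2)))"
        by (rule sw_assoc[where s=scale]) (simp add: K_def[abs_def])
      also have "\<dots> = sw Lam (\<lambda>p1 w. G (a * p1) (c * S w) (b * d * 1 * f))"
        unfolding K_def[abs_def]
        by (rule sw_cong, rule sw_cancel(2)[where s=scale and F="\<lambda>x y. G (a * _) (c * S y) (b * d * x * f)"]) simp
      finally show "sw Lam (\<lambda>p q. sw p (\<lambda>p1 p2. sw q (K a b c d p1 p2)))
        = G' a c (b * d * f)" by (simp add: G'_def)
    qed
    finally show ?thesis .
  qed
  have "z_sum (Suc n) (\<lambda>u v. sw u (\<lambda>a b. sw v (\<lambda>c d. G a c (b * d * f))))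
    = z_sum n (\<lambda>u v. sw u (\<lambda>a b. sw v (\<lambda>c d. G' a c (b * d * f))))"
    unfolding z_sum_Suc by (rule z_sum_cong) (rule step)
  also have "\<dots> = z_sum n (\<lambda>u v. G' u v f)" by (rule Suc.IH[OF \<open>tril scale G'\<close>])
  also have "\<dots> = z_sum (Suc n) (\<lambda>u v. G u v f)" by (simp add: z_sum_Suc G'_def)
  finally show ?case .
qed

lemma z_elem_coinvariant:
  assumes f: "central_idempotent f" and comm: "\<And>x y. x * y * f = y * x * f" and F: "bil scale F"
  shows "sw (z_elem n) (\<lambda>a b. F a (b * f)) = F (z_elem n) f"
proof -
  note [simp] = lin_bil_left[OF F] lin_bil_right[OF F]
  have "sw (z_elem n) (\<lambda>a b. F a (b * f)) = z_sum n (\<lambda>u v. sw (u * v) (\<lambda>a b. F a (b * f)))"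
    unfolding z_elem_z_sum by (rule lin_z_sum) simp
  also have "\<dots> = z_sum n (\<lambda>u v. sw u (\<lambda>a b. sw v (\<lambda>c d. F (a * c) (b * d * f))))"
    by (simp add: sw_mult[where s=scale])
  also have "\<dots> = z_sum n (\<lambda>u v. F (u * v) f)"
    by (rule z_sum_coinvariant[OF f comm]) simp
  also have "\<dots> = F (z_elem n) f"
    unfolding z_elem_z_sum by (rule lin_z_sum[symmetric]) simp
  finally show ?thesis .
qed

lemma generated_le_abelianizing:
  assumes "abelianizing M"
  shows "generated_algebra (z_coideal n) \<subseteq> M"
proof -
  have M: "subalgebra M" "left_coideal M" "normal M" "commutative_quotient M"
    using assms unfolding abelianizing_def by blast+
  obtain f where f: "central_idempotent f" "\<And>x. x \<in> quotient_ideal M \<Longrightarrow> x * f = 0" "1 - f \<in> quotient_ideal M"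
    "\<And>m. m \<in> M \<Longrightarrow> m * f = counit m *s f" "f \<noteq> 0"
    using quotient_idempotent[OF M(1,3)] by blast
  have "f \<in> M" by (rule quotient_idempotent_mem[OF M(1-3) f(1,3-5)])
  have comm: "x * y * f = y * x * f" for x y
    using f(2)[of "x * y - y * x"] M(4) by (simp add: commutative_quotient_def left_diff_distrib)
  have "f * f = f" using f(1) unfolding central_idempotent_def by blast
  have "z_elem n \<in> M"
    by (rule coinvariant_mem[OF M(2) \<open>f \<in> M\<close> \<open>f * f = f\<close> f(5)]) (rule z_elem_coinvariant[OF f(1) comm])
  then have "z_coideal n \<subseteq> M" using M(2) unfolding z_coideal_alt left_coideal_iff by blast
  then show ?thesis by (rule generated_minimal[OF _ M(1)])
qed

end

theorem theorem2p12:
  fixes scale :: "'k::{alg_closed_field,field_char_0} \<Rightarrow> 'h::ring_1 \<Rightarrow> 'h"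
    and comult :: "'h \<Rightarrow> ('h \<times> 'h) list"
    and counit :: "'h \<Rightarrow> 'k"
    and antipode :: "'h \<Rightarrow> 'h"
    and n :: nat
  assumes "hopf_algebra scale comult counit antipode"
    and "hopf_algebra.semisimple scale"
    and "n \<ge> 2"
  shows "hopf_algebra.left_coideal scale comult
           (hopf_algebra.z_coideal scale comult counit antipode n) \<and>
         (\<forall>N. hopf_algebra.is_commutator_subalgebra scale comult counit antipode N \<longleftrightarrow>
           N = hopf_algebra.generated_algebra scale
                 (hopf_algebra.z_coideal scale comult counit antipode n))"
proof -
  interpret semisimple_hopf_algebra scale comult counit antipode
    using assms(1,2) by (simp add: semisimple_hopf_algebra_def semisimple_hopf_algebra_axioms_def)
  have "is_commutator_subalgebra N \<longleftrightarrow> N = generated_algebra (z_coideal n)" for N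
    unfolding is_commutator_subalgebra_def
    using abelianizing_generated[OF assms(3)] generated_le_abelianizing[where n=n] by blast
  then show ?thesis using left_coideal_z_coideal by blast
qed

end
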